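(* Let $B$ be an almost polycyclic brace. Then $B$ is supersoluble if and only if every finite homomorphic image of $B$ is supersoluble.
   Context: A brace (skew left brace) is a set $B$ with two binary operations $+$ and $\cdot$ such that $(B,+)$ and $(B,\cdot)$ are groups and $a(b+c)=ab-a+ac$ for all $a,b,c\in B$. $\lambda_a(b)=-a+ab$ defines a homomorphism $\lambda\colon(B,\cdot)\to\operatorname{Aut}(B,+)$. A subbrace is a subset that is a subgroup of both groups; an ideal is a subbrace normal in both groups and invariant under all $\lambda_b$; quotients by ideals are braces; homomorphic images are quotients by ideals. $\operatorname{Soc}(B)=\operatorname{Ker}\lambda\cap Z(B,+)$. $B$ is supersoluble if there is a finite chain of ideals $\{0\}=I_0\le\dots\le I_n=B$ such that for each $i$, either $(I_{i+1}/I_i,+)$ is infinite cyclic and $I_{i+1}/I_i\le\operatorname{Soc}(B/I_i)$, or $I_{i+1}/I_i$ has prime order. $B$ is almost polycyclic if there is a finite chain of ideals $\{0\}=J_0\le\dots\le J_n=B$ such that for each $i$, either $J_{i+1}/J_i\le\operatorname{Soc}(B/J_i)$ and $J_{i+1}/J_i$ is finitely generated as a brace, or $J_{i+1}/J_i$ is finite. *)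

theory Defs
  imports "HOL-Algebra.Coset" "HOL-Algebra.Generated_Groups" "HOL-Computational_Algebra.Primes"
begin

text \<open>A (skew left) brace: a carrier with an addition (not necessarily commutative),
  a multiplication and a common neutral element (the neutral elements of the two groups
  of a brace always coincide).\<close>
record 'a brace =
  bcar  :: "'a set"
  badd  :: "'a \<Rightarrow> 'a \<Rightarrow> 'a"
  bmul  :: "'a \<Rightarrow> 'a \<Rightarrow> 'a"
  bzero :: 'a

definition addG :: "'a brace \<Rightarrow> 'a monoid" where
  "addG B = \<lparr>carrier = bcar B, monoid.mult = badd B, monoid.one = bzero B\<rparr>"

definition mulG :: "'a brace \<Rightarrow> 'a monoid" where
  "mulG B = \<lparr>carrier = bcar B, monoid.mult = bmul B, monoid.one = bzero B\<rparr>"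

definition bneg :: "'a brace \<Rightarrow> 'a \<Rightarrow> 'a" where
  "bneg B a = inv\<^bsub>addG B\<^esub> a"

definition is_brace :: "'a brace \<Rightarrow> bool" where
  "is_brace B \<longleftrightarrow> group (addG B) \<and> group (mulG B) \<and>
     (\<forall>a\<in>bcar B. \<forall>b\<in>bcar B. \<forall>c\<in>bcar B.
        bmul B a (badd B b c) = badd B (badd B (bmul B a b) (bneg B a)) (bmul B a c))"

definition lam :: "'a brace \<Rightarrow> 'a \<Rightarrow> 'a \<Rightarrow> 'a" where
  "lam B a b = badd B (bneg B a) (bmul B a b)"

definition subbrace :: "'a brace \<Rightarrow> 'a set \<Rightarrow> bool" where
  "subbrace B S \<longleftrightarrow> subgroup S (addG B) \<and> subgroup S (mulG B)"

definition brace_ideal :: "'a brace \<Rightarrow> 'a set \<Rightarrow> bool" where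
  "brace_ideal B I \<longleftrightarrow> subbrace B I \<and> normal I (addG B) \<and> normal I (mulG B) \<and>
     (\<forall>b\<in>bcar B. \<forall>x\<in>I. lam B b x \<in> I)"

definition restrict_brace :: "'a brace \<Rightarrow> 'a set \<Rightarrow> 'a brace" where
  "restrict_brace B S = B\<lparr>bcar := S\<rparr>"

text \<open>Quotient brace B/I: the additive cosets of I, with induced addition and
  multiplication (well defined when I is an ideal).\<close>
definition quot_brace :: "'a brace \<Rightarrow> 'a set \<Rightarrow> 'a set brace" where
  "quot_brace B I = \<lparr>bcar = rcosets\<^bsub>addG B\<^esub> I,
      badd = (\<lambda>X Y. X <#>\<^bsub>addG B\<^esub> Y),
      bmul = (\<lambda>X Y. I #>\<^bsub>addG B\<^esub> bmul B (SOME x. x \<in> X) (SOME y. y \<in> Y)),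
      bzero = I\<rparr>"

definition Soc :: "'a brace \<Rightarrow> 'a set" where
  "Soc B = {a \<in> bcar B. (\<forall>b\<in>bcar B. lam B a b = b) \<and> (\<forall>b\<in>bcar B. badd B a b = badd B b a)}"

definition infinite_cyclic_add :: "'a brace \<Rightarrow> bool" where
  "infinite_cyclic_add B \<longleftrightarrow> infinite (bcar B) \<and>
     (\<exists>g\<in>bcar B. generate (addG B) {g} = bcar B)"

definition brace_generate :: "'a brace \<Rightarrow> 'a set \<Rightarrow> 'a set" where
  "brace_generate B F = \<Inter>{S. subbrace B S \<and> F \<subseteq> S}"

definition fin_gen_brace :: "'a brace \<Rightarrow> bool" where
  "fin_gen_brace B \<longleftrightarrow> (\<exists>F. finite F \<and> F \<subseteq> bcar B \<and> brace_generate B F = bcar B)"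

definition supersoluble :: "'a brace \<Rightarrow> bool" where
  "supersoluble B \<longleftrightarrow> (\<exists>(n::nat) (I::nat \<Rightarrow> 'a set).
     I 0 = {bzero B} \<and> I n = bcar B \<and> (\<forall>i\<le>n. brace_ideal B (I i)) \<and>
     (\<forall>i<n. I i \<subseteq> I (Suc i) \<and>
        ((infinite_cyclic_add (quot_brace (restrict_brace B (I (Suc i))) (I i)) \<and>
          bcar (quot_brace (restrict_brace B (I (Suc i))) (I i)) \<subseteq> Soc (quot_brace B (I i)))
         \<or> prime (card (bcar (quot_brace (restrict_brace B (I (Suc i))) (I i)))))))"

definition almost_polycyclic :: "'a brace \<Rightarrow> bool" where
  "almost_polycyclic B \<longleftrightarrow> (\<exists>(n::nat) (J::nat \<Rightarrow> 'a set).
     J 0 = {bzero B} \<and> J n = bcar B \<and> (\<forall>i\<le>n. brace_ideal B (J i)) \<and>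
     (\<forall>i<n. J i \<subseteq> J (Suc i) \<and>
        ((bcar (quot_brace (restrict_brace B (J (Suc i))) (J i)) \<subseteq> Soc (quot_brace B (J i)) \<and>
          fin_gen_brace (quot_brace (restrict_brace B (J (Suc i))) (J i)))
         \<or> finite (bcar (quot_brace (restrict_brace B (J (Suc i))) (J i))))))"

end

theory Submission
  imports Defs "HOL-Computational_Algebra.Polynomial"
begin

text \<open>
  If some quotient of \<open>B\<close> is not supersoluble, choose an ideal \<open>I\<close> maximal with this property; it exists
  because every subgroup of the additive group of \<open>B\<close> is finitely generated. Then \<open>Q = B/I\<close> is
  infinite, all its proper quotients are supersoluble, and it has a nonzero ideal that is finite or
  contained in the socle.

  If \<open>Q\<close> has a finite nonzero ideal \<open>F\<close>, then supersolubility of \<open>Q/F\<close> together with a pigeonhole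
  argument yields infinitely many elements of the socle in a finite-by-cyclic ideal, hence a nonzero
  ideal \<open>W\<close> with \<open>F \<inter> W = 0\<close>; intersecting a supersoluble series above \<open>W\<close> with \<open>F\<close> gives one of \<open>Q\<close>.

  Otherwise \<open>Q\<close> has a torsion-free finitely generated ideal \<open>A\<close> in the socle, and for every prime \<open>p\<close>
  supersolubility of \<open>Q/pA\<close> says that the \<open>\<lambda>\<close>-action is triangular on \<open>A/pA\<close>. Each \<open>\<lambda>\<^sub>b\<close> therefore has
  eigenvalues in the prime field for all \<open>p\<close>, which forces its eigenvalues to be \<open>1\<close> or \<open>-1\<close>: a monic
  integer polynomial without integer roots cannot split into distinct linear factors modulo almost all
  primes. Hence the squares act unipotently, they have a common nonzero fixed vector \<open>v\<close>, and commuting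
  involutions act on such vectors; so some \<open>v \<noteq> 0\<close> satisfies \<open>\<lambda>\<^sub>b(v) = v\<close> or \<open>\<lambda>\<^sub>b(v) = -v\<close> for all \<open>b\<close>, and the infinite
  cyclic ideal generated by \<open>v\<close> starts a supersoluble series.
\<close>

subsection \<open>Integer polynomials that split modulo almost all primes\<close>

text \<open>The statement on polynomials is classically a consequence of the density theorems of
  Frobenius or Chebotarev. Here it is an elementary count in the manner of Gallagher's larger sieve:
  values of the homogenised polynomial at differences of points in a box are bounded in size, yet a
  full set of roots modulo every large prime puts too many prime factors into them. The module
  theory stays over the integers, without rational vector spaces, fields with \<open>p\<close>
  elements or determinants. A polynomial of least degree killing some nonzero element replaces an
  irreducible factor of the characteristic polynomial; Gauss's lemma makes it monic, so its degree
  survives reduction modulo \<open>p\<close>. The flags for different primes are unrelated. What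
  ties them together is a bound on their length that is independent of \<open>p\<close>: a product
  of boundedly many operators then has values in \<open>pA\<close> for every \<open>p\<close>, hence
  vanishes. Squares are used because over the integers, where 2 is not invertible, \<open>A\<close>
  need not split into eigenspaces for \<open>1\<close> and \<open>-1\<close>.\<close>

lemma multiplicity_fact_bound:
  fixes p :: nat
  assumes "prime p"
  shows "(\<Sum>m\<in>{1..n}. multiplicity p m) * (p - 1) \<le> n"
proof (induction n rule: less_induct)
  case (less n)
  have p: "p \<ge> 2" using assms by (rule prime_ge_2_nat)
  \<comment> \<open>Legendre's recursion for the exponent of \<open>p\<close> in \<open>n!\<close>:
    only the multiples \<open>p * j\<close> contribute, each one more than \<open>j\<close> does.
    The geometric decay gives the bound \<open>n / (p - 1)\<close>.\<close>
  have "(\<Sum>m\<in>{1..n}. multiplicity p m) = (\<Sum>m\<in>(*) p ` {1..n div p}. multiplicity p m)"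
  proof (rule sum.mono_neutral_right)
    show "(*) p ` {1..n div p} \<subseteq> {1..n}"
      using p by (auto simp: less_eq_div_iff_mult_less_eq mult.commute)
    show "\<forall>m\<in>{1..n} - (*) p ` {1..n div p}. multiplicity p m = 0"
    proof
      fix m assume m: "m \<in> {1..n} - (*) p ` {1..n div p}"
      have "\<not> p dvd m"
      proof
        assume "p dvd m"
        then obtain j where "m = p * j" by auto
        with m p have "j \<in> {1..n div p}" by (auto simp: less_eq_div_iff_mult_less_eq mult.commute)
        with \<open>m = p * j\<close> m show False by blast
      qed
      then show "multiplicity p m = 0" by (rule not_dvd_imp_multiplicity_0)
    qed
  qed simp
  also have "\<dots> = (\<Sum>j\<in>{1..n div p}. multiplicity p (p * j))"
    using p by (subst sum.reindex) (auto simp: inj_on_def)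
  also have "\<dots> = (\<Sum>j\<in>{1..n div p}. Suc (multiplicity p j))"
  proof (rule sum.cong)
    fix j assume "j \<in> {1..n div p}"
    with p show "multiplicity p (p * j) = Suc (multiplicity p j)"
      by (intro multiplicity_times_same) auto
  qed simp
  also have "\<dots> = n div p + (\<Sum>j\<in>{1..n div p}. multiplicity p j)"
    by (simp add: sum_Suc)
  finally have eq: "(\<Sum>m\<in>{1..n}. multiplicity p m) = n div p + (\<Sum>j\<in>{1..n div p}. multiplicity p j)" .
  show ?case
  proof (cases "n = 0")
    case False
    have "(\<Sum>j\<in>{1..n div p}. multiplicity p j) * (p - 1) \<le> n div p"
      using False p by (intro less.IH) (auto intro: div_less_dividend)
    then have "(\<Sum>m\<in>{1..n}. multiplicity p m) * (p - 1) \<le> n div p * (p - 1) + n div p"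
      unfolding eq by (simp add: add_mult_distrib)
    also have "\<dots> = n div p * p" using p by (cases p) auto
    also have "\<dots> \<le> n" by simp
    finally show ?thesis .
  qed simp
qed

text \<open>Unique factorisation in logarithmic form. The sum runs over all primes up to
  \<open>n\<close>, not just those dividing \<open>m\<close>, so that the index set is the same for
  all \<open>m\<close> and sums can be swapped.\<close>

lemma ln_nat_prime_sum:
  assumes "m \<in> {1..n}"
  shows "ln (real m) = (\<Sum>p | prime p \<and> p \<le> n. real (multiplicity p m) * ln (real p))"
proof -
  have "m = (\<Prod>p\<in>prime_factors m. p ^ multiplicity p m)"
    using assms by (subst prime_factorization_nat[of m]) auto
  then have "real m = (\<Prod>p\<in>prime_factors m. real p ^ multiplicity p m)"
    by (metis (no_types, lifting) of_nat_power of_nat_prod prod.cong)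
  then have "ln (real m) = ln (\<Prod>p\<in>prime_factors m. real p ^ multiplicity p m)" by simp
  also have "\<dots> = (\<Sum>p\<in>prime_factors m. ln (real p ^ multiplicity p m))"
    by (intro ln_prod) (auto dest: in_prime_factors_imp_prime prime_gt_0_nat)
  also have "\<dots> = (\<Sum>p\<in>prime_factors m. real (multiplicity p m) * ln (real p))"
    by (simp add: ln_realpow)
  also have "\<dots> = (\<Sum>p | prime p \<and> p \<le> n. real (multiplicity p m) * ln (real p))"
  proof (rule sum.mono_neutral_left)
    show "prime_factors m \<subseteq> {p. prime p \<and> p \<le> n}"
      using assms by (auto simp: in_prime_factors_iff dest!: dvd_imp_le)
    show "\<forall>p\<in>{p. prime p \<and> p \<le> n} - prime_factors m. real (multiplicity p m) * ln (real p) = 0"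
      using assms by (auto simp: in_prime_factors_iff not_dvd_imp_multiplicity_0)
  qed simp
  finally show ?thesis .
qed

text \<open>A weak form of Mertens' first theorem. The logarithm of \<open>n!\<close> is at least
  \<open>n ln n - n\<close>, and by Legendre's bound it is at most \<open>n\<close> times the sum on
  the left.\<close>

lemma sum_ln_prime_lower:
  assumes "n > 0"
  shows "(\<Sum>p | prime p \<and> p \<le> n. ln (real p) / (real p - 1)) \<ge> ln (real n) - 1"
proof -
  let ?P = "{p. prime p \<and> p \<le> n}"
  have "(\<Sum>m\<in>{1..n}. ln (real m)) = (\<Sum>m\<in>{1..n}. \<Sum>p\<in>?P. real (multiplicity p m) * ln (real p))"
    by (intro sum.cong refl ln_nat_prime_sum)
  also have "\<dots> = (\<Sum>p\<in>?P. \<Sum>m\<in>{1..n}. real (multiplicity p m) * ln (real p))"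
    by (rule sum.swap)
  also have "\<dots> = (\<Sum>p\<in>?P. real (\<Sum>m\<in>{1..n}. multiplicity p m) * ln (real p))"
    by (simp add: sum_distrib_right)
  also have "\<dots> \<le> (\<Sum>p\<in>?P. real n * (ln (real p) / (real p - 1)))"
  proof (rule sum_mono)
    fix p assume "p \<in> ?P"
    then have pp: "prime p" and p2: "p \<ge> 2" using prime_ge_2_nat by auto
    have "real ((\<Sum>m\<in>{1..n}. multiplicity p m) * (p - 1)) \<le> real n"
      using multiplicity_fact_bound[OF pp, of n] of_nat_le_iff by blast
    then have "real (\<Sum>m\<in>{1..n}. multiplicity p m) * (real p - 1) \<le> real n"
      using p2 by (simp add: of_nat_diff)
    then have "real (\<Sum>m\<in>{1..n}. multiplicity p m) \<le> real n / (real p - 1)"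
      using p2 by (simp add: pos_le_divide_eq)
    then have "real (\<Sum>m\<in>{1..n}. multiplicity p m) * ln (real p) \<le> real n / (real p - 1) * ln (real p)"
      using p2 by (intro mult_right_mono) auto
    then show "real (\<Sum>m\<in>{1..n}. multiplicity p m) * ln (real p) \<le> real n * (ln (real p) / (real p - 1))"
      by simp
  qed
  finally have 1: "(\<Sum>m\<in>{1..n}. ln (real m)) \<le> real n * (\<Sum>p\<in>?P. ln (real p) / (real p - 1))"
    by (simp add: sum_distrib_left)
  have 2: "real n * ln (real n) - real n \<le> (\<Sum>m\<in>{1..n}. ln (real m))"
  proof (induction n)
    case (Suc n)
    have "real n * ln (real (Suc n)) \<le> real n * ln (real n) + 1"
    proof (cases "n = 0")
      case False
      have "ln (real (Suc n) / real n) \<le> real (Suc n) / real n - 1"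
        using False by (intro ln_le_minus_one) auto
      then have "ln (real (Suc n)) - ln (real n) \<le> 1 / real n"
        using False by (subst (asm) ln_div) (auto simp: field_simps)
      then have "real n * (ln (real (Suc n)) - ln (real n)) \<le> 1"
        using False by (simp add: field_simps)
      then show ?thesis by (simp add: algebra_simps)
    qed simp
    then show ?case using Suc by (simp add: algebra_simps)
  qed simp
  from 1 2 have "real n * (ln (real n) - 1) \<le> real n * (\<Sum>p\<in>?P. ln (real p) / (real p - 1))"
    by (simp add: algebra_simps)
  then show ?thesis using assms by simp
qed

text \<open>Cauchy-Schwarz for the fibre sizes of \<open>\<phi>\<close>: colliding pairs are counted
  by the sum of their squares, which is least when all fibres have equal size.\<close>

lemma card_collision_lower:
  fixes \<phi> :: "'a \<Rightarrow> 'b"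
  assumes "finite S" "finite I" "\<phi> ` S \<subseteq> I" "I \<noteq> {}"
  shows "real (card {(z, z') \<in> S \<times> S. \<phi> z = \<phi> z'}) \<ge> (real (card S))\<^sup>2 / real (card I)"
proof -
  define n where "n = (\<lambda>c. real (card {z \<in> S. \<phi> z = c}))"
  have "{(z, z') \<in> S \<times> S. \<phi> z = \<phi> z'} = (\<Union>c\<in>I. {z \<in> S. \<phi> z = c} \<times> {z \<in> S. \<phi> z = c})"
    using assms(3) by auto
  also have "card \<dots> = (\<Sum>c\<in>I. card ({z \<in> S. \<phi> z = c} \<times> {z \<in> S. \<phi> z = c}))"
    using assms by (intro card_UN_disjoint) auto
  finally have 1: "real (card {(z, z') \<in> S \<times> S. \<phi> z = \<phi> z'}) = (\<Sum>c\<in>I. (n c)\<^sup>2)"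
    by (simp add: n_def card_cartesian_product power2_eq_square)
  have "S = (\<Union>c\<in>I. {z \<in> S. \<phi> z = c})" using assms(3) by auto
  also have "card \<dots> = (\<Sum>c\<in>I. card {z \<in> S. \<phi> z = c})"
    using assms by (intro card_UN_disjoint) auto
  finally have 2: "real (card S) = (\<Sum>c\<in>I. n c)" by (simp add: n_def)
  define k where "k = real (card I)"
  define s where "s = real (card S)"
  have k: "k > 0" using assms by (simp add: k_def card_gt_0_iff)
  have "0 \<le> (\<Sum>c\<in>I. (n c - s / k)\<^sup>2)" by (intro sum_nonneg) simp
  also have "\<dots> = (\<Sum>c\<in>I. (n c)\<^sup>2) - 2 * (s / k) * (\<Sum>c\<in>I. n c) + k * (s / k)\<^sup>2"
    by (simp add: power2_diff sum.distrib sum_subtractf k_def sum_distrib_left[symmetric]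
        sum_distrib_right[symmetric] sum_divide_distrib[symmetric] mult_ac)
  also have "\<dots> = (\<Sum>c\<in>I. (n c)\<^sup>2) - s\<^sup>2 / k"
    using k 2 by (simp add: s_def[symmetric] power2_eq_square)
  finally show ?thesis using 1 by (simp add: s_def k_def)
qed

text \<open>The binary form \<open>w ^ d * f (u / w)\<close> with \<open>d = degree f\<close>,
  written without division. Being homogeneous, it can be evaluated at differences of lattice
  points.\<close>

definition hom_eval :: "int poly \<Rightarrow> int \<Rightarrow> int \<Rightarrow> int" where
  "hom_eval f u w = (\<Sum>i\<le>degree f. coeff f i * u ^ i * w ^ (degree f - i))"

lemma hom_eval_scale: "hom_eval f (g * u) (g * w) = g ^ degree f * hom_eval f u w"
proof -
  have "g ^ degree f = g ^ i * g ^ (degree f - i)" if "i \<le> degree f" for i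
    using that by (simp add: power_add[symmetric])
  then show ?thesis
    unfolding hom_eval_def sum_distrib_left
    by (intro sum.cong refl) (simp add: power_mult_distrib mult_ac)
qed

lemma hom_eval_root: "hom_eval f (r * w) w = w ^ degree f * poly f r"
proof -
  have "w ^ degree f = w ^ i * w ^ (degree f - i)" if "i \<le> degree f" for i
    using that by (simp add: power_add[symmetric])
  then show ?thesis
    unfolding hom_eval_def poly_altdef sum_distrib_left
    by (intro sum.cong refl) (simp add: power_mult_distrib mult_ac)
qed

lemma hom_eval_cong:
  assumes "m dvd u - u'"
  shows "m dvd hom_eval f u w - hom_eval f u' w"
  unfolding hom_eval_def sum_subtractf[symmetric]
proof (rule dvd_sum)
  fix i
  have "u - u' dvd u ^ i - u' ^ i" by (simp add: power_diff_sumr2)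
  then have "m dvd u ^ i - u' ^ i" using assms dvd_trans by blast
  then have "m dvd coeff f i * w ^ (degree f - i) * (u ^ i - u' ^ i)" by simp
  then show "m dvd coeff f i * u ^ i * w ^ (degree f - i) - coeff f i * u' ^ i * w ^ (degree f - i)"
    by (simp add: algebra_simps)
qed

lemma hom_eval_bound:
  assumes "\<bar>u\<bar> \<le> X" "\<bar>w\<bar> \<le> X"
  shows "\<bar>hom_eval f u w\<bar> \<le> (\<Sum>i\<le>degree f. \<bar>coeff f i\<bar>) * X ^ degree f"
proof -
  have "\<bar>hom_eval f u w\<bar> \<le> (\<Sum>i\<le>degree f. \<bar>coeff f i * u ^ i * w ^ (degree f - i)\<bar>)"
    unfolding hom_eval_def by (rule sum_abs)
  also have "\<dots> \<le> (\<Sum>i\<le>degree f. \<bar>coeff f i\<bar> * X ^ degree f)"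
  proof (rule sum_mono)
    fix i assume "i \<in> {..degree f}"
    then have "X ^ degree f = X ^ i * X ^ (degree f - i)" by (simp add: power_add[symmetric])
    moreover have "\<bar>u\<bar> ^ i * \<bar>w\<bar> ^ (degree f - i) \<le> X ^ i * X ^ (degree f - i)"
      using assms by (intro mult_mono power_mono) auto
    ultimately show "\<bar>coeff f i * u ^ i * w ^ (degree f - i)\<bar> \<le> \<bar>coeff f i\<bar> * X ^ degree f"
      by (simp add: abs_mult power_abs mult.assoc mult_left_mono)
  qed
  finally show ?thesis by (simp add: sum_distrib_right)
qed

text \<open>The rational root theorem: a zero with coprime coordinates has \<open>w\<close> dividing
  \<open>u ^ d\<close>, so \<open>w\<close> is a unit and \<open>u * w\<close> is an integer root of
  \<open>f\<close>.\<close>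

lemma hom_eval_nonzero:
  assumes "lead_coeff f = 1" "\<And>a. poly f a \<noteq> 0" "(u, w) \<noteq> (0, 0)"
  shows "hom_eval f u w \<noteq> 0"
proof
  assume z: "hom_eval f u w = 0"
  define d where "d = degree f"
  have split: "hom_eval f x y = x ^ d + y * (\<Sum>i<d. coeff f i * x ^ i * y ^ (d - i - 1))" for x y
  proof -
    have "hom_eval f x y = (\<Sum>i<d. coeff f i * x ^ i * y ^ (d - i)) + x ^ d"
      using assms(1) by (simp add: hom_eval_def d_def lessThan_Suc_atMost[symmetric])
    also have "(\<Sum>i<d. coeff f i * x ^ i * y ^ (d - i)) = (\<Sum>i<d. y * (coeff f i * x ^ i * y ^ (d - i - 1)))"
    proof (rule sum.cong)
      fix i assume "i \<in> {..<d}"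
      then have "y ^ (d - i) = y * y ^ (d - i - 1)" by (simp add: power_eq_if)
      then show "coeff f i * x ^ i * y ^ (d - i) = y * (coeff f i * x ^ i * y ^ (d - i - 1))"
        by (simp add: mult_ac)
    qed simp
    finally show ?thesis by (simp add: sum_distrib_left)
  qed
  define g where "g = gcd u w"
  have g: "g \<noteq> 0" using assms(3) by (auto simp: g_def)
  obtain u' w' where uw: "u = g * u'" "w = g * w'" "coprime u' w'"
    using gcd_coprime_exists[of u w] g unfolding g_def by (metis mult.commute)
  have z': "hom_eval f u' w' = 0" using z g unfolding uw(1,2) hom_eval_scale by simp
  have "w' dvd u' ^ d"
  proof -
    have "u' ^ d = w' * - (\<Sum>i<d. coeff f i * u' ^ i * w' ^ (d - i - 1))"
      using z'[unfolded split] by simp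
    then show ?thesis by (rule dvdI)
  qed
  moreover have "coprime w' (u' ^ d)" using uw(3) by (simp add: coprime_commute)
  ultimately have "w' dvd 1" by (metis coprime_absorb_left)
  then have "w' * w' = 1" by (auto simp: zdvd1_eq abs_if split: if_splits)
  then have "hom_eval f ((u' * w') * w') w' = 0" using z' by (simp add: mult.assoc)
  then have "w' ^ degree f * poly f (u' * w') = 0" by (simp only: hom_eval_root)
  then show False using assms(2) \<open>w' dvd 1\<close> by auto
qed

text \<open>If \<open>p\<close> divides \<open>w\<close> and some root is counted, then
  \<open>p\<close> divides \<open>u\<close> too, and homogeneity yields the factor
  \<open>p ^ degree f\<close>. If \<open>p\<close> does not divide \<open>w\<close>, the congruence
  determines the root modulo \<open>p\<close>, so at most one is counted and it contributes one
  factor \<open>p\<close>.\<close>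

lemma prime_power_dvd_hom_eval:
  fixes p :: nat
  assumes p: "prime p" and R: "R \<subseteq> {0..<int p}" "card R \<le> degree f"
    and root: "\<And>r. r \<in> R \<Longrightarrow> int p dvd poly f r"
  shows "int p ^ card {r \<in> R. int p dvd u - r * w} dvd hom_eval f u w"
proof (cases "int p dvd w")
  case True
  show ?thesis
  proof (cases "{r \<in> R. int p dvd u - r * w} = {}")
    case True
    then show ?thesis by (simp only: card.empty power_0 one_dvd)
  next
    case False
    then obtain r where "int p dvd u - r * w" by blast
    then have "int p dvd u" using True
      by (metis dvd_add_right_iff dvd_mult diff_add_cancel add.commute)
    with True obtain a b where ab: "u = int p * a" "w = int p * b" by (auto elim!: dvdE)
    have "card {r \<in> R. int p dvd u - r * w} \<le> card R"
      using R finite_subset by (intro card_mono) auto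
    with R(2) show ?thesis unfolding ab hom_eval_scale by (intro dvd_mult2 le_imp_power_dvd) simp
  qed
next
  case False
  have pi: "prime (int p)" using p by simp
  have uniq: "r = s" if "r \<in> R" "s \<in> R" "int p dvd u - r * w" "int p dvd u - s * w" for r s
  proof -
    have "int p dvd (s - r) * w" using dvd_diff[OF that(3,4)] by (simp add: algebra_simps)
    then have "int p dvd s - r" using False prime_dvd_multD[OF pi] by blast
    then have "s mod int p = r mod int p" by (simp add: mod_eq_dvd_iff)
    then show ?thesis using that(1,2) R(1) by (force simp: subset_iff)
  qed
  show ?thesis
  proof (cases "{r \<in> R. int p dvd u - r * w} = {}")
    case True
    then show ?thesis by (simp only: card.empty power_0 one_dvd)
  next
    case ne: False
    then obtain r where r: "r \<in> R" "int p dvd u - r * w" by blast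
    then have "{r \<in> R. int p dvd u - r * w} = {r}" using uniq by blast
    then have c: "card {r \<in> R. int p dvd u - r * w} = 1" by simp
    have "int p dvd hom_eval f u w - w ^ degree f * poly f r"
      using hom_eval_cong[OF r(2), of f w] by (simp add: hom_eval_root)
    moreover have "int p dvd w ^ degree f * poly f r" using root[OF r(1)] by simp
    ultimately have "int p dvd hom_eval f u w" by (metis diff_add_cancel dvd_add)
    then show ?thesis unfolding c by simp
  qed
qed

lemma ln_prime_powers_le:
  fixes N :: int and k :: "nat \<Rightarrow> nat"
  assumes "finite P" "\<And>p. p \<in> P \<Longrightarrow> prime p" "\<And>p. p \<in> P \<Longrightarrow> int p ^ k p dvd N" "N \<noteq> 0"
  shows "(\<Sum>p\<in>P. real (k p) * ln (real p)) \<le> ln (real_of_int \<bar>N\<bar>)"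
proof -
  have "(\<Prod>p\<in>P. int p ^ k p) dvd N"
    using assms(1-3)
  proof (induction P rule: finite_induct)
    case (insert p P)
    have "coprime (int p ^ k p) (\<Prod>q\<in>P. int q ^ k q)"
      using insert.hyps insert.prems(1)
      by (intro prod_coprime_right) (auto intro!: primes_coprime)
    with insert show ?case by (simp add: divides_mult)
  qed simp
  then have le: "(\<Prod>p\<in>P. int p ^ k p) \<le> \<bar>N\<bar>" using assms(4) by (simp add: zdvd_imp_le)
  have pos: "\<And>p. p \<in> P \<Longrightarrow> p > 0" using assms(2) prime_gt_0_nat by blast
  have "(\<Sum>p\<in>P. real (k p) * ln (real p)) = (\<Sum>p\<in>P. ln (real p ^ k p))"
    using pos by (intro sum.cong refl) (simp add: ln_realpow)
  also have "\<dots> = ln (\<Prod>p\<in>P. real p ^ k p)"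
    using pos assms(1) by (intro ln_prod[symmetric]) auto
  also have "(\<Prod>p\<in>P. real p ^ k p) = real_of_int (\<Prod>p\<in>P. int p ^ k p)" by simp
  also have "ln \<dots> \<le> ln (real_of_int \<bar>N\<bar>)"
  proof (rule ln_mono)
    show "0 < real_of_int (\<Prod>p\<in>P. int p ^ k p)"
      using pos by (auto intro!: prod_pos)
  qed (use le in linarith)
  finally show ?thesis .
qed


text \<open>Average \<open>ln |H|\<close> over pairs of distinct points of a box of side
  \<open>M^2\<close>. The size of the form gives about \<open>2 d ln M\<close>. Each prime
  \<open>p\<close> gives at least about \<open>d ln p / p\<close>, since every one of the
  \<open>d\<close> roots produces its share of collisions modulo \<open>p\<close>; primes up to
  \<open>M^3\<close> add up to about \<open>3 d ln M\<close>. As \<open>M\<close> grows these bounds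
  are incompatible.\<close>

theorem no_split_mod_all_primes:
  fixes f :: "int poly"
  assumes monic: "lead_coeff f = 1" and d: "degree f \<ge> 2" and noroot: "\<And>a. poly f a \<noteq> 0"
    and split: "\<And>p. prime p \<Longrightarrow> p \<ge> P0 \<Longrightarrow>
      \<exists>R\<subseteq>{0..<int p}. card R = degree f \<and> (\<forall>r\<in>R. int p dvd poly f r)"
  shows False
proof -
  define d where "d = degree f"
  \<comment> \<open>For \<open>p >= 4\<close> one has \<open>p / (p - 1) <= 4 / 3\<close>, which
    later allows \<open>p - 1\<close> to be exchanged for \<open>p\<close> in Mertens'
    bound.\<close>
  define Q where "Q = max P0 4"
  define C where "C = (\<Sum>i\<le>degree f. \<bar>coeff f i\<bar>)"
  define c0 where "c0 = (\<Sum>p | prime p \<and> p \<le> Q. ln (real p) / (real p - 1))"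
  have C: "C \<ge> 1"
  proof -
    have "\<bar>coeff f (degree f)\<bar> \<le> C" unfolding C_def by (rule member_le_sum) auto
    then show ?thesis using monic by simp
  qed
  have "\<forall>p\<in>{p. prime p \<and> p \<ge> P0}. \<exists>R. R \<subseteq> {0..<int p} \<and> card R = d \<and> (\<forall>r\<in>R. int p dvd poly f r)"
    using split by (auto simp: d_def)
  from bchoice[OF this] obtain R where R0: "\<forall>p\<in>{p. prime p \<and> p \<ge> P0}.
      R p \<subseteq> {0..<int p} \<and> card (R p) = d \<and> (\<forall>r\<in>R p. int p dvd poly f r)" by blast
  then have R: "\<And>p. prime p \<Longrightarrow> p \<ge> P0 \<Longrightarrow> R p \<subseteq> {0..<int p}"
      "\<And>p. prime p \<Longrightarrow> p \<ge> P0 \<Longrightarrow> card (R p) = d"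
      "\<And>p r. prime p \<Longrightarrow> p \<ge> P0 \<Longrightarrow> r \<in> R p \<Longrightarrow> int p dvd poly f r" by auto
  have bound: "real d * ln (real M) \<le> 4 * ln (real_of_int C) + 3 * real d * (c0 + 5)" if M: "M \<ge> 2" for M :: nat
  proof -
    define S where "S = {0..<int (M^2)} \<times> {0..<int (M^2)}"
    \<comment> \<open>The exponent 3 lies strictly between 2, so that the primes outweigh the box
      side \<open>M^2\<close>, and 4, so that the diagonal pairs stay negligible against the
      \<open>M^4\<close> points of the box.\<close>
    define P where "P = {p. prime p \<and> Q < p \<and> p \<le> M ^ 3}"
    have finP: "finite P" by (simp add: P_def)
    have finS: "finite S" by (simp add: S_def)
    have PP: "prime p" "p \<ge> P0" "p \<ge> 4" "p > 0" "p \<le> M ^ 3" if "p \<in> P" for p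
      using that by (auto simp: P_def Q_def)
    define s where "s = real (card S)"
    have s: "s = real M ^ 4" by (simp add: s_def S_def power_mult[symmetric] power_add[symmetric])
    have M1: "real M \<ge> 2" using M by simp
    have s0: "s > 0" using M1 by (simp add: s)
    define T where "T = {(z, z') \<in> S \<times> S. z \<noteq> z'}"
    have finT: "finite T" using finS by (auto simp: T_def intro: finite_subset[of _ "S \<times> S"])
    have cardT: "real (card T) \<le> s\<^sup>2"
    proof -
      have "card T \<le> card (S \<times> S)" using finS by (intro card_mono) (auto simp: T_def)
      also have "\<dots> = (card S)\<^sup>2" by (simp add: card_cartesian_product power2_eq_square)
      finally show ?thesis unfolding s_def by (metis of_nat_le_iff of_nat_power)
    qed
    define H where "H = (\<lambda>(z, z'). hom_eval f (fst z - fst z') (snd z - snd z'))"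
    define k where "k = (\<lambda>p (z, z'). card {r \<in> R p. int p dvd (fst z - fst z') - r * (snd z - snd z')})"
    have upper: "ln (real_of_int \<bar>H t\<bar>) \<le> ln (real_of_int C) + 2 * real d * ln (real M)"
      and lower: "(\<Sum>p\<in>P. real (k p t) * ln (real p)) \<le> ln (real_of_int \<bar>H t\<bar>)" if t: "t \<in> T" for t
    proof -
      obtain z z' where tz: "t = (z, z')" by (cases t)
      have zS: "z \<in> S" "z' \<in> S" "z \<noteq> z'" using t by (auto simp: T_def tz)
      have ne: "(fst z - fst z', snd z - snd z') \<noteq> (0, 0)" using zS(3) by (auto simp: prod_eq_iff)
      have Hne: "H t \<noteq> 0" unfolding H_def tz using hom_eval_nonzero[OF monic noroot ne] by simp
      have "\<bar>H t\<bar> \<le> C * int (M^2) ^ d"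
        unfolding H_def tz C_def d_def prod.case
        using zS by (intro hom_eval_bound) (auto simp: S_def)
      then have "real_of_int \<bar>H t\<bar> \<le> real_of_int (C * int (M^2) ^ d)" by (simp only: of_int_le_iff)
      then have "ln (real_of_int \<bar>H t\<bar>) \<le> ln (real_of_int (C * int (M^2) ^ d))"
        using Hne by (intro ln_mono) auto
      also have "\<dots> = ln (real_of_int C * real M ^ (2 * d))" by (simp add: power_mult)
      also have "\<dots> = ln (real_of_int C) + 2 * real d * ln (real M)"
        using C M1 by (subst ln_mult_pos) (auto simp: ln_realpow)
      finally show "ln (real_of_int \<bar>H t\<bar>) \<le> ln (real_of_int C) + 2 * real d * ln (real M)" .
      show "(\<Sum>p\<in>P. real (k p t) * ln (real p)) \<le> ln (real_of_int \<bar>H t\<bar>)"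
      proof (rule ln_prime_powers_le)
        fix p assume p: "p \<in> P"
        show "int p ^ k p t dvd H t" unfolding k_def H_def tz prod.case
          using R[OF PP(1,2)[OF p]] PP(1)[OF p] by (intro prime_power_dvd_hom_eval) (auto simp: d_def)
      qed (use finP PP Hne in auto)
    qed
    \<comment> \<open>Each root \<open>r\<close> gives a linear map from the box to the residues
      modulo \<open>p\<close>. Its colliding pairs are exactly those counted in \<open>k\<close> for
      that root, up to the \<open>s\<close> diagonal pairs, which have to be removed.\<close>
    have ksum: "(\<Sum>t\<in>T. real (k p t)) \<ge> real d * (s\<^sup>2 / real p - s)" if p: "p \<in> P" for p
    proof -
      have fR: "finite (R p)" using R(1)[OF PP(1,2)[OF p]] finite_subset by auto
      have "(\<Sum>t\<in>T. k p t) = (\<Sum>t\<in>T. \<Sum>r\<in>R p. if int p dvd (fst (fst t) - fst (snd t)) - r * (snd (fst t) - snd (snd t)) then 1 else 0)"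
        by (intro sum.cong refl) (auto simp: k_def split: prod.split simp: sum.If_cases[OF fR] Int_def)
      also have "\<dots> = (\<Sum>r\<in>R p. \<Sum>t\<in>T. if int p dvd (fst (fst t) - fst (snd t)) - r * (snd (fst t) - snd (snd t)) then 1 else 0)"
        by (rule sum.swap)
      also have "\<dots> = (\<Sum>r\<in>R p. card {t \<in> T. int p dvd (fst (fst t) - fst (snd t)) - r * (snd (fst t) - snd (snd t))})"
        by (intro sum.cong refl) (simp add: sum.If_cases[OF finT] Int_def)
      finally have 0: "(\<Sum>t\<in>T. k p t) = (\<Sum>r\<in>R p. card {t \<in> T. int p dvd (fst (fst t) - fst (snd t)) - r * (snd (fst t) - snd (snd t))})" .
      have 1: "(\<Sum>t\<in>T. real (k p t)) = (\<Sum>r\<in>R p. real (card {t \<in> T. int p dvd (fst (fst t) - fst (snd t)) - r * (snd (fst t) - snd (snd t))}))"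
        using arg_cong[OF 0, of real] by (simp only: of_nat_sum)
      have "(\<Sum>r\<in>R p. s\<^sup>2 / real p - s) \<le> (\<Sum>r\<in>R p. real (card {t \<in> T. int p dvd (fst (fst t) - fst (snd t)) - r * (snd (fst t) - snd (snd t))}))"
      proof (rule sum_mono)
        fix r assume "r \<in> R p"
        define \<phi> where "\<phi> = (\<lambda>z::int \<times> int. (fst z - r * snd z) mod int p)"
        define E where "E = {t \<in> T. int p dvd (fst (fst t) - fst (snd t)) - r * (snd (fst t) - snd (snd t))}"
        have "s\<^sup>2 / real (card {0..<int p}) \<le> real (card {(z, z') \<in> S \<times> S. \<phi> z = \<phi> z'})"
          unfolding s_def using finS PP[OF p] by (intro card_collision_lower) (auto simp: \<phi>_def)
        also have "{(z, z') \<in> S \<times> S. \<phi> z = \<phi> z'} \<subseteq> E \<union> (\<lambda>z. (z, z)) ` S"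
          by (auto simp: E_def T_def \<phi>_def mod_eq_dvd_iff algebra_simps)
        then have "real (card {(z, z') \<in> S \<times> S. \<phi> z = \<phi> z'}) \<le> real (card (E \<union> (\<lambda>z. (z, z)) ` S))"
          using finS finT by (intro of_nat_mono card_mono) (auto simp: E_def)
        also have "\<dots> \<le> real (card E + card ((\<lambda>z. (z, z)) ` S))"
          by (intro of_nat_mono card_Un_le)
        also have "\<dots> \<le> real (card E) + s"
          using card_image_le[OF finS, of "\<lambda>z. (z, z)"] by (simp add: s_def)
        finally show "s\<^sup>2 / real p - s \<le> real (card E)" by simp
      qed
      then show ?thesis using 1 R(2)[OF PP(1,2)[OF p]] by simp
    qed
    have lnP: "ln (real p) \<ge> 0" if "p \<in> P" for p using PP[OF that] by simp
    have "(\<Sum>p\<in>P. ln (real p) * (real d * (s\<^sup>2 / real p - s))) \<le> (\<Sum>p\<in>P. ln (real p) * (\<Sum>t\<in>T. real (k p t)))"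
      using ksum lnP by (intro sum_mono mult_left_mono) auto
    also have "\<dots> = (\<Sum>p\<in>P. \<Sum>t\<in>T. real (k p t) * ln (real p))"
      by (simp add: sum_distrib_left mult_ac)
    also have "\<dots> = (\<Sum>t\<in>T. \<Sum>p\<in>P. real (k p t) * ln (real p))"
      by (rule sum.swap)
    also have "\<dots> \<le> (\<Sum>t\<in>T. ln (real_of_int C) + 2 * real d * ln (real M))"
      using upper lower by (intro sum_mono) (meson order_trans)
    also have "\<dots> = real (card T) * (ln (real_of_int C) + 2 * real d * ln (real M))" by simp
    also have "\<dots> \<le> s\<^sup>2 * (ln (real_of_int C) + 2 * real d * ln (real M))"
      using cardT C M1 by (intro mult_right_mono) auto
    finally have main: "(\<Sum>p\<in>P. ln (real p) * (real d * (s\<^sup>2 / real p - s))) \<le> s\<^sup>2 * (ln (real_of_int C) + 2 * real d * ln (real M))" .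
    have "(\<Sum>p\<in>P. ln (real p) * (real d * (s\<^sup>2 / real p - s))) = s\<^sup>2 * (real d * (\<Sum>p\<in>P. ln (real p) / real p)) - s * (real d * (\<Sum>p\<in>P. ln (real p)))"
      by (simp add: sum_distrib_left sum_subtractf[symmetric] algebra_simps)
    \<comment> \<open>The diagonal costs \<open>s\<close> for each prime and root. Crude bounds
      suffice: at most \<open>M^3\<close> primes, each with logarithm at most \<open>3 M\<close>,
      and \<open>M^3 * 3 M = 3 s\<close>.\<close>
    moreover have "(\<Sum>p\<in>P. ln (real p)) \<le> s * 3"
    proof -
      have "(\<Sum>p\<in>P. ln (real p)) \<le> (\<Sum>p\<in>P. 3 * real M)"
      proof (rule sum_mono)
        fix p assume p: "p \<in> P"
        have "real p \<le> real (M ^ 3)" using PP(5)[OF p] by (simp only: of_nat_le_iff)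
        then have "ln (real p) \<le> ln (real M ^ 3)" using PP[OF p] by (intro ln_mono) auto
        also have "\<dots> = 3 * ln (real M)" using M1 by (simp add: ln_realpow)
        also have "\<dots> \<le> 3 * real M" using ln_le_minus_one[of "real M"] M1 by simp
        finally show "ln (real p) \<le> 3 * real M" .
      qed
      also have "\<dots> = real (card P) * (3 * real M)" by simp
      also have "\<dots> \<le> real (M ^ 3) * (3 * real M)"
      proof (intro mult_right_mono of_nat_mono)
        have "card P \<le> card {1..M ^ 3}" by (intro card_mono) (auto simp: P_def dest: prime_gt_0_nat)
        then show "card P \<le> M ^ 3" by simp
      qed simp
      also have "\<dots> = s * 3" by (simp add: s power_Suc[symmetric] numeral_eq_Suc)
      finally show ?thesis .
    qed
    then have "s * (real d * (\<Sum>p\<in>P. ln (real p))) \<le> s * (real d * (s * 3))"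
      using s0 by (intro mult_left_mono) auto
    ultimately have "s\<^sup>2 * (real d * (\<Sum>p\<in>P. ln (real p) / real p)) \<le> s\<^sup>2 * (3 * real d + ln (real_of_int C) + 2 * real d * ln (real M))"
      using main by (simp add: power2_eq_square algebra_simps)
    then have A: "real d * (\<Sum>p\<in>P. ln (real p) / real p) \<le> 3 * real d + ln (real_of_int C) + 2 * real d * ln (real M)"
      using s0 by simp
    have "ln (real (M ^ 3)) - 1 \<le> (\<Sum>p | prime p \<and> p \<le> M ^ 3. ln (real p) / (real p - 1))"
      using M by (intro sum_ln_prime_lower) simp
    also have "\<dots> \<le> (\<Sum>p \<in> P \<union> {p. prime p \<and> p \<le> Q}. ln (real p) / (real p - 1))"
      by (intro sum_mono2) (auto simp: P_def dest: prime_gt_0_nat intro!: divide_nonneg_nonneg)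
    also have "\<dots> = (\<Sum>p\<in>P. ln (real p) / (real p - 1)) + c0"
      unfolding c0_def using finP by (intro sum.union_disjoint) (auto simp: P_def)
    \<comment> \<open>The loss of the factor \<open>4 / 3\<close> is affordable, because
      \<open>3 * 3 / 4 = 9 / 4\<close> still exceeds 2.\<close>
    also have "(\<Sum>p\<in>P. ln (real p) / (real p - 1)) \<le> (\<Sum>p\<in>P. 4 / 3 * (ln (real p) / real p))"
    proof (rule sum_mono)
      fix p assume p: "p \<in> P"
      have "ln (real p) / (real p - 1) \<le> ln (real p) / (3 / 4 * real p)"
        using PP[OF p] lnP[OF p] by (intro divide_left_mono) auto
      then show "ln (real p) / (real p - 1) \<le> 4 / 3 * (ln (real p) / real p)" by simp
    qed
    finally have B: "3 * ln (real M) - 1 - c0 \<le> 4 / 3 * (\<Sum>p\<in>P. ln (real p) / real p)"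
      using M1 by (simp add: ln_realpow sum_distrib_left)
    have "real d * (3 * ln (real M) - 1 - c0) \<le> real d * (4 / 3 * (\<Sum>p\<in>P. ln (real p) / real p))"
      using B by (intro mult_left_mono) auto
    then show ?thesis using A by (simp add: algebra_simps)
  qed
  define K where "K = 4 * ln (real_of_int C) + 3 * real d * (c0 + 5)"
  have dpos: "real d \<ge> 2" using d by (simp add: d_def)
  obtain M :: nat where M: "real M > exp \<bar>K\<bar> + 2" using reals_Archimedean2 by blast
  then have "exp \<bar>K\<bar> < real M" by simp
  then have "ln (exp \<bar>K\<bar>) < ln (real M)"
    using M exp_gt_zero[of "\<bar>K\<bar>"] by (subst ln_less_cancel_iff) linarith+
  then have "ln (real M) > \<bar>K\<bar>" by simp
  moreover have "M \<ge> 2" using M exp_gt_zero[of "\<bar>K\<bar>"] by linarith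
  ultimately have "real d * ln (real M) > K" 
    using dpos mult_right_mono[of 1 "real d" "ln (real M)"] by linarith
  with bound[OF \<open>M \<ge> 2\<close>] show False by (simp add: K_def)
qed

subsection \<open>Groups all of whose subgroups are finitely generated\<close>

lemma int_subgroup_generator:
  fixes D :: "int set"
  assumes "0 \<in> D" and diff: "\<And>x y. x \<in> D \<Longrightarrow> y \<in> D \<Longrightarrow> x - y \<in> D"
  shows "\<exists>d\<in>D. \<forall>k\<in>D. d dvd k"
proof (cases "D \<subseteq> {0}")
  case True
  then show ?thesis using assms(1) by blast
next
  case False
  have neg: "- x \<in> D" if "x \<in> D" for x using diff[OF assms(1) that] by simp
  have add: "x + y \<in> D" if "x \<in> D" "y \<in> D" for x y using diff[OF that(1) neg[OF that(2)]] by simp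
  have mult: "int n * x \<in> D" if "x \<in> D" for n x
    by (induction n) (use assms(1) add that in \<open>auto simp: algebra_simps\<close>)
  have zmult: "k * x \<in> D" if "x \<in> D" for k x
    using mult[OF that, of "nat k"] mult[OF neg[OF that], of "nat (- k)"] by (cases "k \<ge> 0") auto
  from False obtain x where x: "x \<in> D" "x \<noteq> 0" by blast
  define P where "P = (\<lambda>n::nat. n > 0 \<and> int n \<in> D)"
  have "\<exists>n. P n"
  proof (cases "x > 0")
    case True
    with x show ?thesis by (intro exI[of _ "nat x"]) (simp add: P_def)
  next
    case False
    with x neg show ?thesis by (intro exI[of _ "nat (- x)"]) (simp add: P_def)
  qed
  then have P: "P (LEAST n. P n)" by (rule LeastI_ex)
  define d where "d = int (LEAST n. P n)"
  have d: "d > 0" "d \<in> D" using P by (auto simp: d_def P_def)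
  have "d dvd k" if "k \<in> D" for k
  proof (rule ccontr)
    assume "\<not> d dvd k"
    then have "k mod d > 0" using d by (simp add: dvd_eq_mod_eq_0 order_less_le)
    moreover have "k mod d \<in> D"
      using diff[OF that zmult[OF d(2), of "k div d"]] by (simp add: minus_div_mult_eq_mod)
    ultimately have "P (nat (k mod d))" by (simp add: P_def)
    then have "(LEAST n. P n) \<le> nat (k mod d)" by (rule Least_le)
    then have "d \<le> k mod d" using \<open>k mod d > 0\<close> by (simp add: d_def)
    then show False using pos_mod_bound[OF d(1), of k] by linarith
  qed
  with d(2) show ?thesis by blast
qed

text \<open>The Noetherian condition relative to a set \<open>K\<close> of elements. Keeping the
  ambient group fixed lets it be carried up a series of subgroups without changing the
  group.\<close>

definition subgroups_fin_gen :: "('a, 'b) monoid_scheme \<Rightarrow> 'a set \<Rightarrow> bool" where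
  "subgroups_fin_gen G K \<longleftrightarrow> (\<forall>H. subgroup H G \<and> H \<subseteq> K \<longrightarrow> (\<exists>F. finite F \<and> F \<subseteq> H \<and> generate G F = H))"

lemma subgroups_fin_genE:
  assumes "subgroups_fin_gen G K" "subgroup H G" "H \<subseteq> K"
  obtains F where "finite F" "F \<subseteq> H" "generate G F = H"
  using assms unfolding subgroups_fin_gen_def by meson

lemma subgroups_fin_gen_mono: "subgroups_fin_gen G K \<Longrightarrow> K' \<subseteq> K \<Longrightarrow> subgroups_fin_gen G K'"
  by (auto simp: subgroups_fin_gen_def)

context group
begin

lemma subgroups_fin_gen_finite:
  assumes "finite K"
  shows "subgroups_fin_gen G K"
  unfolding subgroups_fin_gen_def
proof (intro allI impI)
  fix H assume H: "subgroup H G \<and> H \<subseteq> K"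
  then have "generate G H = H" using generate_subgroup_incl[of H H] generate.incl[of _ H G] by blast
  with H assms show "\<exists>F. finite F \<and> F \<subseteq> H \<and> generate G F = H" using finite_subset by blast
qed

text \<open>Zorn's lemma: the union of a chain is a finitely generated subgroup, and its finitely
  many generators already lie in one member of the chain. The family is arbitrary, so it may consist
  of ideals, kernels or cyclic groups.\<close>

lemma subgroups_fin_gen_maximal:
  assumes fg: "subgroups_fin_gen G (carrier G)" and "\<A> \<noteq> {}" and sub: "\<And>H. H \<in> \<A> \<Longrightarrow> subgroup H G"
  shows "\<exists>M\<in>\<A>. \<forall>X\<in>\<A>. M \<subseteq> X \<longrightarrow> X = M"
proof (rule subset_Zorn_nonempty[OF assms(2)])
  fix \<C> assume C: "\<C> \<noteq> {}" "subset.chain \<A> \<C>"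
  then have CA: "\<C> \<subseteq> \<A>" and cmp: "\<And>X Y. X \<in> \<C> \<Longrightarrow> Y \<in> \<C> \<Longrightarrow> X \<subseteq> Y \<or> Y \<subseteq> X"
    by (auto simp: subset_chain_def)
  have sg: "subgroup X G" if "X \<in> \<C>" for X using that CA sub by blast
  have "subgroup (\<Union>\<C>) G"
  proof (rule subgroupI)
    show "\<Union>\<C> \<subseteq> carrier G" using subgroup.subset[OF sg] by blast
    obtain X where "X \<in> \<C>" using C(1) by blast
    with subgroup.one_closed[OF sg] show "\<Union>\<C> \<noteq> {}" by (metis UnionI empty_iff)
    fix a assume "a \<in> \<Union>\<C>"
    then obtain X where X: "a \<in> X" "X \<in> \<C>" by (elim UnionE)
    show "inv a \<in> \<Union>\<C>" using UnionI[OF X(2) subgroup.m_inv_closed[OF sg[OF X(2)] X(1)]] .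
    fix b assume "b \<in> \<Union>\<C>"
    then obtain Y where Y: "b \<in> Y" "Y \<in> \<C>" by (elim UnionE)
    from cmp[OF X(2) Y(2)] show "a \<otimes> b \<in> \<Union>\<C>"
    proof
      assume "X \<subseteq> Y"
      then have "a \<otimes> b \<in> Y" using X Y sg[OF Y(2)] by (meson subgroup.m_closed subsetD)
      then show ?thesis using Y(2) by (rule UnionI[rotated])
    next
      assume "Y \<subseteq> X"
      then have "a \<otimes> b \<in> X" using X Y sg[OF X(2)] by (meson subgroup.m_closed subsetD)
      then show ?thesis using X(2) by (rule UnionI[rotated])
    qed
  qed
  from subgroups_fin_genE[OF fg this subgroup.subset[OF this]]
  obtain F where F: "finite F" "F \<subseteq> \<Union>\<C>" "generate G F = \<Union>\<C>" .
  obtain X where X: "X \<in> \<C>" "F \<subseteq> X" using finite_subset_Union_chain[OF F(1,2) C] .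
  then have "\<Union>\<C> \<subseteq> X" using generate_subgroup_incl[OF X(2) sg[OF X(1)]] F(3) by simp
  with X(1) have "\<Union>\<C> = X" by blast
  with X(1) CA show "\<Union>\<C> \<in> \<A>" by blast
qed

lemma subgroups_fin_gen_restrict:
  assumes L: "subgroup L G"
  shows "subgroups_fin_gen (G\<lparr>carrier := L\<rparr>) L \<longleftrightarrow> subgroups_fin_gen G L"
proof -
  have "subgroup H (G\<lparr>carrier := L\<rparr>) \<longleftrightarrow> subgroup H G" if "H \<subseteq> L" for H
    using that L incl_subgroup subgroup_incl by blast
  moreover have "generate (G\<lparr>carrier := L\<rparr>) F = generate G F" if "F \<subseteq> L" for F
    using generate_consistent[OF that L] .
  ultimately show ?thesis unfolding subgroups_fin_gen_def by (smt (verit, ccfv_threshold) order_trans)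
qed

end

context normal
begin

lemma coset_eq_iff:
  assumes "x \<in> carrier G" "y \<in> carrier G"
  shows "H #> x = H #> y \<longleftrightarrow> x \<otimes> inv y \<in> H"
proof
  assume "H #> x = H #> y"
  then have "x \<in> H #> y" using rcos_self[OF assms(1) subgroup_axioms] by simp
  then show "x \<otimes> inv y \<in> H" using rcos_module_imp[OF is_group assms(2)] by blast
next
  assume "x \<otimes> inv y \<in> H"
  then have "x \<in> H #> y" using rcos_module_rev[OF is_group assms(2,1)] by blast
  then show "H #> x = H #> y" using repr_independence[OF _ assms(2) subgroup_axioms] by simp
qed

lemma coset_hom: "group_hom G (G Mod H) ((#>) H)"
  by (intro group_hom.intro group_hom_axioms.intro is_group factorgroup_is_group r_coset_hom_Mod)

lemma coset_mult: "x \<in> carrier G \<Longrightarrow> y \<in> carrier G \<Longrightarrow> H #> (x \<otimes> y) = (H #> x) <#> (H #> y)"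
  by (simp add: rcos_sum)

lemma coset_int_pow: "x \<in> carrier G \<Longrightarrow> H #> (x [^] (k::int)) = (H #> x) [^]\<^bsub>G Mod H\<^esub> k"
  by (simp add: FactGroup_int_pow)

lemma coset_in_Mod: "x \<in> carrier G \<Longrightarrow> H #> x \<in> carrier (G Mod H)"
  by (simp add: carrier_FactGroup)

lemma coset_eq_self: "x \<in> carrier G \<Longrightarrow> H #> x = H \<longleftrightarrow> x \<in> H"
  using coset_eq_iff[of x \<one>] subset by simp

text \<open>The exponents \<open>k\<close> for which the coset of \<open>a [^] k\<close> meets
  \<open>K\<close> form a subgroup of the integers; its generator is realised by an element of
  \<open>K\<close> itself. This matters because \<open>a\<close> need not lie in
  \<open>K\<close>.\<close>

lemma cyclic_mod_subgroup:
  assumes K: "subgroup K G" and a: "a \<in> carrier G"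
    and cyc: "\<And>x. x \<in> K \<Longrightarrow> \<exists>k::int. x \<otimes> inv (a [^] k) \<in> H"
  shows "\<exists>d\<in>K. \<forall>x\<in>K. \<exists>k::int. x \<otimes> inv (d [^] k) \<in> H"
proof -
  interpret Q: group "G Mod H" by (rule factorgroup_is_group)
  interpret h: group_hom G "G Mod H" "(#>) H" by (rule coset_hom)
  have Kc: "x \<in> carrier G" if "x \<in> K" for x using that K subgroup.subset by blast
  define D where "D = {k::int. \<exists>x\<in>K. H #> x = (H #> a) [^]\<^bsub>G Mod H\<^esub> k}"
  have "\<exists>d\<in>D. \<forall>k\<in>D. d dvd k"
  proof (rule int_subgroup_generator)
    have "H #> \<one> = (H #> a) [^]\<^bsub>G Mod H\<^esub> (0::int)" using h.hom_one by simp
    then show "0 \<in> D" unfolding D_def using K subgroup.one_closed by blast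
    fix k l assume "k \<in> D" "l \<in> D"
    then obtain x y where xy: "x \<in> K" "H #> x = (H #> a) [^]\<^bsub>G Mod H\<^esub> k"
      "y \<in> K" "H #> y = (H #> a) [^]\<^bsub>G Mod H\<^esub> l" by (auto simp: D_def)
    have "H #> (x \<otimes> inv y) = (H #> a) [^]\<^bsub>G Mod H\<^esub> (k - l)"
      using xy Kc a by (simp add: h.hom_mult[simplified] h.hom_inv Q.int_pow_diff coset_in_Mod)
    then show "k - l \<in> D" unfolding D_def using xy K by (blast intro: subgroup.m_closed subgroup.m_inv_closed)
  qed
  then obtain d x where d: "\<forall>k\<in>D. d dvd k" "x \<in> K" "H #> x = (H #> a) [^]\<^bsub>G Mod H\<^esub> d"
    by (auto simp: D_def)
  show ?thesis
  proof (intro bexI[OF _ d(2)] ballI)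
    fix y assume y: "y \<in> K"
    from cyc[OF y] obtain k :: int where k: "y \<otimes> inv (a [^] k) \<in> H" by blast
    then have yk: "H #> y = (H #> a) [^]\<^bsub>G Mod H\<^esub> k"
      using a Kc[OF y] by (simp add: coset_eq_iff[symmetric] coset_int_pow)
    then have "k \<in> D" using y by (auto simp: D_def)
    then obtain q where "k = d * q" using d(1) by (meson dvdE)
    then have "H #> y = H #> (x [^] q)"
      using yk a Kc[OF d(2)] d(3) by (simp add: coset_int_pow Q.int_pow_pow coset_in_Mod)
    then show "\<exists>k::int. y \<otimes> inv (x [^] k) \<in> H"
      using Kc[OF y] Kc[OF d(2)] by (auto simp: coset_eq_iff)
  qed
qed

lemma subgroups_fin_gen_cyclic_ext:
  assumes fg: "subgroups_fin_gen G H" and a: "a \<in> carrier G" and M: "M \<subseteq> carrier G"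
    and cyc: "\<And>x. x \<in> M \<Longrightarrow> \<exists>k::int. x \<otimes> inv (a [^] k) \<in> H"
  shows "subgroups_fin_gen G M"
  unfolding subgroups_fin_gen_def
proof (intro allI impI)
  fix K assume K: "subgroup K G \<and> K \<subseteq> M"
  then obtain d where d: "d \<in> K" "\<forall>x\<in>K. \<exists>k::int. x \<otimes> inv (d [^] k) \<in> H"
    using cyclic_mod_subgroup[of K a] a cyc by blast
  have "subgroup (K \<inter> H) G" using K subgroups_Inter_pair subgroup_axioms by blast
  from subgroups_fin_genE[OF fg this Int_lower2]
  obtain F where F: "finite F" "F \<subseteq> K \<inter> H" "generate G F = K \<inter> H" .
  have Kc: "x \<in> carrier G" if "x \<in> K" for x using that K subgroup.subset by blast
  have dF: "insert d F \<subseteq> K" using d F by blast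
  then have dFc: "insert d F \<subseteq> carrier G" using Kc by blast
  have sg: "subgroup (generate G (insert d F)) G" by (rule generate_is_subgroup[OF dFc])
  have "K \<subseteq> generate G (insert d F)"
  proof
    fix x assume x: "x \<in> K"
    then obtain k :: int where k: "x \<otimes> inv (d [^] k) \<in> H" using d by blast
    have "x \<otimes> inv (d [^] k) \<in> K"
      using x d(1) K by (meson subgroup.m_closed subgroup.m_inv_closed subgroup_int_pow_closed)
    then have "x \<otimes> inv (d [^] k) \<in> generate G F" using k F(3) by blast
    then have "x \<otimes> inv (d [^] k) \<in> generate G (insert d F)" using mono_generate[of F "insert d F"] by blast
    moreover have "d [^] k \<in> generate G (insert d F)"
      using subgroup_int_pow_closed[OF sg] generate.incl[of d "insert d F"] by blast
    ultimately have "x \<otimes> inv (d [^] k) \<otimes> d [^] k \<in> generate G (insert d F)"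
      using subgroup.m_closed[OF sg] by blast
    then show "x \<in> generate G (insert d F)" using Kc[OF x] Kc[OF d(1)] by (simp add: m_assoc)
  qed
  then have "generate G (insert d F) = K" using generate_subgroup_incl[OF dF] K by blast
  then show "\<exists>F. finite F \<and> F \<subseteq> K \<and> generate G F = K" using F(1) dF by blast
qed

text \<open>A subgroup is generated by lifts of generators of its image modulo \<open>H\<close>
  together with generators of its intersection with \<open>H\<close>.\<close>

lemma subgroups_fin_gen_preimage:
  assumes fgH: "subgroups_fin_gen G H" and fgL: "subgroups_fin_gen (G Mod H) L"
    and M: "\<And>x. x \<in> M \<Longrightarrow> H #> x \<in> L"
  shows "subgroups_fin_gen G M"
  unfolding subgroups_fin_gen_def
proof (intro allI impI)
  fix K assume K: "subgroup K G \<and> K \<subseteq> M"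
  interpret h: group_hom G "G Mod H" "(#>) H" by (rule coset_hom)
  have Kc: "x \<in> carrier G" if "x \<in> K" for x using that K subgroup.subset by blast
  have sI: "subgroup ((#>) H ` K) (G Mod H)" using K h.subgroup_img_is_subgroup by blast
  have iL: "(#>) H ` K \<subseteq> L" using K M by blast
  from subgroups_fin_genE[OF fgL sI iL]
  obtain F' where F': "finite F'" "F' \<subseteq> (#>) H ` K" "generate (G Mod H) F' = (#>) H ` K"
    .
  obtain F1 where F1: "finite F1" "F1 \<subseteq> K" "F' = (#>) H ` F1"
    using finite_subset_image[OF F'(1,2)] by blast
  have "subgroup (K \<inter> H) G" using K subgroups_Inter_pair subgroup_axioms by blast
  from subgroups_fin_genE[OF fgH this Int_lower2]
  obtain F2 where F2: "finite F2" "F2 \<subseteq> K \<inter> H" "generate G F2 = K \<inter> H" .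
  have FK: "F1 \<union> F2 \<subseteq> K" using F1 F2 by blast
  have F1c: "F1 \<subseteq> carrier G" using F1 Kc by blast
  have Fc: "F1 \<union> F2 \<subseteq> carrier G" using FK Kc by blast
  have sg: "subgroup (generate G (F1 \<union> F2)) G" by (rule generate_is_subgroup[OF Fc])
  have "K \<subseteq> generate G (F1 \<union> F2)"
  proof
    fix x assume x: "x \<in> K"
    then have "H #> x \<in> (#>) H ` generate G F1" using F' F1 h.generate_img[OF F1c] by auto
    then obtain y where y: "y \<in> generate G F1" "H #> x = H #> y" by blast
    have yK: "y \<in> K" using y(1) generate_subgroup_incl[OF F1(2)] K by blast
    have "x \<otimes> inv y \<in> K" using x yK K by (meson subgroup.m_closed subgroup.m_inv_closed)
    moreover have "x \<otimes> inv y \<in> H" using y(2) x yK Kc by (simp add: coset_eq_iff)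
    ultimately have "x \<otimes> inv y \<in> generate G F2" using F2(3) by blast
    then have "x \<otimes> inv y \<in> generate G (F1 \<union> F2)" using mono_generate[of F2 "F1 \<union> F2"] by blast
    moreover have "y \<in> generate G (F1 \<union> F2)" using y(1) mono_generate[of F1 "F1 \<union> F2"] by blast
    ultimately have "x \<otimes> inv y \<otimes> y \<in> generate G (F1 \<union> F2)" using subgroup.m_closed[OF sg] by blast
    then show "x \<in> generate G (F1 \<union> F2)" using Kc[OF x] Kc[OF yK] by (simp add: m_assoc)
  qed
  then have "generate G (F1 \<union> F2) = K" using generate_subgroup_incl[OF FK] K by blast
  then show "\<exists>F. finite F \<and> F \<subseteq> K \<and> generate G F = K" using F1(1) F2(1) FK by blast
qed

end

context comm_group
begin

lemma generate_insert:
  assumes "a \<in> carrier G" "F \<subseteq> carrier G" "x \<in> generate G (insert a F)"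
  shows "\<exists>(k::int). \<exists>y\<in>generate G F. x = a [^] k \<otimes> y"
proof -
  let ?S = "{a [^] k \<otimes> y | (k::int) y. y \<in> generate G F}"
  have sF: "subgroup (generate G F) G" by (rule generate_is_subgroup[OF assms(2)])
  then have Fc: "y \<in> carrier G" if "y \<in> generate G F" for y using that subgroup.subset by blast
  have "subgroup ?S G"
  proof (rule subgroupI)
    show "?S \<subseteq> carrier G" using Fc assms(1) by auto
    show "?S \<noteq> {}" using generate.one by blast
    fix u assume "u \<in> ?S"
    then obtain k :: int and y where u: "u = a [^] k \<otimes> y" "y \<in> generate G F" by blast
    have "inv u = a [^] (- k) \<otimes> inv y" using u Fc assms(1) by (simp add: inv_mult int_pow_neg)
    then show "inv u \<in> ?S" using subgroup.m_inv_closed[OF sF u(2)] by blast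
    fix v assume "v \<in> ?S"
    then obtain l :: int and z where v: "v = a [^] l \<otimes> z" "z \<in> generate G F" by blast
    have "u \<otimes> v = a [^] (k + l) \<otimes> (y \<otimes> z)" using u v Fc assms(1) by (simp add: int_pow_mult m_ac)
    then show "u \<otimes> v \<in> ?S" using subgroup.m_closed[OF sF u(2) v(2)] by blast
  qed
  moreover have "insert a F \<subseteq> ?S"
  proof -
    have "a = a [^] (1::int) \<otimes> \<one>" using assms(1) by simp
    then have "a \<in> ?S" using generate.one by blast
    moreover have "f \<in> ?S" if "f \<in> F" for f
    proof -
      have "f = a [^] (0::int) \<otimes> f" using assms that by auto
      then show ?thesis using generate.incl[OF that] by blast
    qed
    ultimately show ?thesis by blast
  qed
  ultimately have "generate G (insert a F) \<subseteq> ?S" by (intro generate_subgroup_incl)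
  with assms(3) show ?thesis by blast
qed

lemma subgroups_fin_gen_generate:
  assumes "finite F" "F \<subseteq> carrier G"
  shows "subgroups_fin_gen G (generate G F)"
  using assms
proof (induction F rule: finite_induct)
  case empty
  then show ?case by (simp add: generate_empty subgroups_fin_gen_finite)
next
  case (insert a F)
  have sF: "subgroup (generate G F) G" using insert.prems by (intro generate_is_subgroup) auto
  interpret N: normal "generate G F" G using subgroup_imp_normal[OF sF] .
  show ?case
  proof (rule N.subgroups_fin_gen_cyclic_ext)
    show "subgroups_fin_gen G (generate G F)" using insert by blast
    show "a \<in> carrier G" using insert by blast
    show "generate G (insert a F) \<subseteq> carrier G" using insert.prems by (rule generate_incl)
    fix x assume "x \<in> generate G (insert a F)"
    then obtain k :: int and y where x: "x = a [^] k \<otimes> y" "y \<in> generate G F"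
      using generate_insert insert.prems by blast
    have "x \<otimes> inv (a [^] k) = y"
      using x insert.prems N.subset by (auto simp: m_ac)
    then show "\<exists>k::int. x \<otimes> inv (a [^] k) \<in> generate G F" using x(2) by blast
  qed
qed

text \<open>Write each exponent as quotient and remainder modulo \<open>p\<close>: the remainders
  form the representative in \<open>R\<close>, the quotients the \<open>p\<close>-th power. The
  count \<open>p ^ card F\<close> is what later bounds flag lengths independently of
  \<open>p\<close>.\<close>

lemma generate_mod_powers_finite:
  fixes p :: nat
  assumes "finite F" "F \<subseteq> carrier G" "p > 0"
  shows "\<exists>R. finite R \<and> R \<subseteq> generate G F \<and> card R \<le> p ^ card F \<and>
    (\<forall>x\<in>generate G F. \<exists>r\<in>R. \<exists>y\<in>generate G F. x = r \<otimes> y [^] int p)"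
  using assms(1,2)
proof (induction F rule: finite_induct)
  case empty
  show ?case by (rule exI[of _ "{\<one>}"]) (simp add: generate_empty)
next
  case (insert a F)
  then obtain R where R: "finite R" "R \<subseteq> generate G F" "card R \<le> p ^ card F"
    "\<And>x. x \<in> generate G F \<Longrightarrow> \<exists>r\<in>R. \<exists>y\<in>generate G F. x = r \<otimes> y [^] int p" by auto
  have aF: "a \<in> carrier G" "F \<subseteq> carrier G" using insert.prems by auto
  have sI: "subgroup (generate G (insert a F)) G" using insert.prems by (rule generate_is_subgroup)
  have FI: "generate G F \<subseteq> generate G (insert a F)" by (rule mono_generate) blast
  have aI: "a [^] (k::int) \<in> generate G (insert a F)" for k
    by (rule subgroup_int_pow_closed[OF sI generate.incl]) simp
  have Ic: "y \<in> carrier G" if "y \<in> generate G (insert a F)" for y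
    using that subgroup.subset[OF sI] by blast
  define R' where "R' = (\<lambda>(j, r). a [^] j \<otimes> r) ` ({0..<int p} \<times> R)"
  show ?case
  proof (intro exI[of _ R'] conjI ballI)
    show "finite R'" using R(1) by (simp add: R'_def)
    show "R' \<subseteq> generate G (insert a F)"
      unfolding R'_def using R(2) FI aI subgroup.m_closed[OF sI] by fastforce
    have "card R' \<le> card ({0..<int p} \<times> R)" unfolding R'_def using R(1) by (intro card_image_le) auto
    also have "\<dots> \<le> p * p ^ card F" using R(3) by (simp add: card_cartesian_product)
    finally show "card R' \<le> p ^ card (insert a F)" using insert.hyps by simp
    fix x assume "x \<in> generate G (insert a F)"
    then obtain k :: int and y where x: "x = a [^] k \<otimes> y" "y \<in> generate G F"
      using generate_insert[OF aF] by blast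
    obtain r z where rz: "r \<in> R" "z \<in> generate G F" "y = r \<otimes> z [^] int p" using R(4)[OF x(2)] by blast
    define w where "w = a [^] (k div int p) \<otimes> z"
    have c: "r \<in> carrier G" "z \<in> carrier G" using rz R(2) FI Ic by auto
    have w: "w \<in> generate G (insert a F)" unfolding w_def using aI rz FI subgroup.m_closed[OF sI] by blast
    have "a [^] k = a [^] (k mod int p) \<otimes> (a [^] (k div int p)) [^] int p"
      using aF(1) by (simp add: int_pow_pow int_pow_mult[symmetric])
    then have "x = (a [^] (k mod int p) \<otimes> r) \<otimes> w [^] int p"
      using x rz c aF(1) by (simp add: w_def int_pow_distrib m_ac)
    moreover have "a [^] (k mod int p) \<otimes> r \<in> R'"
      using rz assms(3) by (force simp: R'_def)
    ultimately show "\<exists>r\<in>R'. \<exists>y\<in>generate G (insert a F). x = r \<otimes> y [^] int p" using w by blast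
  qed
qed

lemma fin_gen_exponent_finite:
  assumes "finite F" "F \<subseteq> carrier G" "m > (0::nat)" "\<And>x. x \<in> generate G F \<Longrightarrow> x [^] int m = \<one>"
  shows "finite (generate G F)"
proof -
  obtain R where R: "finite R" "R \<subseteq> generate G F"
    "\<forall>x\<in>generate G F. \<exists>r\<in>R. \<exists>y\<in>generate G F. x = r \<otimes> y [^] int m"
    using generate_mod_powers_finite[OF assms(1-3)] by blast
  have "generate G F \<subseteq> R"
  proof
    fix x assume "x \<in> generate G F"
    then obtain r y where "r \<in> R" "y \<in> generate G F" "x = r \<otimes> y [^] int m" using R(3) by blast
    moreover have "r \<in> carrier G" using \<open>r \<in> R\<close> R(2) generate_incl[OF assms(2)] by blast
    ultimately show "x \<in> R" using assms(4) by simp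
  qed
  with R(1) finite_subset show ?thesis by blast
qed

text \<open>The torsion subgroup of the quotient by \<open>M\<close> is finitely generated, so a
  single \<open>e\<close> kills it, and primes not dividing \<open>e\<close> are coprime to all
  orders that occur.\<close>

lemma isolated_exponent:
  assumes fg: "subgroups_fin_gen G (carrier G)" and M: "subgroup M G"
  shows "\<exists>e::int. e > 0 \<and> (\<forall>p x. prime p \<and> \<not> p dvd e \<and> x \<in> carrier G \<and> x [^] p \<in> M \<longrightarrow> x \<in> M)"
proof -
  have Mpow: "x [^] (k * l :: int) \<in> M" if "x [^] l \<in> M" "x \<in> carrier G" for x k l
    using subgroup_int_pow_closed[OF M that(1), of k] that(2) by (simp add: int_pow_pow mult.commute)
  define N where "N = {x \<in> carrier G. \<exists>k::int. k > 0 \<and> x [^] k \<in> M}"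
  have sN: "subgroup N G"
  proof (rule subgroupI)
    show "N \<subseteq> carrier G" by (auto simp: N_def)
    have "\<one> [^] (1::int) \<in> M" using subgroup.one_closed[OF M] by simp
    then have "\<one> \<in> N" unfolding N_def using zero_less_one by blast
    then show "N \<noteq> {}" by blast
    fix x assume "x \<in> N"
    then obtain k :: int where k: "x \<in> carrier G" "k > 0" "x [^] k \<in> M" by (auto simp: N_def)
    then have "inv x [^] k \<in> M" using subgroup.m_inv_closed[OF M k(3)] by (simp add: int_pow_inv)
    then show "inv x \<in> N" using k by (auto simp: N_def)
    fix y assume "y \<in> N"
    then obtain l :: int where l: "y \<in> carrier G" "l > 0" "y [^] l \<in> M" by (auto simp: N_def)
    have "(x \<otimes> y) [^] (k * l) = x [^] (l * k) \<otimes> y [^] (k * l)" using k l by (simp add: int_pow_distrib mult.commute)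
    also have "\<dots> \<in> M" using Mpow[OF k(3,1)] Mpow[OF l(3,1)] subgroup.m_closed[OF M] by blast
    finally show "x \<otimes> y \<in> N" using k l by (auto simp: N_def intro!: exI[of _ "k * l"])
  qed
  from subgroups_fin_genE[OF fg this subgroup.subset[OF this]]
  obtain F where F: "finite F" "F \<subseteq> N" "generate G F = N" .
  have "\<forall>x\<in>F. \<exists>k::int. k > 0 \<and> x [^] k \<in> M" using F(2) by (auto simp: N_def)
  from bchoice[OF this] obtain k :: "'a \<Rightarrow> int" where k: "\<forall>x\<in>F. k x > 0 \<and> x [^] k x \<in> M" by blast
  define e where "e = (\<Prod>x\<in>F. k x)"
  have e0: "e > 0" unfolding e_def using k by (intro prod_pos) auto
  have "subgroup {x \<in> carrier G. x [^] e \<in> M} G"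
  proof (rule subgroupI)
    show "{x \<in> carrier G. x [^] e \<in> M} \<noteq> {}" using subgroup.one_closed[OF M] by (auto intro!: exI[of _ \<one>])
    show "inv x \<in> {x \<in> carrier G. x [^] e \<in> M}" if "x \<in> {x \<in> carrier G. x [^] e \<in> M}" for x
      using that subgroup.m_inv_closed[OF M] by (simp add: int_pow_inv)
    show "x \<otimes> y \<in> {x \<in> carrier G. x [^] e \<in> M}"
      if "x \<in> {x \<in> carrier G. x [^] e \<in> M}" "y \<in> {x \<in> carrier G. x [^] e \<in> M}" for x y
      using that subgroup.m_closed[OF M] by (simp add: int_pow_distrib)
  qed auto
  moreover have "F \<subseteq> {x \<in> carrier G. x [^] e \<in> M}"
  proof
    fix x assume x: "x \<in> F"
    \<comment> \<open>The product of the exponents of the finitely many generators of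
      \<open>N\<close> works for each generator, hence for all of \<open>N\<close>.\<close>
    then have "k x dvd e" unfolding e_def using F(1) by (intro dvd_prodI)
    then obtain q where "e = q * k x" by (metis dvdE mult.commute)
    then show "x \<in> {x \<in> carrier G. x [^] e \<in> M}" using x k F(2) Mpow by (auto simp: N_def)
  qed
  ultimately have eN: "x [^] e \<in> M" if "x \<in> N" for x
    using generate_subgroup_incl[of F "{x \<in> carrier G. x [^] e \<in> M}"] F(3) that by blast
  show ?thesis
  proof (intro exI[of _ e] conjI allI impI e0)
    fix p :: int and x
    assume A: "prime p \<and> \<not> p dvd e \<and> x \<in> carrier G \<and> x [^] p \<in> M"
    then have "x \<in> N" by (auto simp: N_def prime_int_iff intro!: exI[of _ p])
    from A have "coprime p e" by (simp add: prime_imp_coprime)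
    then obtain u v where uv: "u * p + v * e = 1" by (metis bezout_int coprime_imp_gcd_eq_1)
    have "x [^] (u * p) \<otimes> x [^] (v * e) \<in> M"
      using Mpow[of x p u] Mpow[of x e v] A eN[OF \<open>x \<in> N\<close>] subgroup.m_closed[OF M] by blast
    then show "x \<in> M" using A uv by (simp add: int_pow_mult[symmetric])
  qed
qed

end

subsection \<open>Flagged actions on finitely generated abelian groups\<close>

locale comm_group_endo = comm_group G for G (structure) +
  fixes T :: "'a \<Rightarrow> 'a"
  assumes T_hom: "T \<in> hom G G"
begin

sublocale T: group_hom G G T
  by unfold_locales (rule T_hom)

text \<open>The value \<open>f(T) v\<close> of Horner's scheme, that is, the structure of
  \<open>G\<close> as a module over the integer polynomials, in multiplicative notation: powers are
  scalar multiples.\<close>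

definition poly_act :: "int poly \<Rightarrow> 'a \<Rightarrow> 'a" where
  "poly_act f v = fold_coeffs (\<lambda>c w. v [^] c \<otimes> T w) f \<one>"

lemma poly_act_0 [simp]: "poly_act 0 v = \<one>"
  by (simp add: poly_act_def)

lemma poly_act_pCons:
  assumes "v \<in> carrier G"
  shows "poly_act (pCons a f) v = v [^] a \<otimes> T (poly_act f v)"
proof (cases "a = 0 \<and> f = 0")
  case True
  then show ?thesis by (simp add: poly_act_def)
next
  case False
  then show ?thesis by (auto simp: poly_act_def)
qed

lemma poly_act_closed [simp, intro]: "v \<in> carrier G \<Longrightarrow> poly_act f v \<in> carrier G"
  by (induction f) (auto simp: poly_act_pCons)

lemma poly_act_one [simp]: "poly_act f \<one> = \<one>"
  by (induction f) (auto simp: poly_act_pCons)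

lemma poly_act_add: "v \<in> carrier G \<Longrightarrow> poly_act (f + g) v = poly_act f v \<otimes> poly_act g v"
  by (induction f g rule: poly_induct2) (auto simp: poly_act_pCons int_pow_mult m_ac)

lemma poly_act_smult: "v \<in> carrier G \<Longrightarrow> poly_act (smult c f) v = poly_act f v [^] c"
  by (induction f) (auto simp: poly_act_pCons int_pow_pow int_pow_distrib T.hom_int_pow mult.commute)

lemma poly_act_minus: "v \<in> carrier G \<Longrightarrow> poly_act (- f) v = inv (poly_act f v)"
  using poly_act_smult[of v "-1" f] by (simp add: int_pow_neg)

lemma poly_act_diff: "v \<in> carrier G \<Longrightarrow> poly_act (f - g) v = poly_act f v \<otimes> inv (poly_act g v)"
  using poly_act_add[of v f "- g"] by (simp add: poly_act_minus)

lemma poly_act_hom: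
  "v \<in> carrier G \<Longrightarrow> w \<in> carrier G \<Longrightarrow> poly_act f (v \<otimes> w) = poly_act f v \<otimes> poly_act f w"
  by (induction f) (auto simp: poly_act_pCons int_pow_distrib m_ac)

lemma poly_act_group_hom: "group_hom G G (poly_act f)"
  by unfold_locales (auto simp: hom_def poly_act_hom)

lemma poly_act_T: "v \<in> carrier G \<Longrightarrow> T (poly_act f v) = poly_act f (T v)"
  by (induction f) (auto simp: poly_act_pCons T.hom_int_pow)

lemma poly_act_mult: "v \<in> carrier G \<Longrightarrow> poly_act (f * g) v = poly_act f (poly_act g v)"
proof (induction f)
  case (pCons a f)
  then show ?case by (simp add: poly_act_add poly_act_smult poly_act_pCons)
qed simp

lemma poly_act_const [simp]: "v \<in> carrier G \<Longrightarrow> poly_act [:c:] v = v [^] c"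
  by (simp add: poly_act_pCons)

lemma poly_act_1 [simp]: "v \<in> carrier G \<Longrightarrow> poly_act 1 v = v"
  using poly_act_const[of v 1] by (simp add: one_pCons)

lemma poly_act_linear: "v \<in> carrier G \<Longrightarrow> poly_act [:a, 1:] v = v [^] a \<otimes> T v"
  by (simp add: poly_act_pCons)

lemma poly_act_square_minus_one: "v \<in> carrier G \<Longrightarrow> poly_act [:-1, 0, 1:] v = T (T v) \<otimes> inv v"
  by (simp add: poly_act_pCons int_pow_neg m_comm)

lemma poly_act_in_subgroup:
  assumes "subgroup U G" "\<And>v. v \<in> U \<Longrightarrow> T v \<in> U" "v \<in> U"
  shows "poly_act f v \<in> U"
proof -
  have "v \<in> carrier G" using assms subgroup.subset by blast
  then show ?thesis
    by (induction f) (use assms in \<open>auto simp: poly_act_pCons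
          intro!: subgroup.one_closed subgroup.m_closed subgroup_int_pow_closed\<close>)
qed

lemma poly_act_orbit_subgroup:
  assumes v: "v \<in> carrier G"
  shows "subgroup (range (\<lambda>h. poly_act h v)) G"
proof (rule subgroupI)
  show "range (\<lambda>h. poly_act h v) \<subseteq> carrier G" using v by auto
  show "range (\<lambda>h. poly_act h v) \<noteq> {}" by simp
  fix x assume "x \<in> range (\<lambda>h. poly_act h v)"
  then obtain h where h: "x = poly_act h v" by (elim rangeE)
  have "inv x = poly_act (- h) v" using v h by (simp add: poly_act_minus)
  then show "inv x \<in> range (\<lambda>h. poly_act h v)" by (rule range_eqI)
  fix y assume "y \<in> range (\<lambda>h. poly_act h v)"
  then obtain g where g: "y = poly_act g v" by (elim rangeE)
  have "x \<otimes> y = poly_act (h + g) v" using v h g by (simp add: poly_act_add)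
  then show "x \<otimes> y \<in> range (\<lambda>h. poly_act h v)" by (rule range_eqI)
qed

text \<open>An eigenvector modulo an invariant subgroup: \<open>f(T)\<close> acts on it as the
  integer \<open>f(r)\<close>, by induction along Horner's scheme.\<close>

lemma poly_act_eigen_mod:
  assumes C: "subgroup C G" "\<And>x. x \<in> C \<Longrightarrow> T x \<in> C" and v: "v \<in> carrier G"
    and r: "T v \<otimes> inv (v [^] r) \<in> C"
  shows "poly_act f v \<otimes> inv (v [^] poly f r) \<in> C"
proof (induction f)
  case 0
  then show ?case using subgroup.one_closed[OF C(1)] by simp
next
  case (pCons a f)
  let ?w = "poly_act f v" and ?k = "poly f r"
  have "T (?w \<otimes> inv (v [^] ?k)) \<in> C" by (rule C(2)[OF pCons.IH])
  moreover have "(T v \<otimes> inv (v [^] r)) [^] ?k \<in> C" by (rule subgroup_int_pow_closed[OF C(1) r])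
  ultimately have "T (?w \<otimes> inv (v [^] ?k)) \<otimes> (T v \<otimes> inv (v [^] r)) [^] ?k \<in> C"
    by (rule subgroup.m_closed[OF C(1)])
  also have "T (?w \<otimes> inv (v [^] ?k)) \<otimes> (T v \<otimes> inv (v [^] r)) [^] ?k
      = T ?w \<otimes> inv (T v [^] ?k) \<otimes> (T v [^] ?k \<otimes> inv (v [^] (r * ?k)))"
    using v by (simp add: int_pow_distrib int_pow_inv int_pow_pow T.hom_int_pow)
  also have "\<dots> = T ?w \<otimes> inv (v [^] (r * ?k))"
  proof -
    have "a \<otimes> inv b \<otimes> (b \<otimes> c) = a \<otimes> c" if "a \<in> carrier G" "b \<in> carrier G" "c \<in> carrier G" for a b c
      using that by (simp add: m_assoc inv_solve_left')
    then show ?thesis using v by simp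
  qed
  also have "\<dots> = poly_act (pCons a f) v \<otimes> inv (v [^] poly (pCons a f) r)"
  proof -
    have "a \<otimes> inv b = (c \<otimes> a) \<otimes> inv (c \<otimes> b)" if "a \<in> carrier G" "b \<in> carrier G" "c \<in> carrier G" for a b c
      using that by (simp add: inv_mult m_ac)
    from this[of "T ?w" "v [^] (r * ?k)" "v [^] a"]
    show ?thesis using v by (simp add: poly_act_pCons int_pow_mult)
  qed
  finally show ?case .
qed

end

section \<open>Integer polynomials: division, Gauss's lemma, factorisation modulo a prime\<close>

lemma monic_division:
  fixes f g :: "int poly"
  assumes "lead_coeff g = 1"
  obtains q r where "f = g * q + r" "r = 0 \<or> degree r < degree g"
proof -
  have g: "g \<noteq> 0" using assms by auto
  obtain q r where qr: "pseudo_divmod f g = (q, r)" by (cases "pseudo_divmod f g")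
  show thesis using pseudo_divmod[OF g qr] assms by (intro that[of q r]) auto
qed

text \<open>Gauss's lemma: comparing contents, all of \<open>a\<close> up to sign sits in
  \<open>s\<close> and can be cancelled. What remains exhibits \<open>h\<close> as a factor of the
  monic \<open>\<mu>\<close>, so its leading coefficient is a unit.\<close>

lemma monic_of_dvd_smult_monic:
  fixes h \<mu> :: "int poly"
  assumes h: "content h = 1" and \<mu>: "lead_coeff \<mu> = 1" and a: "a \<noteq> 0" and eq: "smult a \<mu> = h * s"
  shows "lead_coeff h = 1 \<or> lead_coeff h = -1"
proof -
  have "content \<mu> dvd lead_coeff \<mu>" by (rule content_dvd_coeff)
  then have "content \<mu> dvd 1" by (simp only: \<mu>)
  then have c\<mu>: "content \<mu> = 1" using is_unit_content_iff by blast
  have "content (smult a \<mu>) = content (h * s)" using eq by simp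
  then have cs: "content s = \<bar>a\<bar>" using h c\<mu> by (simp add: content_mult)
  have "smult a \<mu> = smult \<bar>a\<bar> (h * primitive_part s)"
    using eq cs content_times_primitive_part[of s] by (metis mult_smult_right)
  then have "smult a \<mu> = smult a (smult (sgn a) (h * primitive_part s))"
    by (simp add: abs_sgn mult.commute)
  then have "\<mu> = smult (sgn a) (h * primitive_part s)" using a by (metis smult_cancel)
  then have "1 = sgn a * (lead_coeff h * lead_coeff (primitive_part s))"
    using \<mu> by (metis lead_coeff_mult lead_coeff_smult)
  then have "lead_coeff h dvd 1" by (metis dvd_triv_left dvd_mult2 mult.left_commute)
  then show ?thesis by auto
qed

text \<open>Unique factorisation modulo \<open>p\<close>, expressed by congruences of integer
  polynomials. The first root \<open>r\<close> is a root of \<open>f\<close> or of \<open>a\<close>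
  modulo \<open>p\<close>; dividing that factor by \<open>x - r\<close> and cancelling the
  prime-to-\<open>p\<close> polynomial \<open>x - r\<close> shortens the list.\<close>

lemma splits_mod_prime_factor:
  fixes f a :: "int poly" and p :: int
  assumes p: "prime p" and "lead_coeff f = 1" "lead_coeff a = 1"
    and "[:p:] dvd f * a - (\<Prod>r\<leftarrow>rs. [:- r, 1:])"
  shows "\<exists>ss. set ss \<subseteq> set rs \<and> length ss = degree f \<and> [:p:] dvd f - (\<Prod>r\<leftarrow>ss. [:- r, 1:])"
  using assms(2-4)
proof (induction rs arbitrary: f a)
  case Nil
  have "lead_coeff (f * a) = 1" using Nil by (simp add: lead_coeff_mult)
  moreover have "p dvd coeff (f * a - 1) (degree (f * a))"
    using Nil(3) by (simp only: const_poly_dvd_iff list.simps prod_list.Nil)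
  ultimately have "degree (f * a) = 0"
    using p not_prime_unit[of p] by (cases "degree (f * a) = 0") auto
  moreover have "f \<noteq> 0" "a \<noteq> 0" using Nil by auto
  ultimately have "degree f = 0" using degree_mult_eq[of f a] by simp
  moreover obtain c where "f = [:c:]" using calculation by (rule degree_eq_zeroE)
  then have "f = 1" using Nil(1) by (simp add: one_pCons)
  ultimately show ?case by (intro exI[of _ "[]"]) simp
next
  case (Cons r rs)
  have pe: "prime_elem [:p:]" using prime_imp_prime_elem[OF p] by (simp only: prime_elem_const_poly_iff)
  have factor: "\<exists>g1. lead_coeff g1 = 1 \<and> Suc (degree g1) = degree g \<and> [:p:] dvd g - [:- r, 1:] * g1"
    if g: "lead_coeff g = 1" "p dvd poly g r" for g
  proof -
    have "g - [:poly g r:] = [:- r, 1:] * synthetic_div g r"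
      using synthetic_div_correct'[of r g] by (simp add: algebra_simps)
    moreover have "degree g \<noteq> 0"
    proof
      assume "degree g = 0"
      then obtain c where "g = [:c:]" by (rule degree_eq_zeroE)
      with g p show False by auto
    qed
    moreover have "lead_coeff (synthetic_div g r) = 1"
    proof -
      have "g = [:- r, 1:] * synthetic_div g r + [:poly g r:]" using synthetic_div_correct'[of r g] by simp
      then have "coeff g (Suc (degree (synthetic_div g r))) =
          coeff ([:- r, 1:] * synthetic_div g r + [:poly g r:]) (Suc (degree (synthetic_div g r)))" by metis
      then show ?thesis using g \<open>degree g \<noteq> 0\<close>
        by (cases "degree g") (simp_all add: coeff_eq_0 degree_synthetic_div)
    qed
    moreover have "[:p:] dvd [:poly g r:]" using g(2) by simp
    ultimately show ?thesis
      by (intro exI[of _ "synthetic_div g r"]) (auto simp: degree_synthetic_div algebra_simps)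
  qed
  have cancel: "[:p:] dvd h" if "[:p:] dvd [:- r, 1:] * h" for h
  proof -
    have "\<not> [:p:] dvd [:- r, 1:]"
    proof
      assume "[:p:] dvd [:- r, 1:]"
      then have "p dvd coeff [:- r, 1:] 1" by (simp only: const_poly_dvd_iff)
      then show False using p not_prime_unit[of p] by (simp add: coeff_pCons)
    qed
    with that pe show ?thesis using prime_elem_dvd_multD by blast
  qed
  have "[:p:] dvd f * a - [:- r, 1:] * (\<Prod>r\<leftarrow>rs. [:- r, 1:])" using Cons.prems(3) by simp
  note main = this
  then obtain b where b: "f * a - [:- r, 1:] * (\<Prod>r\<leftarrow>rs. [:- r, 1:]) = [:p:] * b" by (rule dvdE)
  have "poly (f * a - [:- r, 1:] * (\<Prod>r\<leftarrow>rs. [:- r, 1:])) r = poly ([:p:] * b) r" by (simp only: b)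
  then have "p dvd poly f r * poly a r" by (simp add: poly_mult)
  then consider "p dvd poly f r" | "p dvd poly a r" using p prime_dvd_mult_iff by blast
  then show ?case
  proof cases
    case 1
    obtain f1 where f1: "lead_coeff f1 = 1" "Suc (degree f1) = degree f" "[:p:] dvd f - [:- r, 1:] * f1"
      using factor[OF Cons.prems(1) 1] by blast
    have "[:p:] dvd (f * a - [:- r, 1:] * (\<Prod>r\<leftarrow>rs. [:- r, 1:])) - (f - [:- r, 1:] * f1) * a"
      by (rule dvd_diff[OF main dvd_mult2[OF f1(3)]])
    also have "(f * a - [:- r, 1:] * (\<Prod>r\<leftarrow>rs. [:- r, 1:])) - (f - [:- r, 1:] * f1) * a
        = [:- r, 1:] * (f1 * a - (\<Prod>r\<leftarrow>rs. [:- r, 1:]))"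
      by (simp only: algebra_simps)
    finally have "[:p:] dvd f1 * a - (\<Prod>r\<leftarrow>rs. [:- r, 1:])" by (rule cancel)
    from Cons.IH[OF f1(1) Cons.prems(2) this] obtain ss where
      ss: "set ss \<subseteq> set rs" "length ss = degree f1" "[:p:] dvd f1 - (\<Prod>r\<leftarrow>ss. [:- r, 1:])" by blast
    have cancel_mid: "(f - L * f1) + L * (f1 - P) = f - L * P" for L P :: "int poly"
      by (simp add: algebra_simps)
    have "[:p:] dvd (f - [:- r, 1:] * f1) + [:- r, 1:] * (f1 - (\<Prod>r\<leftarrow>ss. [:- r, 1:]))"
      by (rule dvd_add[OF f1(3) dvd_mult[OF ss(3)]])
    then have "[:p:] dvd f - (\<Prod>r\<leftarrow>r # ss. [:- r, 1:])" by (simp only: cancel_mid list.map prod_list.Cons)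
    then show ?thesis using ss f1(2) by (intro exI[of _ "r # ss"]) auto
  next
    case 2
    obtain a1 where a1: "lead_coeff a1 = 1" "Suc (degree a1) = degree a" "[:p:] dvd a - [:- r, 1:] * a1"
      using factor[OF Cons.prems(2) 2] by blast
    have "[:p:] dvd (f * a - [:- r, 1:] * (\<Prod>r\<leftarrow>rs. [:- r, 1:])) - f * (a - [:- r, 1:] * a1)"
      by (rule dvd_diff[OF main dvd_mult[OF a1(3)]])
    also have "(f * a - [:- r, 1:] * (\<Prod>r\<leftarrow>rs. [:- r, 1:])) - f * (a - [:- r, 1:] * a1)
        = [:- r, 1:] * (f * a1 - (\<Prod>r\<leftarrow>rs. [:- r, 1:]))"
      by (simp only: algebra_simps)
    finally have "[:p:] dvd f * a1 - (\<Prod>r\<leftarrow>rs. [:- r, 1:])" by (rule cancel)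
    from Cons.IH[OF Cons.prems(1) a1(1) this] show ?thesis by auto
  qed
qed

lemma prod_linear_mod_cong:
  fixes p :: int
  shows "[:p:] dvd (\<Prod>r\<leftarrow>rs. [:- (r mod p), 1:]) - (\<Prod>r\<leftarrow>rs. [:- r, 1:])"
proof (induction rs)
  case (Cons r rs)
  let ?P = "\<Prod>r\<leftarrow>rs. [:- (r mod p), 1:]" and ?Q = "\<Prod>r\<leftarrow>rs. [:- r, 1:]"
  have "p dvd r - r mod p" by (simp add: minus_mod_eq_mult_div)
  then have "[:p:] dvd [:r - r mod p:]" by simp
  then have "[:p:] dvd [:r - r mod p:] * ?P + [:- r, 1:] * (?P - ?Q)"
    using Cons by (intro dvd_add dvd_mult dvd_mult2)
  also have "[:r - r mod p:] * ?P + [:- r, 1:] * (?P - ?Q) = ([:r - r mod p:] + [:- r, 1:]) * ?P - [:- r, 1:] * ?Q"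
    by (simp only: algebra_simps)
  finally show ?case by simp
qed simp

text \<open>A repeated \<open>r\<close> would be a root of both \<open>f\<close> and its derivative
  modulo \<open>p\<close>, hence \<open>p\<close> would divide \<open>D\<close>. The constant
  \<open>D\<close> takes the place of the discriminant.\<close>

lemma separable_split_distinct:
  fixes f :: "int poly" and p :: int
  assumes p: "prime p" and f: "[:p:] dvd f - (\<Prod>r\<leftarrow>ss. [:- r, 1:])"
    and D: "\<alpha> * f + \<beta> * pderiv f = [:D:]" "\<not> p dvd D"
  shows "distinct ss"
proof (rule ccontr)
  assume "\<not> distinct ss"
  then obtain xs ys zs r where ss: "ss = xs @ [r] @ ys @ [r] @ zs" using not_distinct_decomp by blast
  define g where "g = (\<Prod>r\<leftarrow>xs @ ys @ zs. [:- r, 1:])"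
  have P: "(\<Prod>r\<leftarrow>ss. [:- r, 1:]) = [:- r, 1:] * ([:- r, 1:] * g)" by (simp only: ss g_def map_append list.map prod_list.append prod_list.Cons prod_list.Nil
        mult_ac mult_1_left)
  obtain b where "f - (\<Prod>r\<leftarrow>ss. [:- r, 1:]) = [:p:] * b" using f by (rule dvdE)
  then have fb: "f = [:- r, 1:] * ([:- r, 1:] * g) + smult p b" unfolding P by (simp add: algebra_simps)
  have 1: "p dvd poly f r" by (subst fb) simp
  have 2: "p dvd poly (pderiv f) r"
    by (subst fb) (simp add: pderiv_add pderiv_mult pderiv_smult del: mult_pCons_left)
  have "poly (\<alpha> * f + \<beta> * pderiv f) r = D" unfolding D(1) by simp
  then have "D = poly \<alpha> r * poly f r + poly \<beta> r * poly (pderiv f) r" by simp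
  then have "p dvd D" using 1 2 by simp
  with D(2) show False by simp
qed


section \<open>A single endomorphism of a finitely generated torsion-free abelian group\<close>

locale fin_gen_torsion_free_endo = comm_group_endo G T for G (structure) and T +
  assumes fg: "subgroups_fin_gen G (carrier G)"
    and torsion_free: "\<And>x (k::int). x \<in> carrier G \<Longrightarrow> x [^] k = \<one> \<Longrightarrow> k = 0 \<or> x = \<one>"
begin

text \<open>A substitute for Cayley-Hamilton. The submodule generated by \<open>v\<close> is
  finitely generated as a group, so polynomials of some bounded degree already reach all of it, in
  particular the image of \<open>v\<close> under a higher power of \<open>T\<close>.\<close>

lemma monic_annihilator:
  assumes v: "v \<in> carrier G"
  shows "\<exists>\<mu>. lead_coeff \<mu> = 1 \<and> poly_act \<mu> v = \<one>"
proof -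
  define M where "M = range (\<lambda>h. poly_act h v)"
  have M: "subgroup M G" unfolding M_def by (rule poly_act_orbit_subgroup[OF v])
  from subgroups_fin_genE[OF fg M subgroup.subset[OF M]]
  obtain F where F: "finite F" "F \<subseteq> M" "generate G F = M" .
  from finite_subset_image[OF F(1) F(2)[unfolded M_def]]
  obtain H where H: "finite H" "F = (\<lambda>h. poly_act h v) ` H" by (elim exE conjE)
  define n where "n = Suc (Max (insert 0 (degree ` H)))"
  have n: "degree h < n" if "h \<in> H" for h
    unfolding n_def using that H(1) by (simp add: less_Suc_eq_le)
  define L where "L = (\<lambda>h. poly_act h v) ` {h. h = 0 \<or> degree h < n}"
  have n0: "n > 0" by (simp add: n_def)
  have L: "subgroup L G"
  proof (rule subgroupI)
    show "L \<subseteq> carrier G" using v by (auto simp: L_def)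
    show "L \<noteq> {}" by (auto simp: L_def)
    fix x assume "x \<in> L"
    then obtain h where h: "x = poly_act h v" "h = 0 \<or> degree h < n" by (auto simp: L_def)
    then have "inv x = poly_act (- h) v" using v by (simp add: poly_act_minus)
    then show "inv x \<in> L" using h(2) by (auto simp: L_def)
    fix y assume "y \<in> L"
    then obtain g where g: "y = poly_act g v" "g = 0 \<or> degree g < n" by (auto simp: L_def)
    then have "x \<otimes> y = poly_act (h + g) v" using v h by (simp add: poly_act_add)
    moreover have "degree (h + g) < n" using h(2) g(2) n0 by (auto intro: degree_add_less)
    ultimately show "x \<otimes> y \<in> L" by (auto simp: L_def)
  qed
  have "F \<subseteq> L" using H n by (auto simp: L_def)
  then have "M \<subseteq> L" using generate_subgroup_incl[OF _ L] F(3) by blast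
  then have "poly_act (monom 1 n) v \<in> L" by (auto simp: M_def)
  then obtain h where h: "poly_act (monom 1 n) v = poly_act h v" "h = 0 \<or> degree h < n"
    unfolding L_def by blast
  then have h: "poly_act (monom 1 n) v = poly_act h v" "degree h < n" using n0 by auto
  have "degree (monom 1 n - h) = n"
    using h(2) by (subst diff_conv_add_uminus, subst degree_add_eq_left) (auto simp: degree_monom_eq)
  then have "lead_coeff (monom 1 n - h) = 1" using h(2) by (simp add: coeff_eq_0)
  moreover have "poly_act (monom 1 n - h) v = \<one>" using v h(1) by (simp add: poly_act_diff)
  ultimately show ?thesis by blast
qed

text \<open>The degree is minimal over all nontrivial elements of \<open>U\<close>, not only for the
  chosen \<open>v\<close>. Therefore \<open>f\<close> behaves like an irreducible polynomial: a
  proper factor would kill some other nontrivial element of \<open>U\<close>.\<close>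

lemma minimal_annihilator:
  assumes U: "subgroup U G" "\<And>v. v \<in> U \<Longrightarrow> T v \<in> U" and ne: "U \<noteq> {\<one>}"
  obtains f v where "v \<in> U" "v \<noteq> \<one>" "lead_coeff f = 1" "poly_act f v = \<one>" "degree f > 0"
    and "\<And>h u. h \<noteq> 0 \<Longrightarrow> u \<in> U \<Longrightarrow> u \<noteq> \<one> \<Longrightarrow> poly_act h u = \<one> \<Longrightarrow> degree f \<le> degree h"
proof -
  have Uc: "u \<in> carrier G" if "u \<in> U" for u using that U(1) subgroup.subset by blast
  define P where "P = (\<lambda>n. \<exists>h v. h \<noteq> 0 \<and> v \<in> U \<and> v \<noteq> \<one> \<and> poly_act h v = \<one> \<and> degree h = n)"
  obtain u0 where u0: "u0 \<in> U" "u0 \<noteq> \<one>" using ne subgroup.one_closed[OF U(1)] by blast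
  obtain \<mu>0 where "lead_coeff \<mu>0 = 1" "poly_act \<mu>0 u0 = \<one>" using monic_annihilator Uc u0 by blast
  then have "P (degree \<mu>0)" using u0 unfolding P_def by (intro exI[of _ \<mu>0] exI[of _ u0]) auto
  then have "P (LEAST n. P n)" by (rule LeastI)
  then obtain h0 v where h0: "h0 \<noteq> 0" "v \<in> U" "v \<noteq> \<one>" "poly_act h0 v = \<one>" "degree h0 = (LEAST n. P n)"
    unfolding P_def by blast
  have min: "degree h0 \<le> degree h" if "h \<noteq> 0" "u \<in> U" "u \<noteq> \<one>" "poly_act h u = \<one>" for h u
    unfolding h0(5) by (rule Least_le) (use that in \<open>auto simp: P_def\<close>)
  have vc: "v \<in> carrier G" using h0 Uc by blast
  define h where "h = primitive_part h0"
  have h0h: "h0 = smult (content h0) h" by (simp add: h_def)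
  have hdeg: "degree h = degree h0" by (simp add: h_def)
  have "poly_act h v [^] content h0 = \<one>" using h0(4) h0h poly_act_smult[OF vc] by metis
  \<comment> \<open>Absence of torsion allows division by the content, so the primitive part still
    kills \<open>v\<close>.\<close>
  then have hv: "poly_act h v = \<one>" using torsion_free[of "poly_act h v" "content h0"] vc h0(1) by auto
  have hc: "content h = 1" using h0(1) by (simp add: h_def)
  have hn: "h \<noteq> 0" using hc by auto
  obtain \<mu> where \<mu>: "lead_coeff \<mu> = 1" "poly_act \<mu> v = \<one>" using monic_annihilator[OF vc] by blast
  obtain a q where aq: "a \<noteq> 0" "smult a \<mu> = h * q + pseudo_mod \<mu> h" using pseudo_mod(1)[OF hn] by blast
  have "poly_act (pseudo_mod \<mu> h) v = poly_act (smult a \<mu> - q * h) v" using aq(2) by (simp add: mult.commute)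
  also have "\<dots> = \<one>" using vc \<mu>(2) hv by (simp add: poly_act_diff poly_act_smult poly_act_mult)
  \<comment> \<open>The remainder kills \<open>v\<close> and has smaller degree than
    \<open>h\<close>, so it vanishes by minimality; now \<open>h\<close> divides a multiple of a
    monic polynomial and Gauss's lemma applies.\<close>
  finally have "pseudo_mod \<mu> h = 0"
    using min[of "pseudo_mod \<mu> h" v] h0 pseudo_mod(2)[OF hn, of \<mu>] hdeg by fastforce
  then have lc: "lead_coeff h = 1 \<or> lead_coeff h = -1"
    using monic_of_dvd_smult_monic[OF hc \<mu>(1) aq(1), of q] aq(2) by simp
  define f where "f = smult (lead_coeff h) h"
  have "lead_coeff f = 1" using lc by (auto simp: f_def)
  moreover have fv: "poly_act f v = \<one>" using vc hv by (simp add: f_def poly_act_smult)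
  moreover have fdeg: "degree f = degree h0" using lc hdeg by (auto simp: f_def)
  moreover have "degree f > 0"
  proof (rule ccontr)
    assume "\<not> degree f > 0"
    then have "degree f = 0" by simp
    then obtain c where c: "f = [:c:]" by (rule degree_eq_zeroE)
    then have "c = 1" using \<open>lead_coeff f = 1\<close> by simp
    then show False using fv c vc h0(3) by simp
  qed
  ultimately show thesis using that[of v f] h0(2,3) min by simp
qed

text \<open>An element \<open>h\<close> of least degree in the ideal generated by \<open>f\<close>
  and \<open>pderiv f\<close> divides a multiple of \<open>f\<close>. If it were not constant, the
  cofactor \<open>q\<close> would send \<open>v\<close> to a nontrivial element killed by
  \<open>h\<close>, whose degree is below that of \<open>f\<close>.\<close>

lemma separability_bezout:
  fixes f :: "int poly"
  assumes U: "subgroup U G" "\<And>v. v \<in> U \<Longrightarrow> T v \<in> U"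
    and v: "v \<in> U" "v \<noteq> \<one>" "poly_act f v = \<one>" and f: "degree f > 0"
    and min: "\<And>h u. h \<noteq> 0 \<Longrightarrow> u \<in> U \<Longrightarrow> u \<noteq> \<one> \<Longrightarrow> poly_act h u = \<one> \<Longrightarrow> degree f \<le> degree h"
  shows "\<exists>\<alpha> \<beta> D. D \<noteq> 0 \<and> \<alpha> * f + \<beta> * pderiv f = [:D:]"
proof -
  define P where "P = (\<lambda>n. \<exists>\<alpha> \<beta>. \<alpha> * f + \<beta> * pderiv f \<noteq> 0 \<and> degree (\<alpha> * f + \<beta> * pderiv f) = n)"
  have vc: "v \<in> carrier G" using v U(1) subgroup.subset by blast
  have "pderiv f \<noteq> 0" using f by (simp add: pderiv_eq_0_iff)
  then have P1: "P (degree (pderiv f))" unfolding P_def by (intro exI[of _ 0] exI[of _ 1]) simp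
  then have "P (LEAST n. P n)" by (rule LeastI)
  then obtain \<alpha> \<beta> where h: "\<alpha> * f + \<beta> * pderiv f \<noteq> 0" "degree (\<alpha> * f + \<beta> * pderiv f) = (LEAST n. P n)"
    unfolding P_def by blast
  define h where "h = \<alpha> * f + \<beta> * pderiv f"
  have hn: "h \<noteq> 0" using h by (simp add: h_def)
  have "degree h \<le> degree (pderiv f)" unfolding h_def h(2) by (rule Least_le[of P, OF P1])
  then have hf: "degree h < degree f" using f by (simp add: degree_pderiv)
  obtain a q where aq: "a \<noteq> 0" "smult a f = h * q + pseudo_mod f h" using pseudo_mod(1)[OF hn] by blast
  have "pseudo_mod f h = ([:a:] - \<alpha> * q) * f + (- \<beta> * q) * pderiv f"
    using aq(2) by (simp add: h_def algebra_simps)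
  then have r: "pseudo_mod f h = 0"
  proof (rule contrapos_pp)
    assume n0: "pseudo_mod f h \<noteq> 0"
    show "pseudo_mod f h \<noteq> ([:a:] - \<alpha> * q) * f + (- \<beta> * q) * pderiv f"
    proof
      assume "pseudo_mod f h = ([:a:] - \<alpha> * q) * f + (- \<beta> * q) * pderiv f"
      then have "P (degree (pseudo_mod f h))" unfolding P_def using n0 by metis
      then have "(LEAST n. P n) \<le> degree (pseudo_mod f h)" by (rule Least_le[of P])
      then show False using n0 pseudo_mod(2)[OF hn, of f] h(2) by (simp add: h_def)
    qed
  qed
  have "degree h = 0"
  proof (rule ccontr)
    assume "degree h \<noteq> 0"
    have fn: "f \<noteq> 0" using f by auto
    have e: "smult a f = h * q" using aq(2) r by simp
    then have qn: "q \<noteq> 0" using aq(1) fn by auto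
    have "degree f = degree h + degree q" using e aq(1) hn qn by (metis degree_mult_eq degree_smult_eq)
    then have dq: "degree q < degree f" using \<open>degree h \<noteq> 0\<close> by simp
    define u where "u = poly_act q v"
    have "u \<in> U" unfolding u_def by (rule poly_act_in_subgroup[OF U v(1)])
    moreover have "u \<noteq> \<one>" using min[OF qn v(1,2)] dq by (auto simp: u_def)
    moreover have "poly_act h u = poly_act (smult a f) v" unfolding u_def e using vc by (simp add: poly_act_mult)
    then have "poly_act h u = \<one>" using v(3) vc by (simp add: poly_act_smult)
    ultimately show False using min[OF hn, of u] hf by simp
  qed
  then obtain D where D: "h = [:D:]" by (rule degree_eq_zeroE)
  with hn have "D \<noteq> 0 \<and> \<alpha> * f + \<beta> * pderiv f = [:D:]" by (auto simp: h_def)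
  then show ?thesis by blast
qed

text \<open>The minimal annihilator \<open>f\<close> has degree 1, since otherwise it has no integer
  root and yet splits into distinct linear factors modulo all large primes. The splitting comes from
  the hypothesis: the product \<open>q\<close> of linear factors maps \<open>v\<close> into
  \<open>p\<close>-th powers, which forces \<open>f\<close> to divide \<open>q\<close> modulo
  \<open>p\<close>.\<close>

lemma eigenvector:
  assumes split: "\<And>p::nat. prime p \<Longrightarrow>
      \<exists>rs. \<forall>v\<in>carrier G. \<exists>w\<in>carrier G. poly_act (\<Prod>r\<leftarrow>rs. [:- r, 1:]) v = w [^] int p"
    and U: "subgroup U G" "\<And>v. v \<in> U \<Longrightarrow> T v \<in> U" and ne: "U \<noteq> {\<one>}"
  shows "\<exists>v\<in>U. v \<noteq> \<one> \<and> (\<exists>a::int. T v = v [^] a)"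
proof (rule minimal_annihilator[OF U ne])
  fix f v assume v: "v \<in> U" "v \<noteq> \<one>" and f: "lead_coeff f = 1" "poly_act f v = \<one>" "degree f > 0"
    and min: "\<And>h u. h \<noteq> 0 \<Longrightarrow> u \<in> U \<Longrightarrow> u \<noteq> \<one> \<Longrightarrow> poly_act h u = \<one> \<Longrightarrow> degree f \<le> degree h"
  have vc: "v \<in> carrier G" using v U(1) subgroup.subset by blast
  show ?thesis
  proof (cases "degree f = 1")
    case True
    obtain a g where ag: "f = pCons a g" by (cases f)
    then have "degree g = 0" "g \<noteq> 0" using True by (auto split: if_splits)
    moreover obtain c where "g = [:c:]" using calculation(1) by (rule degree_eq_zeroE)
    ultimately have "f = [:a, 1:]" using f(1) ag by simp
    then have "v [^] a \<otimes> T v = \<one>" using f(2) vc by (simp add: poly_act_linear)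
    then have "T v = v [^] (- a)" using vc by (simp add: int_pow_neg inv_equality m_comm)
    with v show ?thesis by blast
  next
    case False
    have fn: "f \<noteq> 0" using f by auto
    \<comment> \<open>A root \<open>a\<close> would leave a nontrivial element killed by the linear
      polynomial \<open>x - a\<close>, against the minimality of a degree above 1.\<close>
    have noroot: "poly f a \<noteq> 0" for a
    proof
      assume "poly f a = 0"
      then obtain g where g: "f = [:- a, 1:] * g" by (auto simp: poly_eq_0_iff_dvd elim: dvdE)
      have gn: "g \<noteq> 0" using g fn by auto
      have "degree f = degree [:- a, 1:] + degree g" unfolding g using gn by (intro degree_mult_eq) auto
      then have dg: "degree g < degree f" by simp
      define u where "u = poly_act g v"
      have "u \<in> U" unfolding u_def by (rule poly_act_in_subgroup[OF U v(1)])
      moreover have "u \<noteq> \<one>" using min[OF gn v] dg by (auto simp: u_def)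
      moreover have "poly_act [:- a, 1:] u = poly_act f v"
        unfolding u_def g by (rule poly_act_mult[OF vc, symmetric])
      then have "poly_act [:- a, 1:] u = \<one>" using f(2) by simp
      ultimately have "degree f \<le> degree [:- a, 1:]" by (intro min) auto
      then show False using f(3) False by simp
    qed
    have "\<exists>\<alpha> \<beta> D. D \<noteq> 0 \<and> \<alpha> * f + \<beta> * pderiv f = [:D:]"
      by (rule separability_bezout[OF U v f(2,3)]) (assumption | rule min)+
    then obtain \<alpha> \<beta> D where D: "D \<noteq> 0" "\<alpha> * f + \<beta> * pderiv f = [:D:]" by (elim exE conjE)
    define M where "M = range (\<lambda>h. poly_act h v)"
    have M: "subgroup M G" unfolding M_def by (rule poly_act_orbit_subgroup[OF vc])
    obtain e :: int where e: "e > 0"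
      "\<And>p x. prime p \<Longrightarrow> \<not> p dvd e \<Longrightarrow> x \<in> carrier G \<Longrightarrow> x [^] p \<in> M \<Longrightarrow> x \<in> M"
      using isolated_exponent[OF fg M] by blast
    have "\<exists>R\<subseteq>{0..<int p}. card R = degree f \<and> (\<forall>r\<in>R. int p dvd poly f r)"
      if p: "prime p" and large: "p \<ge> Suc (nat (e + \<bar>D\<bar>))" for p :: nat
    proof -
      have pi: "prime (int p)" using p by simp
      have p0: "int p > 0" using p prime_gt_0_nat by simp
      \<comment> \<open>The bound on \<open>p\<close> exceeds both \<open>e\<close> and the absolute
        value of \<open>D\<close>, so \<open>p\<close> divides neither: the orbit of
        \<open>v\<close> is then isolated at \<open>p\<close>, and roots modulo \<open>p\<close> are
        simple.\<close>
      have pe: "\<not> int p dvd e" and pD: "\<not> int p dvd D"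
        using large e(1) D(1) dvd_imp_le_int[of e "int p"] dvd_imp_le_int[of D "int p"] by auto
      obtain rs0 where rs0: "\<forall>v\<in>carrier G. \<exists>w\<in>carrier G. poly_act (\<Prod>r\<leftarrow>rs0. [:- r, 1:]) v = w [^] int p"
        using split[OF p] by blast
      define q where "q = (\<Prod>r\<leftarrow>rs0. [:- r, 1:])"
      obtain w where w: "w \<in> carrier G" "poly_act q v = w [^] int p" using rs0 vc by (auto simp: q_def)
      have "w [^] int p \<in> M" unfolding M_def w(2)[symmetric] by (rule rangeI)
      \<comment> \<open>The \<open>p\<close>-th root \<open>w\<close> of an element of the orbit of
        \<open>v\<close> is again of the form \<open>b(T) v\<close>, and division by the monic
        \<open>f\<close> brings \<open>b\<close> below the degree of \<open>f\<close>.\<close>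
      then have "w \<in> M" using e(2)[OF pi pe w(1)] by simp
      then obtain b0 where "w = poly_act b0 v" by (auto simp: M_def)
      moreover obtain b1 b where b: "b0 = f * b1 + b" "b = 0 \<or> degree b < degree f" using monic_division[OF f(1)] .
      ultimately have wb: "w = poly_act b v"
        using vc f(2) by (simp add: poly_act_add mult.commute poly_act_mult)
      obtain a r where ar: "q = f * a + r" "r = 0 \<or> degree r < degree f" using monic_division[OF f(1)] .
      have "poly_act (r - smult (int p) b) v = \<one>"
      proof -
        have "poly_act r v = poly_act (q - a * f) v" using ar by (simp add: mult.commute)
        also have "\<dots> = w [^] int p" using vc f(2) w by (simp add: poly_act_diff poly_act_mult)
        finally show ?thesis using vc wb w by (simp add: poly_act_diff poly_act_smult)
      qed
      moreover have "r - smult (int p) b = 0 \<or> degree (r - smult (int p) b) < degree f"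
        using ar(2) b(2) f(3) by (auto intro!: degree_diff_less)
      \<comment> \<open>Minimality turns an identity of values at \<open>v\<close> into one of
        polynomials: \<open>q = f * a + p * b\<close> holds exactly, so \<open>q\<close> is
        congruent to \<open>f * a\<close> modulo \<open>p\<close>.\<close>
      ultimately have rb: "r = smult (int p) b" using min[of "r - smult (int p) b" v] v by fastforce
      have qm: "lead_coeff q = 1"
        unfolding q_def by (induction rs0) (simp_all add: lead_coeff_mult del: mult_pCons_left)
      have "degree f \<le> degree q"
      proof -
        show ?thesis
        proof (rule ccontr)
          assume small: "\<not> degree f \<le> degree q"
          have "a = 0"
          proof (rule ccontr)
            assume "a \<noteq> 0"
            then have "degree (f * a) = degree f + degree a" by (rule degree_mult_eq[OF fn])
            then have "degree q = degree f + degree a"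
              unfolding ar(1) using ar(2) f(3) by (subst degree_add_eq_left) auto
            with small show False by simp
          qed
          then have "q = smult (int p) b" using ar rb by simp
          then have "int p dvd lead_coeff q" by simp
          then show False using qm pi by simp
        qed
      qed
      have am: "lead_coeff a = 1"
      proof -
        have "a \<noteq> 0"
        proof
          assume "a = 0"
          then have "degree q < degree f" using ar qm f(3) by auto
          then show False using \<open>degree f \<le> degree q\<close> by simp
        qed
        then have "degree r < degree (f * a)" using ar(2) f(3) by (auto simp: degree_mult_eq[OF fn])
        then have "lead_coeff q = lead_coeff (f * a)" unfolding ar(1) add.commute[of "f * a" r] by (rule lead_coeff_add_le)
        then show ?thesis using qm f(1) by (simp add: lead_coeff_mult)
      qed
      define rs where "rs = map (\<lambda>r. r mod int p) rs0"
      have "[:int p:] dvd (\<Prod>r\<leftarrow>rs. [:- r, 1:]) - q"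
        using prod_linear_mod_cong[of "int p" rs0] by (simp add: rs_def q_def o_def)
      moreover have "f * a - q = [:int p:] * (- b)" using ar rb by simp
      then have "[:int p:] dvd f * a - q" by (metis dvd_triv_left)
      ultimately have "[:int p:] dvd (f * a - q) - ((\<Prod>r\<leftarrow>rs. [:- r, 1:]) - q)"
        by (rule dvd_diff[rotated])
      then have "[:int p:] dvd f * a - (\<Prod>r\<leftarrow>rs. [:- r, 1:])" by simp
      from splits_mod_prime_factor[OF pi f(1) am this] obtain ss where
        ss: "set ss \<subseteq> set rs" "length ss = degree f" "[:int p:] dvd f - (\<Prod>r\<leftarrow>ss. [:- r, 1:])" by blast
      have dist: "distinct ss" by (rule separable_split_distinct[OF pi ss(3) D(2) pD])
      have "int p dvd poly f r" if "r \<in> set ss" for r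
      proof -
        have "poly (\<Prod>r\<leftarrow>ss. [:- r, 1:]) r = 0"
          using that by (induction ss) auto
        moreover obtain c where "f - (\<Prod>r\<leftarrow>ss. [:- r, 1:]) = [:int p:] * c" using ss(3) by (rule dvdE)
        then have "poly (f - (\<Prod>r\<leftarrow>ss. [:- r, 1:])) r = int p * poly c r" by simp
        ultimately show ?thesis by simp
      qed
      moreover have "set ss \<subseteq> {0..<int p}" using ss(1) p0 by (auto simp: rs_def)
      moreover have "card (set ss) = degree f" using dist ss(2) distinct_card by metis
      ultimately show ?thesis by blast
    qed
    then have False
      using no_split_mod_all_primes[OF f(1) _ noroot, of "Suc (nat (e + \<bar>D\<bar>))"] f(3) False by simp
    then show ?thesis ..
  qed
qed


text \<open>Take a maximal cyclic group among those generated by eigenvectors for \<open>a\<close>.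
  The preimage of its generator \<open>u\<close> under \<open>T\<close> is again such an eigenvector
  and its \<open>a\<close>-th power is \<open>u\<close>; by maximality it is a power of
  \<open>u\<close>, so \<open>a\<close> is invertible.\<close>

lemma eigenvalue_unit:
  assumes T: "T \<in> iso G G" and v: "v \<in> carrier G" "v \<noteq> \<one>" "T v = v [^] (a::int)"
  shows "a = 1 \<or> a = -1"
proof -
  have inj: "inj_on T (carrier G)" and surj: "T ` carrier G = carrier G"
    using T by (auto simp: iso_def bij_betw_def)
  define \<A> where "\<A> = (\<lambda>u. generate G {u}) ` {u \<in> carrier G. u \<noteq> \<one> \<and> T u = u [^] a}"
  have "\<exists>M\<in>\<A>. \<forall>X\<in>\<A>. M \<subseteq> X \<longrightarrow> X = M"
  proof (rule subgroups_fin_gen_maximal[OF fg])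
    show "\<A> \<noteq> {}" using v by (auto simp: \<A>_def)
    show "subgroup H G" if "H \<in> \<A>" for H using that by (auto simp: \<A>_def intro!: generate_is_subgroup)
  qed
  then obtain u where u: "u \<in> carrier G" "u \<noteq> \<one>" "T u = u [^] a"
    and max: "\<And>X. X \<in> \<A> \<Longrightarrow> generate G {u} \<subseteq> X \<Longrightarrow> X = generate G {u}" by (auto simp: \<A>_def)
  obtain w where w: "w \<in> carrier G" "T w = u" using surj u(1) by (metis imageE)
  have "T (T w) = T (w [^] a)" using u w by (simp add: T.hom_int_pow)
  then have Tw: "T w = w [^] a" using inj w u by (simp add: inj_on_eq_iff)
  have "w \<noteq> \<one>" using w u(2) by auto
  then have "generate G {w} \<in> \<A>" using w Tw by (auto simp: \<A>_def)
  moreover have "generate G {u} \<subseteq> generate G {w}"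
  proof (rule generate_subgroup_incl)
    show "{u} \<subseteq> generate G {w}" using Tw w by (auto simp: generate_pow)
  qed (use w in \<open>auto intro: generate_is_subgroup\<close>)
  ultimately have "generate G {w} = generate G {u}" by (rule max)
  moreover have "w \<in> generate G {w}" by (rule generate.incl) simp
  ultimately obtain c :: int where "w = u [^] c" using u(1) by (auto simp: generate_pow)
  then have "w = w [^] (a * c)" using Tw w by (metis int_pow_pow)
  then have "w [^] (a * c - 1) = \<one>" using w by (simp add: int_pow_diff)
  then have "a * c = 1" using torsion_free[of w "a * c - 1"] w \<open>w \<noteq> \<one>\<close> by auto
  then show ?thesis using zmult_eq_1_iff by blast
qed

text \<open>Fitting's argument: the kernels of the powers of \<open>T^2 - 1\<close> become
  stationary. Were the image of the stable power nontrivial, it would contain an eigenvector, with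
  eigenvalue \<open>1\<close> or \<open>-1\<close>, hence a nontrivial element of that image killed
  by \<open>T^2 - 1\<close>, and the next kernel would be larger.\<close>

lemma square_unipotent:
  assumes T: "T \<in> iso G G"
    and split: "\<And>p::nat. prime p \<Longrightarrow>
      \<exists>rs. \<forall>v\<in>carrier G. \<exists>w\<in>carrier G. poly_act (\<Prod>r\<leftarrow>rs. [:- r, 1:]) v = w [^] int p"
  shows "\<exists>k. \<forall>v\<in>carrier G. poly_act ([:-1, 0, 1:] ^ k) v = \<one>"
proof -
  define q :: "int poly" where "q = [:-1, 0, 1:]"
  define K where "K = (\<lambda>k. {v \<in> carrier G. poly_act (q ^ k) v = \<one>})"
  have sK: "subgroup (K k) G" for k
  proof -
    interpret h: group_hom G G "poly_act (q ^ k)" by (rule poly_act_group_hom)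
    show ?thesis using h.subgroup_kernel by (simp add: kernel_def K_def)
  qed
  have "\<exists>M\<in>range K. \<forall>X\<in>range K. M \<subseteq> X \<longrightarrow> X = M"
    using sK by (intro subgroups_fin_gen_maximal[OF fg]) auto
  then obtain k where k: "\<And>j. K k \<subseteq> K j \<Longrightarrow> K j = K k" by auto
  have "K k \<subseteq> K (Suc k)" using poly_act_mult[of _ q "q ^ k"] by (auto simp: K_def)
  then have Kk: "K (Suc k) = K k" by (rule k)
  define U where "U = poly_act (q ^ k) ` carrier G"
  have U: "subgroup U G" unfolding U_def
    using group_hom.img_is_subgroup[OF poly_act_group_hom] .
  have TU: "T v \<in> U" if "v \<in> U" for v
    using that by (auto simp: U_def poly_act_T)
  have "U = {\<one>}"
  proof (rule ccontr)
    assume "U \<noteq> {\<one>}"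
    from eigenvector[OF split U TU this] obtain v a where v: "v \<in> U" "v \<noteq> \<one>" "T v = v [^] (a::int)" by blast
    have vc: "v \<in> carrier G" using v(1) subgroup.subset[OF U] by blast
    have "a = 1 \<or> a = -1" by (rule eigenvalue_unit[OF T vc v(2,3)])
    then have "T (T v) = v" using v(3) vc by (auto simp: int_pow_neg)
    then have "poly_act q v = \<one>" using vc by (simp add: q_def poly_act_square_minus_one)
    moreover obtain x where x: "x \<in> carrier G" "v = poly_act (q ^ k) x" using v(1) by (auto simp: U_def)
    ultimately have "x \<in> K (Suc k)" using poly_act_mult[of x q "q ^ k"] by (simp add: K_def)
    then have "x \<in> K k" using Kk by simp
    then show False using x v(2) by (simp add: K_def)
  qed
  then show ?thesis unfolding U_def q_def by blast
qed

end

text \<open>An abstraction of the maps \<open>lam B b\<close> restricted to an ideal inside the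
  socle. Composites and inverses are required to agree only on the carrier, because the maps are
  uncontrolled outside it.\<close>

locale flagged_action = comm_group G for G (structure) +
  fixes \<T> :: "('a \<Rightarrow> 'a) set"
  assumes fg: "subgroups_fin_gen G (carrier G)"
    and torsion_free: "\<And>x (k::int). x \<in> carrier G \<Longrightarrow> x [^] k = \<one> \<Longrightarrow> k = 0 \<or> x = \<one>"
    and iso: "\<And>T. T \<in> \<T> \<Longrightarrow> T \<in> iso G G"
    and closed: "\<And>S T. S \<in> \<T> \<Longrightarrow> T \<in> \<T> \<Longrightarrow> \<exists>R\<in>\<T>. \<forall>v\<in>carrier G. R v = S (T v)"
    and inverse: "\<And>T. T \<in> \<T> \<Longrightarrow> \<exists>S\<in>\<T>. \<forall>v\<in>carrier G. S (T v) = v"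
    and nontrivial: "carrier G \<noteq> {\<one>}"
begin

lemma endo: "T \<in> \<T> \<Longrightarrow> fin_gen_torsion_free_endo G T"
  using iso[of T] fg torsion_free
  by unfold_locales (auto simp: iso_def)

lemma T_closed [simp]: "T \<in> \<T> \<Longrightarrow> v \<in> carrier G \<Longrightarrow> T v \<in> carrier G"
  using iso[of T] by (auto simp: iso_def hom_def)

lemma T_mult: "T \<in> \<T> \<Longrightarrow> v \<in> carrier G \<Longrightarrow> w \<in> carrier G \<Longrightarrow> T (v \<otimes> w) = T v \<otimes> T w"
  using iso[of T] by (auto simp: iso_def hom_def)

lemma T_hom: "T \<in> \<T> \<Longrightarrow> group_hom G G T"
  using iso[of T] by unfold_locales (auto simp: iso_def)

lemma T_inv: "T \<in> \<T> \<Longrightarrow> v \<in> carrier G \<Longrightarrow> T (inv v) = inv (T v)"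
  using group_hom.hom_inv[OF T_hom] by blast

lemma T_inj: "T \<in> \<T> \<Longrightarrow> v \<in> carrier G \<Longrightarrow> w \<in> carrier G \<Longrightarrow> T v = T w \<Longrightarrow> v = w"
  using iso[of T] by (auto simp: iso_def bij_betw_def inj_on_def)

text \<open>One invariant step with cyclic quotient. Trivial quotients are permitted, since
  intersecting a series with an ideal may collapse steps.\<close>

definition flag_step :: "'a set \<Rightarrow> 'a set \<Rightarrow> bool" where
  "flag_step C D \<longleftrightarrow> subgroup C G \<and> subgroup D G \<and> C \<subseteq> D \<and>
     (\<forall>T\<in>\<T>. \<forall>x\<in>C. T x \<in> C) \<and> (\<forall>T\<in>\<T>. \<forall>x\<in>D. T x \<in> D) \<and>
     (\<exists>g\<in>D. \<forall>x\<in>D. \<exists>k::int. x \<otimes> inv (g [^] k) \<in> C)"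

definition powers :: "nat \<Rightarrow> 'a set" where
  "powers p = (\<lambda>x. x [^] int p) ` carrier G"

text \<open>On each cyclic quotient \<open>T\<close> multiplies the generator by some integer
  \<open>r\<close>, so \<open>T - r\<close> pushes the upper group into the lower one. The product
  over the steps is triangularity in the form of an annihilating polynomial modulo
  \<open>C\<close>.\<close>

lemma flag_eigenvalues:
  assumes "flag_step\<^sup>*\<^sup>* C D" "T \<in> \<T>" "D \<subseteq> carrier G" "C \<subseteq> carrier G"
  shows "\<exists>rs. \<forall>v\<in>D. comm_group_endo.poly_act G T (\<Prod>r\<leftarrow>rs. [:- r, 1:]) v \<in> C"
  using assms(1,3)
proof (induction rule: rtranclp_induct)
  case base
  interpret E: fin_gen_torsion_free_endo G T by (rule endo[OF assms(2)])
  show ?case by (rule exI[of _ "[]"]) (use assms(4) in auto)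
next
  case (step D E)
  interpret E: fin_gen_torsion_free_endo G T by (rule endo[OF assms(2)])
  note s = step.hyps(2)[unfolded flag_step_def]
  have Dc: "D \<subseteq> carrier G" using s subgroup.subset by blast
  obtain rs where rs: "\<forall>v\<in>D. E.poly_act (\<Prod>r\<leftarrow>rs. [:- r, 1:]) v \<in> C" using step.IH[OF Dc] by blast
  obtain g where g: "g \<in> E" "\<forall>x\<in>E. \<exists>k::int. x \<otimes> inv (g [^] k) \<in> D" using s by blast
  have gc: "g \<in> carrier G" using g step.prems by blast
  have "T g \<in> E" using s g(1) assms(2) by blast
  then obtain r :: int where r: "T g \<otimes> inv (g [^] r) \<in> D" using g(2) by blast
  have low: "E.poly_act [:- r, 1:] x \<in> D" if x: "x \<in> E" for x
  proof -
    interpret h: group_hom G G "E.poly_act [:- r, 1:]" by (rule E.poly_act_group_hom)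
    obtain k :: int where k: "x \<otimes> inv (g [^] k) \<in> D" using g(2) x by blast
    define c where "c = x \<otimes> inv (g [^] k)"
    have cc: "c \<in> carrier G" using k Dc by (auto simp: c_def)
    have "x = c \<otimes> g [^] k" using x step.prems gc by (auto simp: c_def m_assoc)
    then have "E.poly_act [:- r, 1:] x = E.poly_act [:- r, 1:] c \<otimes> E.poly_act [:- r, 1:] g [^] k"
      using cc gc by (simp add: h.hom_int_pow)
    moreover have "E.poly_act [:- r, 1:] c \<in> D"
      using s k assms(2) by (intro E.poly_act_in_subgroup) (auto simp: c_def)
    moreover have "E.poly_act [:- r, 1:] g \<in> D"
      using r gc by (simp add: E.poly_act_linear int_pow_neg m_comm)
    ultimately show ?thesis using s by (metis subgroup.m_closed subgroup_int_pow_closed)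
  qed
  show ?case
  proof (intro exI[of _ "rs @ [r]"] ballI)
    fix v assume v: "v \<in> E"
    then have "E.poly_act (\<Prod>r\<leftarrow>rs @ [r]. [:- r, 1:]) v = E.poly_act (\<Prod>r\<leftarrow>rs. [:- r, 1:]) (E.poly_act [:- r, 1:] v)"
      using step.prems by (simp add: E.poly_act_mult[symmetric] subset_iff del: mult_pCons_right mult_pCons_left)
    then show "E.poly_act (\<Prod>r\<leftarrow>rs @ [r]. [:- r, 1:]) v \<in> C" using rs low[OF v] by simp
  qed
qed

text \<open>The operator \<open>T^2 - 1\<close>. In \<open>fold sq_diff ts\<close> the head of the
  list acts first.\<close>

definition sq_diff :: "('a \<Rightarrow> 'a) \<Rightarrow> 'a \<Rightarrow> 'a" where
  "sq_diff T x = T (T x) \<otimes> inv x"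

lemma sq_diff_hom: "T \<in> \<T> \<Longrightarrow> group_hom G G (sq_diff T)"
proof
  assume T: "T \<in> \<T>"
  show "sq_diff T \<in> hom G G"
    using T by (auto simp: sq_diff_def hom_def T_mult inv_mult m_ac)
qed

lemma sq_diff_closed [simp]: "T \<in> \<T> \<Longrightarrow> x \<in> carrier G \<Longrightarrow> sq_diff T x \<in> carrier G"
  by (simp add: sq_diff_def)

lemma fold_sq_diff_closed: "set ts \<subseteq> \<T> \<Longrightarrow> x \<in> carrier G \<Longrightarrow> fold sq_diff ts x \<in> carrier G"
  by (induction ts arbitrary: x) auto


text \<open>With \<open>r\<close> the eigenvalue on the quotient, unipotence gives
  \<open>(r^2 - 1)^k g = 0\<close> modulo \<open>C\<close>, while \<open>p g = 0\<close> modulo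
  \<open>C\<close>. If \<open>p\<close> divides \<open>r^2 - 1\<close>, then \<open>T^2 - 1\<close>
  vanishes on the quotient; otherwise the two multipliers are coprime and the quotient itself is
  trivial.\<close>

lemma sq_diff_lower:
  assumes step: "flag_step C D" and p: "prime p" "powers p \<subseteq> C" and T: "T \<in> \<T>"
    and unip: "\<forall>v\<in>carrier G. comm_group_endo.poly_act G T ([:-1, 0, 1:] ^ k) v = \<one>"
    and x: "x \<in> D"
  shows "sq_diff T x \<in> C"
proof -
  interpret E: fin_gen_torsion_free_endo G T by (rule endo[OF T])
  interpret h: group_hom G G "sq_diff T" by (rule sq_diff_hom[OF T])
  note s = step[unfolded flag_step_def]
  have sC: "subgroup C G" and TC: "\<And>x. x \<in> C \<Longrightarrow> T x \<in> C" using s T by auto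
  have Dc: "D \<subseteq> carrier G" using s subgroup.subset by blast
  have Cc: "C \<subseteq> carrier G" using s subgroup.subset by blast
  obtain g where g: "g \<in> D" "\<forall>x\<in>D. \<exists>k::int. x \<otimes> inv (g [^] k) \<in> C" using s by blast
  have gc: "g \<in> carrier G" using g Dc by blast
  have "T g \<in> D" using s g(1) T by blast
  then obtain r :: int where r: "T g \<otimes> inv (g [^] r) \<in> C" using g(2) by blast
  note eig = E.poly_act_eigen_mod[OF sC TC gc r]
  have in_C: "g [^] m \<in> C" if "E.poly_act f g \<in> C" "poly f r = m" for f m
  proof -
    have "inv (E.poly_act f g \<otimes> inv (g [^] m)) \<otimes> E.poly_act f g \<in> C"
      using eig[of f] that sC by (metis subgroup.m_closed subgroup.m_inv_closed)
    also have "inv (E.poly_act f g \<otimes> inv (g [^] m)) \<otimes> E.poly_act f g = g [^] m"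
      using gc by (simp add: inv_mult m_ac)
    finally show ?thesis .
  qed
  have "g [^] ((r\<^sup>2 - 1) ^ k) \<in> C"
  proof (rule in_C)
    show "E.poly_act ([:-1, 0, 1:] ^ k) g \<in> C" using unip gc subgroup.one_closed[OF sC] by simp
    show "poly ([:-1, 0, 1:] ^ k) r = (r\<^sup>2 - 1) ^ k" by (simp add: power2_eq_square)
  qed
  moreover have gp: "g [^] int p \<in> C" using p gc by (auto simp: powers_def)
  ultimately have mult: "g [^] (u * int p + w * (r\<^sup>2 - 1) ^ k) \<in> C" for u w
    using sC gc subgroup_int_pow_closed[OF sC]
    by (simp add: int_pow_mult int_pow_pow[symmetric] mult.commute[of _ "int p"] mult.commute[of _ "(r\<^sup>2 - 1) ^ k"]
        subgroup.m_closed)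
  have "g [^] (r\<^sup>2 - 1) \<in> C"
  proof (cases "int p dvd r\<^sup>2 - 1")
    case True
    then obtain q where "r\<^sup>2 - 1 = q * int p" by (metis dvdE mult.commute)
    then show ?thesis using mult[of q 0] by simp
  next
    case False
    then have "coprime (int p) ((r\<^sup>2 - 1) ^ k)" using p by (simp add: prime_imp_coprime)
    then obtain u w where "u * int p + w * (r\<^sup>2 - 1) ^ k = 1" by (metis bezout_int coprime_imp_gcd_eq_1)
    then have "(r\<^sup>2 - 1) * u * int p + (r\<^sup>2 - 1) * w * (r\<^sup>2 - 1) ^ k = r\<^sup>2 - 1"
      by (metis distrib_left mult.assoc mult.right_neutral)
    then show ?thesis using mult[of "(r\<^sup>2 - 1) * u" "(r\<^sup>2 - 1) * w"] by simp
  qed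
  moreover have "E.poly_act [:-1, 0, 1:] g \<otimes> inv (g [^] poly [:-1, 0, 1:] r) \<in> C" by (rule eig)
  then have "sq_diff T g \<otimes> inv (g [^] (r\<^sup>2 - 1)) \<in> C"
    using gc by (simp add: E.poly_act_square_minus_one sq_diff_def power2_eq_square)
  ultimately have "sq_diff T g \<otimes> inv (g [^] (r\<^sup>2 - 1)) \<otimes> g [^] (r\<^sup>2 - 1) \<in> C"
    using sC by (metis subgroup.m_closed)
  then have sg: "sq_diff T g \<in> C" using gc T by (simp add: m_assoc)
  obtain k :: int where k: "x \<otimes> inv (g [^] k) \<in> C" using g(2) x by blast
  define c where "c = x \<otimes> inv (g [^] k)"
  have cC: "c \<in> C" using k by (simp add: c_def)
  then have cc: "c \<in> carrier G" using Cc by blast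
  have "x = c \<otimes> g [^] k" using x Dc gc by (auto simp: c_def m_assoc)
  then have "sq_diff T x = sq_diff T c \<otimes> sq_diff T g [^] k"
    using cc gc by (simp add: h.hom_int_pow)
  moreover have "sq_diff T c \<in> C"
    unfolding sq_diff_def using TC[OF TC[OF cC]] cC sC by (metis subgroup.m_closed subgroup.m_inv_closed)
  ultimately show ?thesis using sC sg by (metis subgroup.m_closed subgroup_int_pow_closed)
qed

lemma powers_subgroup: "subgroup (powers p) G"
proof -
  have "(\<lambda>x. x [^] int p) \<in> hom G G" by (auto simp: hom_def int_pow_distrib)
  then interpret h: group_hom G G "\<lambda>x. x [^] int p" by unfold_locales
  show ?thesis unfolding powers_def by (rule h.img_is_subgroup)
qed

lemma powers_invariant: "T \<in> \<T> \<Longrightarrow> x \<in> powers p \<Longrightarrow> T x \<in> powers p"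
  using group_hom.hom_int_pow[OF T_hom] by (fastforce simp: powers_def)

lemma sq_diff_powers: "T \<in> \<T> \<Longrightarrow> x \<in> powers p \<Longrightarrow> sq_diff T x \<in> powers p"
  unfolding sq_diff_def using powers_invariant powers_subgroup
  by (metis subgroup.m_closed subgroup.m_inv_closed)

lemma fold_sq_diff_powers: "set ts \<subseteq> \<T> \<Longrightarrow> x \<in> powers p \<Longrightarrow> fold sq_diff ts x \<in> powers p"
  by (induction ts arbitrary: x) (auto simp: sq_diff_powers)

text \<open>The flag has at most as many proper steps as \<open>G\<close> has generators, because \<open>k\<close> proper steps
  produce \<open>p ^ k\<close> elements that are pairwise incongruent modulo \<open>p\<close>-th powers.\<close>

lemma flag_length:
  assumes "flag_step\<^sup>*\<^sup>* (powers p) D" and p: "prime p"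
    and unip: "\<And>T. T \<in> \<T> \<Longrightarrow> \<exists>k. \<forall>v\<in>carrier G. comm_group_endo.poly_act G T ([:-1, 0, 1:] ^ k) v = \<one>"
  shows "powers p \<subseteq> D \<and> (\<exists>k E. finite E \<and> E \<subseteq> D \<and> card E = p ^ k \<and>
    (\<forall>x\<in>E. \<forall>y\<in>E. x \<otimes> inv y \<in> powers p \<longrightarrow> x = y) \<and>
    (\<forall>ts x. set ts \<subseteq> \<T> \<longrightarrow> k \<le> length ts \<longrightarrow> x \<in> D \<longrightarrow> fold sq_diff ts x \<in> powers p))"
  using assms(1)
proof (induction rule: rtranclp_induct)
  case base
  show ?case
  proof (intro conjI exI[of _ 0] exI[of _ "{\<one>}"])
    show "{\<one>} \<subseteq> powers p" using subgroup.one_closed[OF powers_subgroup] by blast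
  qed (auto simp: fold_sq_diff_powers)
next
  case (step C D)
  note s = step.hyps(2)[unfolded flag_step_def]
  from step.IH obtain k E where pC: "powers p \<subseteq> C" and E: "finite E" "E \<subseteq> C" "card E = p ^ k"
    "\<forall>x\<in>E. \<forall>y\<in>E. x \<otimes> inv y \<in> powers p \<longrightarrow> x = y"
    and ts: "\<And>ts x. set ts \<subseteq> \<T> \<Longrightarrow> k \<le> length ts \<Longrightarrow> x \<in> C \<Longrightarrow> fold sq_diff ts x \<in> powers p"
    by blast
  have sC: "subgroup C G" and sD: "subgroup D G" and CD: "C \<subseteq> D" using s by auto
  have Cc: "C \<subseteq> carrier G" and Dc: "D \<subseteq> carrier G" using sC sD subgroup.subset by auto
  obtain g where g: "g \<in> D" "\<forall>x\<in>D. \<exists>k::int. x \<otimes> inv (g [^] k) \<in> C" using s by blast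
  have gc: "g \<in> carrier G" using g Dc by blast
  have pD: "powers p \<subseteq> D" using pC CD by blast
  show ?case
  \<comment> \<open>A step with \<open>g\<close> in \<open>C\<close> is trivial and must not be
    counted: \<open>k\<close> has to be the number of proper steps for the size \<open>p ^ k\<close>
    to hold.\<close>
  proof (cases "g \<in> C")
    case True
    have "D \<subseteq> C"
    proof
      fix x assume x: "x \<in> D"
      then obtain k :: int where "x \<otimes> inv (g [^] k) \<in> C" using g(2) by blast
      then have "x \<otimes> inv (g [^] k) \<otimes> g [^] k \<in> C"
        using True sC by (metis subgroup.m_closed subgroup_int_pow_closed)
      then show "x \<in> C" using x gc Dc by (auto simp: m_assoc)
    qed
    with CD have "D = C" by blast
    with step.IH show ?thesis by simp
  next
    case False
    have p1: "p > 0" using p(1) prime_gt_0_nat by blast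
    have gp: "g [^] int p \<in> C" using pC gc by (auto simp: powers_def)
    have gC: "int p dvd m" if m: "g [^] m \<in> C" for m :: int
    proof (rule ccontr)
      assume "\<not> int p dvd m"
      then have "coprime (int p) m" using p by (simp add: prime_imp_coprime)
      then obtain u w where uw: "u * int p + w * m = 1" by (metis bezout_int coprime_imp_gcd_eq_1)
      have "(g [^] int p) [^] u \<otimes> (g [^] m) [^] w \<in> C"
        using gp m sC by (metis subgroup.m_closed subgroup_int_pow_closed)
      also have "(g [^] int p) [^] u \<otimes> (g [^] m) [^] w = g [^] (u * int p + w * m)"
        using gc by (simp add: int_pow_pow int_pow_mult mult.commute)
      finally show False using uw False gc by simp
    qed
    \<comment> \<open>In a proper step the quotient has order \<open>p\<close>, so \<open>p\<close>
      translates of \<open>E\<close> by powers of \<open>g\<close> are pairwise incongruent.\<close>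
    define F where "F = (\<lambda>(x, j). x \<otimes> g [^] j) ` (E \<times> {0..<int p})"
    have key: "x = y \<and> i = j" if A: "x \<in> E" "y \<in> E" "i \<in> {0..<int p}" "j \<in> {0..<int p}"
      "(x \<otimes> g [^] i) \<otimes> inv (y \<otimes> g [^] j) \<in> powers p" for x y i j
    proof -
      have c: "x \<in> carrier G" "y \<in> carrier G" "x \<in> C" "y \<in> C" using A E(2) Cc by auto
      have eq: "(x \<otimes> g [^] i) \<otimes> inv (y \<otimes> g [^] j) = (x \<otimes> inv y) \<otimes> g [^] (i - j)"
        using c gc by (simp add: inv_mult int_pow_diff m_ac)
      have xyC: "x \<otimes> inv y \<in> C" using c sC by (metis subgroup.m_closed subgroup.m_inv_closed)
      have "inv (x \<otimes> inv y) \<otimes> ((x \<otimes> inv y) \<otimes> g [^] (i - j)) \<in> C"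
        using A(5) eq pC xyC sC by (metis subgroup.m_closed subgroup.m_inv_closed subsetD)
      moreover have "inv u \<otimes> (u \<otimes> h) = h" if "u \<in> carrier G" "h \<in> carrier G" for u h
        using that by (simp add: m_assoc[symmetric])
      ultimately have "g [^] (i - j) \<in> C" using c gc by simp
      then have "int p dvd i - j" by (rule gC)
      then have ij: "i = j" using A(3,4) by (auto dest: zdvd_imp_le simp: mod_eq_dvd_iff[symmetric])
      then have "x \<otimes> inv y \<in> powers p" using A(5) eq c by simp
      with E(4) A(1,2) ij show ?thesis by blast
    qed
    have self: "u \<otimes> inv u \<in> powers p" if "u \<in> carrier G" for u
      using that subgroup.one_closed[OF powers_subgroup] by simp
    show ?thesis
    proof (intro conjI pD exI[of _ "Suc k"] exI[of _ F] ballI allI impI)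
      show "finite F" unfolding F_def using E(1) by simp
      show "F \<subseteq> D" unfolding F_def using E(2) CD g(1) sD
        by (auto intro!: subgroup.m_closed[OF sD] subgroup_int_pow_closed[OF sD])
      have "inj_on (\<lambda>(x, j). x \<otimes> g [^] j) (E \<times> {0..<int p})"
      proof (rule inj_onI, clarify)
        fix x i y j assume A: "x \<in> E" "i \<in> {0..<int p}" "y \<in> E" "j \<in> {0..<int p}" "x \<otimes> g [^] i = y \<otimes> g [^] j"
        have "y \<otimes> g [^] j \<in> carrier G" using A(3) E(2) Cc gc by auto
        then have "(x \<otimes> g [^] i) \<otimes> inv (y \<otimes> g [^] j) \<in> powers p" using A(5) self by simp
        with A key show "x = y \<and> i = j" by blast
      qed
      then have "card F = card (E \<times> {0..<int p})" unfolding F_def by (rule card_image)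
      then show "card F = p ^ Suc k" using E(3) by (simp add: card_cartesian_product)
      show "u = w" if "u \<in> F" "w \<in> F" "u \<otimes> inv w \<in> powers p" for u w
        using that key unfolding F_def by fastforce
      fix ts x assume A: "set ts \<subseteq> \<T>" "Suc k \<le> length ts" "x \<in> D"
      then obtain t ts' where t: "ts = t # ts'" by (cases ts) auto
      then have tT: "t \<in> \<T>" using A(1) by simp
      \<comment> \<open>The first operator of the list moves \<open>x\<close> down through the top
        step; the remaining ones are handled by the induction hypothesis for
        \<open>C\<close>.\<close>
      obtain m where "\<forall>v\<in>carrier G. comm_group_endo.poly_act G t ([:-1, 0, 1:] ^ m) v = \<one>"
        using unip[OF tT] by blast
      from sq_diff_lower[OF step.hyps(2) p pC tT this A(3)] show "fold sq_diff ts x \<in> powers p"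
        using ts[of ts' "sq_diff t x"] A t by simp
    qed
  qed
qed

text \<open>For a prime not dividing the exponent belonging to the cyclic group of \<open>w\<close>,
  a \<open>p\<close>-th root of \<open>w\<close> would be a power of \<open>w\<close>, which would
  make \<open>p\<close> a unit.\<close>

lemma nonpower:
  assumes "w \<in> carrier G" "\<And>p. prime p \<Longrightarrow> w \<in> powers p"
  shows "w = \<one>"
proof (rule ccontr)
  assume ne: "w \<noteq> \<one>"
  have M: "subgroup (generate G {w}) G" using assms(1) by (intro generate_is_subgroup) auto
  obtain e :: int where e: "e > 0"
    "\<And>p x. prime p \<Longrightarrow> \<not> p dvd e \<Longrightarrow> x \<in> carrier G \<Longrightarrow> x [^] p \<in> generate G {w} \<Longrightarrow> x \<in> generate G {w}"
    using isolated_exponent[OF fg M] by blast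
  obtain p :: nat where p: "prime p" "p > nat e" using bigger_prime by blast
  obtain x where x: "x \<in> carrier G" "w = x [^] int p" using assms(2)[OF p(1)] by (auto simp: powers_def)
  have "\<not> int p dvd e" using p(2) e(1) zdvd_imp_le by fastforce
  moreover have "x [^] int p \<in> generate G {w}" unfolding x(2)[symmetric] by (rule generate.incl) simp
  ultimately have "x \<in> generate G {w}" using e(2)[of "int p" x] p(1) x(1) by simp
  then obtain c :: int where "x = w [^] c" using assms(1) by (auto simp: generate_pow)
  then have "w = w [^] (c * int p)" using x(2) assms(1) int_pow_pow by metis
  then have "w [^] (c * int p - 1) = \<one>" using assms(1) by (simp add: int_pow_diff)
  then have "c * int p = 1" using torsion_free assms(1) ne by fastforce
  then have "int p dvd 1" by (metis dvd_triv_right)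
  then show False using p(1) not_prime_unit by simp
qed


lemma split_of_flag:
  assumes flags: "\<And>p. prime p \<Longrightarrow> flag_step\<^sup>*\<^sup>* (powers p) (carrier G)" and T: "T \<in> \<T>" and p: "prime p"
  shows "\<exists>rs. \<forall>v\<in>carrier G. \<exists>w\<in>carrier G.
    comm_group_endo.poly_act G T (\<Prod>r\<leftarrow>rs. [:- r, 1:]) v = w [^] int p"
  using flag_eigenvalues[OF flags[OF p] T subset_refl subgroup.subset[OF powers_subgroup]]
  by (fastforce simp: powers_def)

text \<open>Any \<open>s\<close> of the operators \<open>T^2 - 1\<close> compose to the trivial map,
  where \<open>s\<close> is the number of generators of the group. The last nontrivial value of a
  longest composite is killed by all of them.\<close>

lemma fixed_by_squares:
  assumes flags: "\<And>p. prime p \<Longrightarrow> flag_step\<^sup>*\<^sup>* (powers p) (carrier G)"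
  shows "\<exists>v\<in>carrier G. v \<noteq> \<one> \<and> (\<forall>T\<in>\<T>. sq_diff T v = \<one>)"
proof -
  have unip: "\<exists>k. \<forall>v\<in>carrier G. comm_group_endo.poly_act G T ([:-1, 0, 1:] ^ k) v = \<one>" if T: "T \<in> \<T>" for T
    using fin_gen_torsion_free_endo.square_unipotent[OF endo[OF T] iso[OF T]] split_of_flag[OF flags T] by blast
  from subgroups_fin_genE[OF fg subgroup_self subset_refl]
  obtain F where F: "finite F" "F \<subseteq> carrier G" "generate G F = carrier G" .
  define s where "s = card F"
  have zero: "fold sq_diff ts x = \<one>" if ts: "set ts \<subseteq> \<T>" "length ts = s" and x: "x \<in> carrier G" for ts x
  proof (rule nonpower)
    show "fold sq_diff ts x \<in> carrier G" using ts(1) x by (rule fold_sq_diff_closed)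
    fix p :: nat assume p: "prime p"
    have p1: "p > 1" using p prime_gt_1_nat by blast
    obtain k E where E: "finite E" "E \<subseteq> carrier G" "card E = p ^ k"
      "\<forall>x\<in>E. \<forall>y\<in>E. x \<otimes> inv y \<in> powers p \<longrightarrow> x = y"
      and low: "\<forall>ts x. set ts \<subseteq> \<T> \<longrightarrow> k \<le> length ts \<longrightarrow> x \<in> carrier G \<longrightarrow> fold sq_diff ts x \<in> powers p"
      using flag_length[OF flags[OF p] p unip] by blast
    obtain R where R: "finite R" "R \<subseteq> carrier G" "card R \<le> p ^ s"
      "\<forall>x\<in>carrier G. \<exists>r\<in>R. \<exists>y\<in>carrier G. x = r \<otimes> y [^] int p"
      using generate_mod_powers_finite[OF F(1,2), of p] p1 unfolding F(3) s_def by auto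
    have "\<forall>x\<in>E. \<exists>r. r \<in> R \<and> (\<exists>y\<in>carrier G. x = r \<otimes> y [^] int p)" using R(4) E(2) by blast
    from bchoice[OF this] obtain r where r: "\<forall>x\<in>E. r x \<in> R \<and> (\<exists>y\<in>carrier G. x = r x \<otimes> y [^] int p)" by blast
    \<comment> \<open>Incongruent elements have different representatives, so
      \<open>p ^ k <= p ^ s\<close>: the number of proper steps is at most \<open>s\<close> for
      every \<open>p\<close>, and one length of list serves all primes.\<close>
    have "inj_on r E"
    proof (rule inj_onI)
      fix x y assume A: "x \<in> E" "y \<in> E" "r x = r y"
      obtain a where a: "a \<in> carrier G" "x = r x \<otimes> a [^] int p" using r A by blast
      obtain b where b: "b \<in> carrier G" "y = r x \<otimes> b [^] int p" using r A by metis
      have rc: "r x \<in> carrier G" using r A R by blast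
      have "x \<otimes> inv y = (r x \<otimes> a [^] int p) \<otimes> inv (r x \<otimes> b [^] int p)" using a b by metis
      also have "\<dots> = (a \<otimes> inv b) [^] int p"
      proof -
        have "(u \<otimes> c) \<otimes> inv (u \<otimes> d) = c \<otimes> inv d" if "u \<in> carrier G" "c \<in> carrier G" "d \<in> carrier G" for u c d
        proof -
          have "(u \<otimes> c) \<otimes> inv (u \<otimes> d) = (u \<otimes> inv u) \<otimes> (c \<otimes> inv d)"
            using that by (simp add: inv_mult m_ac del: r_inv l_inv)
          then show ?thesis using that by simp
        qed
        then have "(r x \<otimes> a [^] int p) \<otimes> inv (r x \<otimes> b [^] int p) = a [^] int p \<otimes> inv (b [^] int p)"
          using a(1) b(1) rc by blast
        also have "\<dots> = (a \<otimes> inv b) [^] int p" using a(1) b(1) by (simp add: int_pow_distrib int_pow_inv)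
        finally show ?thesis .
      qed
      finally have "x \<otimes> inv y \<in> powers p" using a b by (auto simp: powers_def)
      then show "x = y" using E(4) A by blast
    qed
    then have "card E \<le> card R" using r R(1) by (intro card_inj_on_le) auto
    then have "p ^ k \<le> p ^ s" using E(3) R(3) by simp
    then have "k \<le> s" using p1 by simp
    then show "fold sq_diff ts x \<in> powers p" using low ts x by blast
  qed
  define P where "P = (\<lambda>n. \<exists>ts x. set ts \<subseteq> \<T> \<and> length ts = n \<and> x \<in> carrier G \<and> fold sq_diff ts x \<noteq> \<one>)"
  have "P 0" using nontrivial unfolding P_def by (auto intro!: exI[of _ "[]"])
  moreover have "\<not> P s" using zero by (auto simp: P_def)
  \<comment> \<open>Composites of length 0 are nontrivial and those of length \<open>s\<close> are
    trivial, so there is a last nontrivial length before some drop.\<close>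
  ultimately obtain n where n: "P n" "\<not> P (Suc n)"
    by (metis dec_induct le0)
  then obtain ts x where ts: "set ts \<subseteq> \<T>" "length ts = n" "x \<in> carrier G" "fold sq_diff ts x \<noteq> \<one>"
    by (auto simp: P_def)
  show ?thesis
  proof (intro bexI[of _ "fold sq_diff ts x"] conjI ballI ts(4))
    fix T assume T: "T \<in> \<T>"
    show "sq_diff T (fold sq_diff ts x) = \<one>"
    proof (rule ccontr)
      assume "sq_diff T (fold sq_diff ts x) \<noteq> \<one>"
      then have "P (Suc n)" unfolding P_def
        using ts T by (intro exI[of _ "ts @ [T]"] exI[of _ x]) auto
      with n(2) show False ..
    qed
  qed (use fold_sq_diff_closed ts in blast)
qed

text \<open>On the elements fixed by all squares the maps are commuting involutions. Their common
  eigenspaces cannot be split off over the integers; instead a product of operators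
  \<open>T + 1\<close> is chosen whose kernel is maximal among those that are proper in
  \<open>W\<close>, and any nontrivial value of it is a common eigenvector.\<close>

theorem common_eigenvector:
  assumes flags: "\<And>p. prime p \<Longrightarrow> flag_step\<^sup>*\<^sup>* (powers p) (carrier G)"
  shows "\<exists>v\<in>carrier G. v \<noteq> \<one> \<and> (\<forall>T\<in>\<T>. T v = v \<or> T v = inv v)"
proof -
  define W where "W = {v \<in> carrier G. \<forall>T\<in>\<T>. T (T v) = v}"
  have Wc: "v \<in> carrier G" if "v \<in> W" for v using that by (simp add: W_def)
  have W2: "T (T v) = v" if "v \<in> W" "T \<in> \<T>" for v T using that by (simp add: W_def)
  have Wmult: "v \<otimes> w \<in> W" if "v \<in> W" "w \<in> W" for v w using that by (auto simp: W_def T_mult)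
  have Winv: "inv v \<in> W" if "v \<in> W" for v using that by (auto simp: W_def T_inv)
  have one: "T \<one> = \<one>" if "T \<in> \<T>" for T using group_hom.hom_one[OF T_hom[OF that]] .
  have TW: "T v \<in> W" if v: "v \<in> W" and T: "T \<in> \<T>" for v T
  proof -
    obtain T' where T': "T' \<in> \<T>" "\<And>v. v \<in> carrier G \<Longrightarrow> T' (T v) = v" using inverse[OF T] by blast
    have TT': "T (T' x) = x" if "x \<in> carrier G" for x
      by (rule T_inj[OF T'(1)]) (use that T T' in auto)
    have "S (S (T v)) = T v" if S: "S \<in> \<T>" for S
    proof -
      obtain R where R: "R \<in> \<T>" "\<forall>v\<in>carrier G. R v = S (T v)" using closed[OF S T] by blast
      obtain Q where Q: "Q \<in> \<T>" "\<forall>v\<in>carrier G. Q v = T' (R v)" using closed[OF T'(1) R(1)] by blast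
      \<comment> \<open>The conjugate of \<open>S\<close> by \<open>T\<close> belongs to the family,
        so its square fixes \<open>v\<close>; this says that the square of \<open>S\<close> fixes
        \<open>T v\<close>.\<close>
      have "T' (S (T (T' (S (T v))))) = v" using W2[OF v Q(1)] Q(2) R Wc[OF v] T T' S by simp
      then have "T' (S (S (T v))) = T' (T v)" using TT' T' Wc[OF v] T S by simp
      then show ?thesis using T' T S Wc[OF v] by (meson T_closed T_inj)
    qed
    then show ?thesis using T Wc[OF v] by (simp add: W_def)
  qed
  have commT: "S (T v) = T (S v)" if v: "v \<in> W" and ST: "S \<in> \<T>" "T \<in> \<T>" for v S T
  proof -
    obtain R where R: "R \<in> \<T>" "\<forall>v\<in>carrier G. R v = S (T v)" using closed[OF ST] by blast
    \<comment> \<open>The composite of \<open>S\<close> and \<open>T\<close> is itself an involution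
      on \<open>W\<close>, which makes the two involutions commute.\<close>
    have "S (T (S (T v))) = v" using W2[OF v R(1)] R(2) Wc[OF v] ST by simp
    then have "S (S (T (S (T v)))) = S v" by simp
    then have "T (S (T v)) = S v" using W2[of "T (S (T v))" S] TW v ST by simp
    then have "T (T (S (T v))) = T (S v)" by simp
    then show ?thesis using W2[of "S (T v)" T] TW v ST by simp
  qed
  define plus where "plus = (\<lambda>T x. T x \<otimes> x)"
  have plusW: "plus T x \<in> W" if "T \<in> \<T>" "x \<in> W" for T x using that TW Wmult by (simp add: plus_def)
  have foldW: "fold plus ts x \<in> W" if "set ts \<subseteq> \<T>" "x \<in> W" for ts x
    using that by (induction ts arbitrary: x) (auto simp: plusW)
  have fold_mult: "fold plus ts (x \<otimes> y) = fold plus ts x \<otimes> fold plus ts y"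
    if "set ts \<subseteq> \<T>" "x \<in> W" "y \<in> W" for ts x y
    using that
  proof (induction ts arbitrary: x y)
    case (Cons t ts)
    have "plus t (x \<otimes> y) = plus t x \<otimes> plus t y"
      using Cons.prems Wc by (simp add: plus_def T_mult m_ac)
    then show ?case using Cons plusW by simp
  qed simp
  have fold_one: "fold plus ts \<one> = \<one>" if "set ts \<subseteq> \<T>" for ts
    using that by (induction ts) (auto simp: plus_def one)
  have fold_inv: "fold plus ts (inv x) = inv (fold plus ts x)" if "set ts \<subseteq> \<T>" "x \<in> W" for ts x
  proof -
    have "fold plus ts (inv x) \<otimes> fold plus ts x = \<one>"
      using fold_mult[OF that(1) Winv[OF that(2)] that(2)] Wc[OF that(2)] fold_one[OF that(1)] by simp
    then show ?thesis
      using foldW[OF that] foldW[OF that(1) Winv[OF that(2)]] Wc by (metis inv_equality)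
  qed
  have fold_T: "fold plus ts (T x) = T (fold plus ts x)" if "set ts \<subseteq> \<T>" "T \<in> \<T>" "x \<in> W" for ts T x
    using that
  proof (induction ts arbitrary: x)
    case (Cons t ts)
    have "plus t (T x) = T (plus t x)"
      using Cons.prems Wc commT by (simp add: plus_def T_mult)
    then show ?case using Cons plusW by simp
  qed simp
  define N where "N = (\<lambda>ts. {x \<in> W. fold plus ts x = \<one>})"
  have sN: "subgroup (N ts) G" if ts: "set ts \<subseteq> \<T>" for ts
  proof (rule subgroupI)
    show "N ts \<subseteq> carrier G" using Wc by (auto simp: N_def)
    have "\<one> \<in> N ts" using fold_one[OF ts] by (auto simp: N_def W_def one)
    then show "N ts \<noteq> {}" by blast
    show "inv a \<in> N ts" if "a \<in> N ts" for a using that fold_inv[OF ts] Winv by (auto simp: N_def)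
    show "a \<otimes> b \<in> N ts" if "a \<in> N ts" "b \<in> N ts" for a b
      using that fold_mult[OF ts] Wmult by (auto simp: N_def)
  qed
  obtain v0 where v0: "v0 \<in> carrier G" "v0 \<noteq> \<one>" "\<forall>T\<in>\<T>. sq_diff T v0 = \<one>"
    using fixed_by_squares[OF flags] by blast
  have "T (T v0) = v0" if "T \<in> \<T>" for T
    using v0(1,3) that by (metis sq_diff_def T_closed inv_closed inv_equality inv_inv m_closed)
  then have v0W: "v0 \<in> W" using v0(1) by (simp add: W_def)
  define \<A> where "\<A> = N ` {ts. set ts \<subseteq> \<T> \<and> N ts \<noteq> W}"
  have "\<exists>M\<in>\<A>. \<forall>X\<in>\<A>. M \<subseteq> X \<longrightarrow> X = M"
  proof (rule subgroups_fin_gen_maximal[OF fg])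
    have "v0 \<notin> N []" using v0 by (simp add: N_def)
    then show "\<A> \<noteq> {}" using v0W by (auto simp: \<A>_def intro!: exI[of _ "[]"])
    show "subgroup H G" if "H \<in> \<A>" for H using that sN by (auto simp: \<A>_def)
  qed
  then obtain M where M: "M \<in> \<A>" "\<forall>X\<in>\<A>. M \<subseteq> X \<longrightarrow> X = M" by blast
  then obtain ts where ts: "set ts \<subseteq> \<T>" "N ts \<noteq> W" "M = N ts" by (auto simp: \<A>_def)
  have max: "N us = N ts" if "set us \<subseteq> \<T>" "N us \<noteq> W" "N ts \<subseteq> N us" for us
    using M(2) ts(3) that by (auto simp: \<A>_def)
  obtain x where x: "x \<in> W" "x \<notin> N ts" using ts(2) by (auto simp: N_def)
  define u where "u = fold plus ts x"
  have uW: "u \<in> W" unfolding u_def using ts(1) x(1) by (rule foldW)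
  show ?thesis
  proof (intro bexI[of _ u] conjI ballI)
    show "u \<in> carrier G" using uW Wc by blast
    show "u \<noteq> \<one>" using x by (simp add: N_def u_def)
    fix T assume T: "T \<in> \<T>"
    have sub: "N ts \<subseteq> N (ts @ [T])" using T by (auto simp: N_def plus_def one)
    show "T u = u \<or> T u = inv u"
    \<comment> \<open>Adding the factor \<open>T + 1\<close> either kills everything, and then
      \<open>T u\<close> is the inverse of \<open>u\<close>, or leaves the kernel unchanged by
      maximality. In the second case the product already kills \<open>T x - x\<close>, because
      \<open>(T + 1) (T - 1) = 0\<close> on \<open>W\<close>, and \<open>T\<close> fixes
      \<open>u\<close>.\<close>
    proof (cases "N (ts @ [T]) = W")
      case True
      then have "x \<in> N (ts @ [T])" using x(1) by simp
      then have "T u \<otimes> u = \<one>" by (simp add: N_def plus_def u_def)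
      then show ?thesis using uW Wc T by (simp add: inv_equality)
    next
      case False
      then have eq: "N (ts @ [T]) = N ts" using max[of "ts @ [T]"] sub ts(1) T by simp
      define y where "y = T x \<otimes> inv x"
      have y: "y \<in> W" using x(1) T TW Winv Wmult by (simp add: y_def)
      have fy: "fold plus ts y = T u \<otimes> inv u"
        using fold_mult[OF ts(1) TW[OF x(1) T] Winv[OF x(1)]] fold_T[OF ts(1) T x(1)] fold_inv[OF ts(1) x(1)]
        by (simp add: y_def u_def)
      have "fold plus (ts @ [T]) y = T (T u \<otimes> inv u) \<otimes> (T u \<otimes> inv u)" using fy by (simp add: plus_def)
      also have "\<dots> = (u \<otimes> inv (T u)) \<otimes> (T u \<otimes> inv u)"
        using uW Wc T W2[OF uW T] by (simp add: T_mult T_inv)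
      also have "T u \<otimes> inv u = inv (u \<otimes> inv (T u))"
        using uW Wc T by (simp add: inv_mult_group)
      also have "(u \<otimes> inv (T u)) \<otimes> \<dots> = \<one>" using uW Wc T by simp
      finally have "y \<in> N (ts @ [T])" using y by (simp add: N_def)
      then have "y \<in> N ts" using eq by simp
      then have "T u \<otimes> inv u = \<one>" using fy by (simp add: N_def)
      then show ?thesis using uW Wc T by (metis T_closed inv_equality inv_inv inv_closed)
    qed
  qed
qed

end

subsection \<open>Skew braces, ideals and quotients\<close>

lemma addG_simps [simp]:
  "carrier (addG B) = bcar B" "monoid.mult (addG B) = badd B" "monoid.one (addG B) = bzero B"
  "m_inv (addG B) = bneg B"
  by (auto simp: addG_def bneg_def fun_eq_iff)

lemma mulG_simps [simp]:
  "carrier (mulG B) = bcar B" "monoid.mult (mulG B) = bmul B" "monoid.one (mulG B) = bzero B"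
  by (auto simp: mulG_def)

lemma addG_restrict: "addG (restrict_brace B S) = (addG B)\<lparr>carrier := S\<rparr>"
  by (simp add: addG_def restrict_brace_def)

lemma mulG_restrict: "mulG (restrict_brace B S) = (mulG B)\<lparr>carrier := S\<rparr>"
  by (simp add: mulG_def restrict_brace_def)

lemma bcar_restrict [simp]: "bcar (restrict_brace B S) = S"
  by (simp add: restrict_brace_def)

lemma addG_quot: "addG (quot_brace B I) = addG B Mod I"
  by (simp add: addG_def quot_brace_def FactGroup_def)

lemma bcar_quot: "bcar (quot_brace B I) = (\<lambda>x. I #>\<^bsub>addG B\<^esub> x) ` bcar B"
  using carrier_FactGroup[of "addG B" I] by (simp flip: addG_quot)

text \<open>An equality of records, not just an isomorphism. It lets the sections in the definitions
  be treated as subsets of one quotient brace.\<close>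

lemma quot_restrict:
  "quot_brace (restrict_brace B S) I = restrict_brace (quot_brace B I) ((\<lambda>x. I #>\<^bsub>addG B\<^esub> x) ` S)"
proof -
  have 1: "I #>\<^bsub>addG (B\<lparr>bcar := S\<rparr>)\<^esub> x = I #>\<^bsub>addG B\<^esub> x" for x by (simp add: r_coset_def)
  have 2: "X <#>\<^bsub>addG (B\<lparr>bcar := S\<rparr>)\<^esub> Y = X <#>\<^bsub>addG B\<^esub> Y" for X Y by (simp add: set_mult_def)
  have 3: "rcosets\<^bsub>addG (B\<lparr>bcar := S\<rparr>)\<^esub> I = (\<lambda>x. I #>\<^bsub>addG B\<^esub> x) ` S"
    by (auto simp: RCOSETS_def 1)
  show ?thesis
    by (simp add: quot_brace_def restrict_brace_def 1 2 3)
qed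

locale skew_brace =
  fixes B :: "'a brace"
  assumes brace: "is_brace B"
begin

abbreviation add_op (infixl "\<oplus>" 65) where "x \<oplus> y \<equiv> badd B x y"
abbreviation mul_op (infixl "\<odot>" 70) where "x \<odot> y \<equiv> bmul B x y"
abbreviation neg_op ("\<ominus> _" [81] 80) where "\<ominus> x \<equiv> bneg B x"
abbreviation zero ("\<zero>") where "\<zero> \<equiv> bzero B"
abbreviation minv where "minv x \<equiv> inv\<^bsub>mulG B\<^esub> x"
abbreviation nmul (infixr "\<cdot>" 75) where "(k::int) \<cdot> x \<equiv> x [^]\<^bsub>addG B\<^esub> k"
abbreviation C where "C \<equiv> bcar B"
abbreviation coset where "coset I x \<equiv> I #>\<^bsub>addG B\<^esub> x"

sublocale add: group "addG B"
  rewrites "carrier (addG B) = bcar B" and "monoid.mult (addG B) = badd B"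
    and "monoid.one (addG B) = bzero B" and "m_inv (addG B) = bneg B"
  using brace by (auto simp: is_brace_def)

sublocale mul: group "mulG B"
  rewrites "carrier (mulG B) = bcar B" and "monoid.mult (mulG B) = bmul B"
    and "monoid.one (mulG B) = bzero B"
  using brace by (auto simp: is_brace_def)

lemma distrib: "a \<in> C \<Longrightarrow> b \<in> C \<Longrightarrow> c \<in> C \<Longrightarrow> a \<odot> (b \<oplus> c) = a \<odot> b \<oplus> \<ominus> a \<oplus> a \<odot> c"
  using brace by (auto simp: is_brace_def)

lemma lam_closed [simp, intro]: "a \<in> C \<Longrightarrow> b \<in> C \<Longrightarrow> lam B a b \<in> C"
  by (simp add: lam_def)

lemma mul_lam: "a \<in> C \<Longrightarrow> b \<in> C \<Longrightarrow> a \<odot> b = a \<oplus> lam B a b"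
  by (simp add: lam_def add.m_assoc[symmetric])

lemma lam_add: "a \<in> C \<Longrightarrow> b \<in> C \<Longrightarrow> c \<in> C \<Longrightarrow> lam B a (b \<oplus> c) = lam B a b \<oplus> lam B a c"
  by (simp add: lam_def distrib add.m_assoc)

lemma lam_hom: "a \<in> C \<Longrightarrow> group_hom (addG B) (addG B) (lam B a)"
  by unfold_locales (auto simp: hom_def lam_add)

lemma lam_zero: "a \<in> C \<Longrightarrow> lam B a \<zero> = \<zero>"
  using group_hom.hom_one[OF lam_hom] by simp

lemma lam_nmul: "a \<in> C \<Longrightarrow> b \<in> C \<Longrightarrow> lam B a (k \<cdot> b) = k \<cdot> lam B a b"
  using group_hom.hom_int_pow[OF lam_hom] by simp

lemma lam_mul:
  assumes "a \<in> C" "b \<in> C" "c \<in> C"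
  shows "lam B (a \<odot> b) c = lam B a (lam B b c)"
proof -
  have "a \<odot> b \<oplus> lam B (a \<odot> b) c = a \<odot> b \<odot> c" using assms by (simp add: mul_lam[of "a \<odot> b"])
  also have "\<dots> = a \<odot> (b \<oplus> lam B b c)" using assms by (simp add: mul.m_assoc mul_lam[of b c])
  also have "\<dots> = a \<odot> b \<oplus> (\<ominus> a \<oplus> a \<odot> lam B b c)" using assms by (simp add: distrib add.m_assoc)
  also have "\<dots> = a \<odot> b \<oplus> lam B a (lam B b c)" by (simp only: lam_def[of B a "lam B b c"])
  finally show ?thesis using assms by simp
qed

lemma lam_one: "b \<in> C \<Longrightarrow> lam B \<zero> b = b"
  using mul_lam[of \<zero> b] by simp

lemma lam_minv: "a \<in> C \<Longrightarrow> b \<in> C \<Longrightarrow> lam B (minv a) (lam B a b) = b"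
  "a \<in> C \<Longrightarrow> b \<in> C \<Longrightarrow> lam B a (lam B (minv a) b) = b"
  by (simp_all add: lam_mul[symmetric] lam_one)

text \<open>Expresses multiplicative conjugation through \<open>lam\<close>, so that multiplicative
  normality can be checked with additive cosets.\<close>

lemma conj_mul: "b \<in> C \<Longrightarrow> a \<in> C \<Longrightarrow> (b \<odot> a \<odot> minv b) \<odot> b = b \<oplus> lam B b a"
  by (simp add: mul.m_assoc mul_lam[symmetric])

end

locale ideal_of = skew_brace +
  fixes I
  assumes ideal: "brace_ideal B I"
begin

sublocale addn: normal I "addG B"
  rewrites "carrier (addG B) = bcar B" and "monoid.mult (addG B) = badd B"
    and "monoid.one (addG B) = bzero B" and "m_inv (addG B) = bneg B"
  using ideal by (auto simp: brace_ideal_def)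

sublocale muln: normal I "mulG B"
  rewrites "carrier (mulG B) = bcar B" and "monoid.mult (mulG B) = bmul B"
    and "monoid.one (mulG B) = bzero B"
  using ideal by (auto simp: brace_ideal_def)

lemma lam_in: "b \<in> C \<Longrightarrow> x \<in> I \<Longrightarrow> lam B b x \<in> I"
  using ideal by (auto simp: brace_ideal_def)

lemma in_car: "x \<in> I \<Longrightarrow> x \<in> C"
  using addn.subset by blast

lemma coset_eq: "x \<in> C \<Longrightarrow> y \<in> C \<Longrightarrow> coset I x = coset I y \<longleftrightarrow> x \<oplus> \<ominus> y \<in> I"
  by (rule addn.coset_eq_iff)

lemma coset_eqI:
  assumes "x \<in> C" "i \<in> I"
  shows "coset I (x \<oplus> i) = coset I x" "coset I (i \<oplus> x) = coset I x"
proof -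
  have "x \<oplus> i \<oplus> \<ominus> x \<in> I" using addn.inv_op_closed2[of x i] assms by simp
  then show "coset I (x \<oplus> i) = coset I x" using assms in_car by (simp add: coset_eq)
  show "coset I (i \<oplus> x) = coset I x" using assms in_car by (simp add: coset_eq add.m_assoc)
qed

text \<open>Additive and multiplicative cosets of an ideal agree: additive normality moves the
  element of \<open>I\<close> to the right of \<open>x\<close>, and \<open>lam\<close> by the
  inverse of \<open>x\<close> turns that sum into a product.\<close>

lemma coset_memD:
  assumes "x \<in> C" "x' \<in> coset I x"
  shows "\<exists>j\<in>I. x' = x \<odot> j"
proof -
  obtain i where i: "i \<in> I" "x' = i \<oplus> x" using assms(2) by (auto simp: r_coset_def)
  define i2 where "i2 = \<ominus> x \<oplus> i \<oplus> x"
  have i2: "i2 \<in> I" using addn.inv_op_closed1[of x i] assms(1) i by (simp add: i2_def)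
  have "x' = x \<oplus> i2" using assms(1) i in_car by (simp add: i2_def add.m_assoc[symmetric])
  also have "\<dots> = x \<odot> lam B (minv x) i2" using assms(1) i2 in_car by (simp add: mul_lam lam_minv)
  finally show ?thesis using lam_in[OF _ i2, of "minv x"] assms(1) by auto
qed

text \<open>This makes the product in \<open>quot_brace\<close> independent of the representatives
  picked there by the choice operator.\<close>

lemma coset_mul_cong:
  assumes x: "x \<in> C" "x' \<in> coset I x" and y: "y \<in> C" "y' \<in> coset I y"
  shows "coset I (x' \<odot> y') = coset I (x \<odot> y)"
proof -
  obtain j where j: "j \<in> I" "x' = x \<odot> j" using coset_memD[OF x] by blast
  obtain k where k: "k \<in> I" "y' = y \<odot> k" using coset_memD[OF y] by blast
  have c: "j \<in> C" "k \<in> C" using j k in_car by auto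
  define m where "m = (minv y \<odot> j \<odot> y) \<odot> k"
  have m: "m \<in> I" unfolding m_def
    using muln.inv_op_closed1[of y j] y(1) j(1) k(1) muln.m_closed by blast
  have "x' \<odot> y' = (x \<odot> y) \<odot> m"
  proof -
    have "y \<odot> (minv y \<odot> z) = z" if "z \<in> C" for z using that y(1) by (simp add: mul.m_assoc[symmetric])
    then show ?thesis using x(1) y(1) c by (simp add: j k m_def mul.m_assoc)
  qed
  also have "\<dots> = x \<odot> y \<oplus> lam B (x \<odot> y) m" using x(1) y(1) m in_car by (simp add: mul_lam)
  also have "coset I \<dots> = coset I (x \<odot> y)"
    using x(1) y(1) m lam_in by (intro coset_eqI) auto
  finally show ?thesis .
qed

lemma quot_mul:
  assumes "x \<in> C" "y \<in> C"
  shows "bmul (quot_brace B I) (coset I x) (coset I y) = coset I (x \<odot> y)"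
proof -
  have "(SOME z. z \<in> coset I x) \<in> coset I x" "(SOME z. z \<in> coset I y) \<in> coset I y"
    using assms add.rcos_self addn.subgroup_axioms by (meson someI)+
  then show ?thesis using coset_mul_cong assms by (simp add: quot_brace_def)
qed

lemma quot_add:
  assumes "x \<in> C" "y \<in> C"
  shows "badd (quot_brace B I) (coset I x) (coset I y) = coset I (x \<oplus> y)"
  using addn.coset_mult[OF assms] by (simp add: quot_brace_def)

end

text \<open>The target \<open>Q\<close> is not assumed to be a brace; its laws are transported along
  \<open>h\<close>. Applied to the coset map, this is how a quotient is seen to be a brace.\<close>

locale brace_epi = B: skew_brace B for B :: "'a brace" +
  fixes Q :: "'b brace" and h :: "'a \<Rightarrow> 'b"
  assumes surj: "h ` bcar B = bcar Q"
    and hom_add: "x \<in> bcar B \<Longrightarrow> y \<in> bcar B \<Longrightarrow> h (badd B x y) = badd Q (h x) (h y)"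
    and hom_mul: "x \<in> bcar B \<Longrightarrow> y \<in> bcar B \<Longrightarrow> h (bmul B x y) = bmul Q (h x) (h y)"
    and hom_zero: "h (bzero B) = bzero Q"
begin

lemma hom_closed [simp]: "x \<in> bcar B \<Longrightarrow> h x \<in> bcar Q"
  using surj by blast

lemma group_image:
  assumes "group G" "h ` carrier G = carrier H" "h \<one>\<^bsub>G\<^esub> = \<one>\<^bsub>H\<^esub>"
    and "\<And>x y. x \<in> carrier G \<Longrightarrow> y \<in> carrier G \<Longrightarrow> h (x \<otimes>\<^bsub>G\<^esub> y) = h x \<otimes>\<^bsub>H\<^esub> h y"
  shows "group H"
proof -
  interpret G: group G by fact
  show ?thesis
  proof (rule groupI)
    show "\<one>\<^bsub>H\<^esub> \<in> carrier H" using assms(2,3) G.one_closed by (metis imageI)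
    fix x assume "x \<in> carrier H"
    then obtain a where a: "a \<in> carrier G" "x = h a" using assms(2) by blast
    show "\<one>\<^bsub>H\<^esub> \<otimes>\<^bsub>H\<^esub> x = x" using a assms(3,4) G.l_one G.one_closed by metis
    show "\<exists>y\<in>carrier H. y \<otimes>\<^bsub>H\<^esub> x = \<one>\<^bsub>H\<^esub>"
      using a assms(2-4) G.l_inv G.inv_closed by (metis imageI)
    fix y assume "y \<in> carrier H"
    then obtain b where b: "b \<in> carrier G" "y = h b" using assms(2) by blast
    show "x \<otimes>\<^bsub>H\<^esub> y \<in> carrier H" using a b assms(2,4) G.m_closed by (metis imageI)
    fix z assume "z \<in> carrier H"
    then obtain c where c: "c \<in> carrier G" "z = h c" using assms(2) by blast
    show "x \<otimes>\<^bsub>H\<^esub> y \<otimes>\<^bsub>H\<^esub> z = x \<otimes>\<^bsub>H\<^esub> (y \<otimes>\<^bsub>H\<^esub> z)"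
      using a b c assms(4) G.m_closed G.m_assoc by metis
  qed
qed

lemma Q_groups: "group (addG Q)" "group (mulG Q)"
  by (rule group_image[OF B.add.group_axioms]; use surj hom_add hom_zero in simp)
     (rule group_image[OF B.mul.group_axioms]; use surj hom_mul hom_zero in simp)

lemma add_hom: "group_hom (addG B) (addG Q) h"
  by (intro group_hom.intro group_hom_axioms.intro B.add.group_axioms Q_groups)
     (auto simp: hom_def hom_add)

lemma mul_hom: "group_hom (mulG B) (mulG Q) h"
  by (intro group_hom.intro group_hom_axioms.intro B.mul.group_axioms Q_groups)
     (auto simp: hom_def hom_mul)

lemma hom_neg: "x \<in> bcar B \<Longrightarrow> h (bneg B x) = bneg Q (h x)"
  using group_hom.hom_inv[OF add_hom] by simp

lemma hom_minv: "x \<in> bcar B \<Longrightarrow> h (inv\<^bsub>mulG B\<^esub> x) = inv\<^bsub>mulG Q\<^esub> (h x)"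
  using group_hom.hom_inv[OF mul_hom] by simp

lemma hom_nmul: "x \<in> bcar B \<Longrightarrow> h (x [^]\<^bsub>addG B\<^esub> (k::int)) = h x [^]\<^bsub>addG Q\<^esub> k"
  using group_hom.hom_int_pow[OF add_hom] by simp

lemma Q_brace: "is_brace Q"
  unfolding is_brace_def
proof (intro conjI Q_groups ballI)
  fix a b c assume "a \<in> bcar Q" "b \<in> bcar Q" "c \<in> bcar Q"
  then have "a \<in> h ` bcar B" "b \<in> h ` bcar B" "c \<in> h ` bcar B" by (simp_all add: surj)
  then obtain x y z where xyz: "x \<in> bcar B" "a = h x" "y \<in> bcar B" "b = h y" "z \<in> bcar B" "c = h z"
    by (elim imageE)
  have "h (bmul B x (badd B y z)) = h (badd B (badd B (bmul B x y) (bneg B x)) (bmul B x z))"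
    using xyz B.distrib by simp
  then show "bmul Q a (badd Q b c) = badd Q (badd Q (bmul Q a b) (bneg Q a)) (bmul Q a c)"
    using xyz by (simp add: hom_add hom_mul hom_neg)
qed

sublocale Q: skew_brace Q
  by unfold_locales (rule Q_brace)

lemma hom_lam: "x \<in> bcar B \<Longrightarrow> y \<in> bcar B \<Longrightarrow> h (lam B x y) = lam Q (h x) (h y)"
  by (simp add: lam_def hom_add hom_mul hom_neg)

definition pre :: "'b set \<Rightarrow> 'a set" where
  "pre K = {x \<in> bcar B. h x \<in> K}"

lemma h_pre: "K \<subseteq> bcar Q \<Longrightarrow> h ` pre K = K"
  using surj by (fastforce simp: pre_def)

lemma subgroup_pre_add:
  assumes "subgroup K (addG Q)"
  shows "subgroup (pre K) (addG B)"
proof (rule B.add.subgroupI)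
  show "pre K \<subseteq> bcar B" by (auto simp: pre_def)
  have "bzero B \<in> pre K" using subgroup.one_closed[OF assms] by (simp add: pre_def hom_zero)
  then show "pre K \<noteq> {}" by blast
  show "bneg B a \<in> pre K" if "a \<in> pre K" for a
    using that subgroup.m_inv_closed[OF assms] by (simp add: pre_def hom_neg)
  show "badd B a b \<in> pre K" if "a \<in> pre K" "b \<in> pre K" for a b
    using that subgroup.m_closed[OF assms] by (simp add: pre_def hom_add)
qed

lemma subgroup_pre_mul:
  assumes "subgroup K (mulG Q)"
  shows "subgroup (pre K) (mulG B)"
proof (rule B.mul.subgroupI)
  show "pre K \<subseteq> bcar B" by (auto simp: pre_def)
  have "bzero B \<in> pre K" using subgroup.one_closed[OF assms] by (simp add: pre_def hom_zero)
  then show "pre K \<noteq> {}" by blast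
  show "inv\<^bsub>mulG B\<^esub> a \<in> pre K" if "a \<in> pre K" for a
    using that subgroup.m_inv_closed[OF assms] by (simp add: pre_def hom_minv)
  show "bmul B a b \<in> pre K" if "a \<in> pre K" "b \<in> pre K" for a b
    using that subgroup.m_closed[OF assms] by (simp add: pre_def hom_mul)
qed

lemma ideal_pre:
  assumes "brace_ideal Q K"
  shows "brace_ideal B (pre K)"
proof -
  interpret K: ideal_of Q K by unfold_locales (rule assms)
  have sa: "subgroup (pre K) (addG B)" using K.addn.subgroup_axioms by (rule subgroup_pre_add)
  have sm: "subgroup (pre K) (mulG B)" using K.muln.subgroup_axioms by (rule subgroup_pre_mul)
  have na: "pre K \<lhd> addG B"
    unfolding B.add.normal_inv_iff
    using sa K.addn.inv_op_closed2 by (auto simp: pre_def hom_add hom_neg)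
  have nm: "pre K \<lhd> mulG B"
    unfolding B.mul.normal_inv_iff
    using sm K.muln.inv_op_closed2 by (auto simp: pre_def hom_mul hom_minv)
  show ?thesis
    unfolding brace_ideal_def subbrace_def
    using sa sm na nm K.lam_in by (auto simp: pre_def hom_lam)
qed

lemma ideal_image:
  assumes "brace_ideal B K"
  shows "brace_ideal Q (h ` K)"
proof -
  interpret K: ideal_of B K by unfold_locales (rule assms)
  have sa: "subgroup (h ` K) (addG Q)"
    using group_hom.subgroup_img_is_subgroup[OF add_hom] K.addn.subgroup_axioms by blast
  have sm: "subgroup (h ` K) (mulG Q)"
    using group_hom.subgroup_img_is_subgroup[OF mul_hom] K.muln.subgroup_axioms by blast
  have na: "h ` K \<lhd> addG Q"
    unfolding Q.add.normal_inv_iff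
  proof (intro conjI sa ballI)
    fix x k assume "x \<in> bcar Q" "k \<in> h ` K"
    then obtain a b where "a \<in> bcar B" "x = h a" "b \<in> K" "k = h b" using surj by blast
    then have "badd Q (badd Q x k) (bneg Q x) = h (badd B (badd B a b) (bneg B a))"
      "badd B (badd B a b) (bneg B a) \<in> K"
      using K.in_car K.addn.inv_op_closed2[of a b] by (simp_all add: hom_add hom_neg)
    then show "badd Q (badd Q x k) (bneg Q x) \<in> h ` K" by blast
  qed
  have nm: "h ` K \<lhd> mulG Q"
    unfolding Q.mul.normal_inv_iff
  proof (intro conjI sm ballI)
    fix x k assume "x \<in> bcar Q" "k \<in> h ` K"
    then obtain a b where "a \<in> bcar B" "x = h a" "b \<in> K" "k = h b" using surj by blast
    then have "bmul Q (bmul Q x k) (inv\<^bsub>mulG Q\<^esub> x) = h (bmul B (bmul B a b) (inv\<^bsub>mulG B\<^esub> a))"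
      "bmul B (bmul B a b) (inv\<^bsub>mulG B\<^esub> a) \<in> K"
      using K.in_car K.muln.inv_op_closed2[of a b] by (simp_all add: hom_mul hom_minv)
    then show "bmul Q (bmul Q x k) (inv\<^bsub>mulG Q\<^esub> x) \<in> h ` K" by blast
  qed
  have "lam Q b x \<in> h ` K" if bx: "b \<in> bcar Q" "x \<in> h ` K" for b x
  proof -
    obtain a c where "a \<in> bcar B" "b = h a" "c \<in> K" "x = h c" using bx surj by blast
    then have "lam Q b x = h (lam B a c)" "lam B a c \<in> K" using K.in_car K.lam_in by (simp_all add: hom_lam)
    then show ?thesis by blast
  qed
  then show ?thesis
    unfolding brace_ideal_def subbrace_def using sa sm na nm by blast
qed

end

context ideal_of
begin

lemma coset_epi: "brace_epi B (quot_brace B I) (coset I)"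
proof
  show "coset I ` C = bcar (quot_brace B I)" by (simp add: bcar_quot)
  show "coset I \<zero> = bzero (quot_brace B I)" using add.coset_mult_one[of I] addn.subset
    by (simp add: quot_brace_def)
qed (simp_all add: quot_add quot_mul)

lemmas quot_hom_lam = brace_epi.hom_lam[OF coset_epi]
  and quot_hom_add = brace_epi.hom_add[OF coset_epi]
  and quot_hom_neg = brace_epi.hom_neg[OF coset_epi]
  and quot_hom_nmul = brace_epi.hom_nmul[OF coset_epi]

lemma quot_skew_brace: "skew_brace (quot_brace B I)"
  using brace_epi.Q_brace[OF coset_epi] by unfold_locales

lemma coset_zero: "x \<in> C \<Longrightarrow> coset I x = I \<longleftrightarrow> x \<in> I"
  by (rule addn.coset_eq_self)

lemma quot_zero: "bzero (quot_brace B I) = I"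
  by (simp add: quot_brace_def)

end

subsection \<open>Weak steps\<close>

definition central_mod :: "'a brace \<Rightarrow> 'a set \<Rightarrow> 'a set \<Rightarrow> bool" where
  "central_mod B K L \<longleftrightarrow> (\<lambda>x. K #>\<^bsub>addG B\<^esub> x) ` L \<subseteq> Soc (quot_brace B K)"

text \<open>The generator is an explicit element of \<open>L\<close>, so it can be mapped forward or
  lifted along an epimorphism.\<close>

definition cyclic_mod :: "'a brace \<Rightarrow> 'a set \<Rightarrow> 'a set \<Rightarrow> 'a \<Rightarrow> bool" where
  "cyclic_mod B K L g \<longleftrightarrow> g \<in> L \<and>
     (\<forall>x\<in>L. \<exists>k::int. K #>\<^bsub>addG B\<^esub> x = K #>\<^bsub>addG B\<^esub> (g [^]\<^bsub>addG B\<^esub> k))"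

text \<open>In contrast to the steps of a supersoluble series, a weak step may have a finite (even trivial)
  quotient in the central case, and a trivial one in the prime case. This makes weak steps stable
  under images and under intersection with an ideal.\<close>

definition weak_step :: "'a brace \<Rightarrow> 'a set \<Rightarrow> 'a set \<Rightarrow> bool" where
  "weak_step B K L \<longleftrightarrow> brace_ideal B K \<and> brace_ideal B L \<and> K \<subseteq> L \<and>
     (\<exists>g. cyclic_mod B K L g \<and> (central_mod B K L \<or> (\<exists>p::nat. prime p \<and> g [^]\<^bsub>addG B\<^esub> int p \<in> K)))"

text \<open>One step from the definition of \<open>supersoluble\<close>, with the ideal property of
  both ends attached, so that a series becomes a path of a relation.\<close>

definition strict_step :: "'a brace \<Rightarrow> 'a set \<Rightarrow> 'a set \<Rightarrow> bool" where
  "strict_step B K L \<longleftrightarrow> brace_ideal B K \<and> brace_ideal B L \<and> K \<subseteq> L \<and>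
     ((infinite_cyclic_add (quot_brace (restrict_brace B L) K) \<and>
       bcar (quot_brace (restrict_brace B L) K) \<subseteq> Soc (quot_brace B K))
      \<or> prime (card (bcar (quot_brace (restrict_brace B L) K))))"

context skew_brace
begin

lemma idealI: "brace_ideal B I \<Longrightarrow> ideal_of B I"
  by unfold_locales

lemma zero_ideal: "brace_ideal B {\<zero>}"
proof -
  have "subgroup {\<zero>} (addG B)" "subgroup {\<zero>} (mulG B)"
    using add.triv_subgroup mul.triv_subgroup by simp_all
  moreover have "{\<zero>} \<lhd> addG B" "{\<zero>} \<lhd> mulG B"
    using add.one_is_normal mul.one_is_normal by simp_all
  ultimately show ?thesis by (auto simp: brace_ideal_def subbrace_def lam_zero)
qed

lemma full_ideal: "brace_ideal B C"
proof -
  have "subgroup C (addG B)" "subgroup C (mulG B)"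
    using add.subgroup_self mul.subgroup_self by simp_all
  moreover have "C \<lhd> addG B" "C \<lhd> mulG B"
    using add.normal_self mul.normal_self by simp_all
  ultimately show ?thesis by (auto simp: brace_ideal_def subbrace_def)
qed

lemma ideal_Int:
  assumes "brace_ideal B I" "brace_ideal B J"
  shows "brace_ideal B (I \<inter> J)"
proof -
  have "I \<inter> J \<lhd> addG B" "I \<inter> J \<lhd> mulG B"
    using assms add.normal_subgroup_intersect mul.normal_subgroup_intersect by (auto simp: brace_ideal_def)
  then show ?thesis
    using assms normal_imp_subgroup by (auto simp: brace_ideal_def subbrace_def)
qed

lemma supersoluble_iff_strict: "supersoluble B \<longleftrightarrow> (strict_step B)\<^sup>*\<^sup>* {\<zero>} C"
proof -
  have "supersoluble B \<longleftrightarrow> (\<exists>n I. I 0 = {\<zero>} \<and> I n = C \<and> (\<forall>i<n. strict_step B (I i) (I (Suc i))))" (is "_ = ?R")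
  proof
    assume "supersoluble B"
    then show ?R unfolding supersoluble_def strict_step_def by (metis Suc_leI less_imp_le_nat)
  next
    assume ?R
    then obtain n I where nI: "I 0 = {\<zero>}" "I n = C" "\<And>i. i < n \<Longrightarrow> strict_step B (I i) (I (Suc i))" by blast
    have "brace_ideal B (I i)" if "i \<le> n" for i
      using nI(1) nI(3)[of "i - 1"] zero_ideal that by (cases i) (auto simp: strict_step_def)
    with nI show "supersoluble B" unfolding supersoluble_def strict_step_def by (intro exI[of _ n] exI[of _ I]) auto
  qed
  also have "\<dots> \<longleftrightarrow> (strict_step B)\<^sup>*\<^sup>* {\<zero>} C"
    unfolding rtranclp_power relpowp_fun_conv by auto
  finally show ?thesis .
qed

text \<open>Products and inverses reduce to additive data: \<open>a b = a + lam a b\<close>, and the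
  inverse of \<open>a\<close> is \<open>lam\<close> by that inverse of the negative of
  \<open>a\<close>.\<close>

lemma invariant_mul_subgroup:
  assumes E: "subgroup E (addG B)" and inv: "\<And>b x. b \<in> C \<Longrightarrow> x \<in> E \<Longrightarrow> lam B b x \<in> E"
  shows "subgroup E (mulG B)"
proof (rule mul.subgroupI)
  have Ec: "E \<subseteq> C" using subgroup.subset[OF E] by simp
  show "E \<subseteq> C" by (rule Ec)
  show "E \<noteq> {}" using subgroup.one_closed[OF E] by blast
  fix a assume a: "a \<in> E"
  then have ac: "a \<in> C" using Ec by blast
  have "a \<oplus> lam B a (minv a) = \<zero>" using ac by (simp add: mul_lam[symmetric])
  then have "lam B a (minv a) = \<ominus> a" using ac by (metis add.inv_equality add.inv_inv add.inv_closed lam_closed mul.inv_closed)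
  then have "minv a = lam B (minv a) (\<ominus> a)" using lam_minv(1)[of a "minv a"] ac by simp
  moreover have "\<ominus> a \<in> E" using subgroup.m_inv_closed[OF E a] by simp
  ultimately show "minv a \<in> E" using inv[of "minv a" "\<ominus> a"] ac by simp
  fix b assume b: "b \<in> E"
  then have "a \<odot> b = a \<oplus> lam B a b" using ac Ec by (intro mul_lam) auto
  then show "a \<odot> b \<in> E" using subgroup.m_closed[OF E a inv[OF ac b]] by simp
qed

end

context ideal_of
begin

lemma acts_trivially:
  assumes "a \<in> I" "b \<in> C"
  shows "coset I (lam B a b) = coset I b" "coset I (a \<oplus> b) = coset I (b \<oplus> a)"
proof -
  have a: "a \<in> C" using assms in_car by blast
  have "coset I a = bzero (quot_brace B I)" using coset_zero[OF a] assms by (simp add: quot_zero)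
  then show "coset I (lam B a b) = coset I b"
    using quot_hom_lam[OF a assms(2)] skew_brace.lam_one[OF quot_skew_brace, of "coset I b"] assms(2)
    by (simp add: bcar_quot)
  show "coset I (a \<oplus> b) = coset I (b \<oplus> a)"
    using coset_eqI[of b a] assms by simp
qed

lemma central_mod_iff:
  assumes "L \<subseteq> C"
  shows "central_mod B I L \<longleftrightarrow> (\<forall>a\<in>L. \<forall>b\<in>C. coset I (lam B a b) = coset I b \<and> coset I (a \<oplus> b) = coset I (b \<oplus> a))"
proof -
  have key: "coset I a \<in> Soc (quot_brace B I) \<longleftrightarrow>
      (\<forall>b\<in>C. coset I (lam B a b) = coset I b \<and> coset I (a \<oplus> b) = coset I (b \<oplus> a))" if "a \<in> C" for a
    using that by (simp add: Soc_def bcar_quot quot_hom_lam quot_hom_add ball_conj_distrib)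
  show ?thesis unfolding central_mod_def image_subset_iff
    by (rule ball_cong[OF refl key]) (rule subsetD[OF assms])
qed

lemma coset_nmul_cong:
  assumes "x \<in> C" "y \<in> C" "coset I x = coset I y"
  shows "coset I (k \<cdot> x) = coset I (k \<cdot> y)"
  using assms by (simp add: quot_hom_nmul)

text \<open>Below a central section only invariance under \<open>lam\<close> has to be checked.
  Additive conjugation is trivial modulo \<open>I\<close>, and a multiplicative conjugate
  \<open>d\<close> of \<open>a\<close> by \<open>b\<close> is congruent to
  \<open>b + lam b a - b\<close>, because \<open>d\<close> lies in \<open>L\<close> and acts
  trivially modulo \<open>I\<close>.\<close>

lemma ideal_between:
  assumes L: "brace_ideal B L" and cen: "central_mod B I L"
    and E: "subgroup E (addG B)" "I \<subseteq> E" "E \<subseteq> L" and inv: "\<And>b x. b \<in> C \<Longrightarrow> x \<in> E \<Longrightarrow> lam B b x \<in> E"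
  shows "brace_ideal B E"
proof -
  interpret L: ideal_of B L by unfold_locales (rule L)
  have Lc: "L \<subseteq> C" using L.in_car by blast
  have Ec: "x \<in> C" if "x \<in> E" for x using that E(3) Lc by blast
  have cenD: "coset I (lam B a b) = coset I b" "coset I (a \<oplus> b) = coset I (b \<oplus> a)"
    if "a \<in> L" "b \<in> C" for a b using cen that unfolding central_mod_iff[OF Lc] by auto
  have satur: "y \<in> E" if "coset I y = coset I x" "x \<in> E" "y \<in> C" for x y
  proof -
    have "y \<oplus> \<ominus> x \<in> E" using that Ec coset_eq E(2) by blast
    then have "y \<oplus> \<ominus> x \<oplus> x \<in> E" using subgroup.m_closed[OF E(1) _ that(2)] by simp
    then show ?thesis using that Ec by (simp add: add.m_assoc)
  qed
  have conj: "b \<oplus> a \<oplus> \<ominus> b \<in> E" if "a \<in> E" "b \<in> C" for a b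
  proof -
    have "coset I (b \<oplus> a \<oplus> \<ominus> b) = coset I (a \<oplus> b \<oplus> \<ominus> b)"
      using cenD(2)[of a b] that Ec E(3) by (simp add: quot_hom_add quot_hom_neg subset_iff)
    also have "a \<oplus> b \<oplus> \<ominus> b = a" using that Ec by (simp add: add.m_assoc)
    finally show ?thesis using satur that Ec by simp
  qed
  have na: "E \<lhd> addG B" using add.normal_inv_iff E(1) conj by auto
  have sm: "subgroup E (mulG B)" using E(1) inv by (rule invariant_mul_subgroup)
  have "b \<odot> a \<odot> minv b \<in> E" if a: "a \<in> E" and b: "b \<in> C" for a b
  proof -
    have ac: "a \<in> C" using a Ec by blast
    define d where "d = b \<odot> a \<odot> minv b"
    have dL: "d \<in> L" unfolding d_def using L.muln.inv_op_closed2[of b a] a b E(3) by blast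
    then have dc: "d \<in> C" using Lc by blast
    have "d \<oplus> lam B d b = b \<oplus> lam B b a"
      using conj_mul[OF b ac] mul_lam[OF dc b] by (simp add: d_def)
    then have "d = b \<oplus> lam B b a \<oplus> \<ominus> lam B d b" using dc b ac by (simp add: add.inv_solve_right)
    then have "coset I d = coset I (b \<oplus> lam B b a \<oplus> \<ominus> lam B d b)" by simp
    also have "\<dots> = coset I (b \<oplus> lam B b a \<oplus> \<ominus> b)"
      using cenD(1)[OF dL b] b ac dc by (simp add: quot_hom_add quot_hom_neg)
    finally show ?thesis
      using satur[of d "b \<oplus> lam B b a \<oplus> \<ominus> b"] conj[OF inv[OF b a] b] dc unfolding d_def by blast
  qed
  then have "E \<lhd> mulG B" using mul.normal_inv_iff sm by auto
  with E(1) sm na inv show ?thesis by (auto simp: brace_ideal_def subbrace_def)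
qed

end

context skew_brace
begin

text \<open>An element of \<open>F\<close> always acts trivially modulo \<open>F\<close>, and an
  element of \<open>L\<close> does so modulo \<open>K\<close> in the central case; together this
  gives centrality modulo the intersection. The cyclic generator \<open>g\<close> may lie outside
  \<open>F\<close>, so a new one is taken inside \<open>F \<inter> L\<close>.\<close>

lemma weak_step_Int:
  assumes F: "brace_ideal B F" and step: "weak_step B K L"
  shows "weak_step B (F \<inter> K) (F \<inter> L)"
proof -
  have K: "brace_ideal B K" and L: "brace_ideal B L" and KL: "K \<subseteq> L"
    using step by (auto simp: weak_step_def)
  have FK: "brace_ideal B (F \<inter> K)" and FL: "brace_ideal B (F \<inter> L)"
    using ideal_Int F K L by auto
  interpret F: ideal_of B F using F by (rule idealI)
  interpret K: ideal_of B K using K by (rule idealI)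
  interpret L: ideal_of B L using L by (rule idealI)
  interpret FK: ideal_of B "F \<inter> K" using FK by (rule idealI)
  interpret FL: ideal_of B "F \<inter> L" using FL by (rule idealI)
  obtain g where g: "g \<in> L" "\<forall>x\<in>L. \<exists>k::int. coset K x = coset K (k \<cdot> g)"
    and or: "central_mod B K L \<or> (\<exists>p::nat. prime p \<and> int p \<cdot> g \<in> K)"
    using step by (auto simp: weak_step_def cyclic_mod_def)
  have gc: "g \<in> C" using g L.in_car by blast
  have "\<exists>d\<in>F \<inter> L. \<forall>x\<in>F \<inter> L. \<exists>k::int. x \<oplus> \<ominus> (k \<cdot> d) \<in> K"
  proof (rule K.addn.cyclic_mod_subgroup[OF FL.addn.subgroup_axioms gc])
    fix x assume "x \<in> F \<inter> L"
    then obtain k :: int where "x \<in> C" "coset K x = coset K (k \<cdot> g)" using g L.in_car by blast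
    then show "\<exists>k::int. x \<oplus> \<ominus> (k \<cdot> g) \<in> K" using gc K.coset_eq by auto
  qed
  then obtain d where d: "d \<in> F \<inter> L" "\<forall>x\<in>F \<inter> L. \<exists>k::int. x \<oplus> \<ominus> (k \<cdot> d) \<in> K" by blast
  have dc: "d \<in> C" using d FL.in_car by blast
  have "cyclic_mod B (F \<inter> K) (F \<inter> L) d"
    unfolding cyclic_mod_def
  proof (intro conjI d(1) ballI)
    fix x assume x: "x \<in> F \<inter> L"
    then obtain k :: int where k: "x \<oplus> \<ominus> (k \<cdot> d) \<in> K" using d by blast
    have "k \<cdot> d \<in> F" using add.subgroup_int_pow_closed[OF F.addn.subgroup_axioms] d(1) by blast
    then have "x \<oplus> \<ominus> (k \<cdot> d) \<in> F" using x by simp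
    then show "\<exists>k::int. coset (F \<inter> K) x = coset (F \<inter> K) (k \<cdot> d)"
      using k x FL.in_car dc FK.coset_eq by auto
  qed
  moreover have "central_mod B (F \<inter> K) (F \<inter> L) \<or> (\<exists>p::nat. prime p \<and> int p \<cdot> d \<in> F \<inter> K)"
    using or
  proof
    assume "central_mod B K L"
    moreover have LC: "L \<subseteq> C" and FLC: "F \<inter> L \<subseteq> C" using L.in_car by auto
    ultimately have cK: "coset K (lam B a b) = coset K b" "coset K (a \<oplus> b) = coset K (b \<oplus> a)"
      if "a \<in> L" "b \<in> C" for a b using that unfolding K.central_mod_iff[OF LC] by auto
    have "coset (F \<inter> K) (lam B a b) = coset (F \<inter> K) b \<and> coset (F \<inter> K) (a \<oplus> b) = coset (F \<inter> K) (b \<oplus> a)"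
      if a: "a \<in> F \<inter> L" and b: "b \<in> C" for a b
    proof -
      have ac: "a \<in> C" using a FLC by blast
      have join: "coset (F \<inter> K) x = coset (F \<inter> K) y"
        if "coset F x = coset F y" "coset K x = coset K y" "x \<in> C" "y \<in> C" for x y
        using that by (simp add: F.coset_eq K.coset_eq FK.coset_eq)
      show ?thesis
        using F.acts_trivially[of a b] cK[of a b] a b ac by (intro conjI join) auto
    qed
    then show ?thesis unfolding FK.central_mod_iff[OF FLC] by blast
  next
    assume "\<exists>p::nat. prime p \<and> int p \<cdot> g \<in> K"
    then obtain p :: nat where p: "prime p" "int p \<cdot> g \<in> K" by blast
    obtain k :: int where "coset K d = coset K (k \<cdot> g)" using g d(1) by blast
    then have "coset K (int p \<cdot> d) = coset K (int p \<cdot> (k \<cdot> g))" using dc gc by (intro K.coset_nmul_cong) auto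
    also have "int p \<cdot> (k \<cdot> g) = k \<cdot> (int p \<cdot> g)" using gc by (simp add: add.int_pow_pow mult.commute)
    also have "coset K \<dots> = K"
      using add.subgroup_int_pow_closed[OF K.addn.subgroup_axioms p(2)] gc K.coset_zero by simp
    finally have "int p \<cdot> d \<in> K" using dc K.coset_zero by simp
    moreover have "int p \<cdot> d \<in> F" using add.subgroup_int_pow_closed[OF F.addn.subgroup_axioms] d(1) by blast
    ultimately show ?thesis using p(1) by blast
  qed
  ultimately show ?thesis using FK FL KL unfolding weak_step_def by blast
qed

lemma weak_chain_Int:
  assumes F: "brace_ideal B F" and "(weak_step B)\<^sup>*\<^sup>* K L"
  shows "(weak_step B)\<^sup>*\<^sup>* (F \<inter> K) (F \<inter> L)"
  using assms(2) by (induction rule: rtranclp_induct) (auto intro: rtranclp.rtrancl_into_rtrancl weak_step_Int[OF F])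

end

context brace_epi
begin

lemma weak_step_image:
  assumes step: "weak_step B K L"
  shows "weak_step Q (h ` K) (h ` L)"
proof -
  have K: "brace_ideal B K" and L: "brace_ideal B L" and KL: "K \<subseteq> L"
    using step by (auto simp: weak_step_def)
  note hK = ideal_image[OF K] and hL = ideal_image[OF L]
  interpret K: ideal_of B K using K by (rule B.idealI)
  interpret L: ideal_of B L using L by (rule B.idealI)
  interpret hK: ideal_of Q "h ` K" using hK by (rule Q.idealI)
  interpret hL: ideal_of Q "h ` L" using hL by (rule Q.idealI)
  have tr: "Q.coset (h ` K) (h x) = Q.coset (h ` K) (h y)"
    if "B.coset K x = B.coset K y" "x \<in> bcar B" "y \<in> bcar B" for x y
  proof -
    have "h (badd B x (bneg B y)) \<in> h ` K" using that K.coset_eq by blast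
    then show ?thesis using that by (simp add: hK.coset_eq hom_add hom_neg)
  qed
  obtain g where g: "g \<in> L" "\<forall>x\<in>L. \<exists>k::int. B.coset K x = B.coset K (g [^]\<^bsub>addG B\<^esub> k)"
    and or: "central_mod B K L \<or> (\<exists>p::nat. prime p \<and> g [^]\<^bsub>addG B\<^esub> int p \<in> K)"
    using step by (auto simp: weak_step_def cyclic_mod_def)
  have gc: "g \<in> bcar B" using g L.in_car by blast
  have "cyclic_mod Q (h ` K) (h ` L) (h g)"
    unfolding cyclic_mod_def
  proof (intro conjI ballI)
    show "h g \<in> h ` L" using g by blast
    fix y assume "y \<in> h ` L"
    then obtain x where x: "x \<in> L" "y = h x" by blast
    then obtain k :: int where "B.coset K x = B.coset K (g [^]\<^bsub>addG B\<^esub> k)" using g by blast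
    then have "Q.coset (h ` K) (h x) = Q.coset (h ` K) (h (g [^]\<^bsub>addG B\<^esub> k))"
      using L.in_car[OF x(1)] gc by (intro tr) auto
    then show "\<exists>k::int. Q.coset (h ` K) y = Q.coset (h ` K) (h g [^]\<^bsub>addG Q\<^esub> k)"
      using x gc by (auto simp: hom_nmul)
  qed
  moreover have "central_mod Q (h ` K) (h ` L) \<or> (\<exists>p::nat. prime p \<and> h g [^]\<^bsub>addG Q\<^esub> int p \<in> h ` K)"
    using or
  proof
    assume cen: "central_mod B K L"
    have LC: "L \<subseteq> bcar B" and hLC: "h ` L \<subseteq> bcar Q" using L.in_car hL.in_car by auto
    have "Q.coset (h ` K) (lam Q a b) = Q.coset (h ` K) b \<and> Q.coset (h ` K) (badd Q a b) = Q.coset (h ` K) (badd Q b a)"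
      if "a \<in> h ` L" "b \<in> bcar Q" for a b
    proof -
      obtain x y where xy: "x \<in> L" "a = h x" "y \<in> bcar B" "b = h y" using \<open>a \<in> h ` L\<close> \<open>b \<in> bcar Q\<close> surj by blast
      have xc: "x \<in> bcar B" using L.in_car[OF xy(1)] .
      have "B.coset K (lam B x y) = B.coset K y" "B.coset K (badd B x y) = B.coset K (badd B y x)"
        using cen xy unfolding K.central_mod_iff[OF LC] by blast+
      then have "Q.coset (h ` K) (h (lam B x y)) = Q.coset (h ` K) (h y)"
        "Q.coset (h ` K) (h (badd B x y)) = Q.coset (h ` K) (h (badd B y x))"
        using xc xy(3) by - (rule tr; simp)+
      then show ?thesis using xc xy by (simp only: hom_lam hom_add)
    qed
    then show ?thesis unfolding hK.central_mod_iff[OF hLC] by blast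
  next
    assume "\<exists>p::nat. prime p \<and> g [^]\<^bsub>addG B\<^esub> int p \<in> K"
    then show ?thesis using gc by (metis hom_nmul imageI)
  qed
  ultimately show ?thesis using hK hL KL unfolding weak_step_def by blast
qed

lemma weak_chain_image:
  assumes "(weak_step B)\<^sup>*\<^sup>* K L"
  shows "(weak_step Q)\<^sup>*\<^sup>* (h ` K) (h ` L)"
  using assms by (induction rule: rtranclp_induct) (auto intro: rtranclp.rtrancl_into_rtrancl weak_step_image)

text \<open>The correspondence between cosets upstairs and downstairs; through it every condition of
  a weak step is lifted to preimages.\<close>

lemma coset_pre_iff:
  assumes K: "brace_ideal Q K" and x: "x \<in> bcar B" and y: "y \<in> bcar B"
  shows "B.coset (pre K) x = B.coset (pre K) y \<longleftrightarrow> Q.coset K (h x) = Q.coset K (h y)"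
proof -
  have "B.coset (pre K) x = B.coset (pre K) y \<longleftrightarrow> badd B x (bneg B y) \<in> pre K"
    by (rule ideal_of.coset_eq[OF B.idealI[OF ideal_pre[OF K]] x y])
  also have "\<dots> \<longleftrightarrow> badd Q (h x) (bneg Q (h y)) \<in> K"
    using x y by (simp add: pre_def hom_add hom_neg)
  also have "\<dots> \<longleftrightarrow> Q.coset K (h x) = Q.coset K (h y)"
    by (rule ideal_of.coset_eq[OF Q.idealI[OF K] hom_closed[OF x] hom_closed[OF y], symmetric])
  finally show ?thesis .
qed

lemma weak_step_pre:
  assumes step: "weak_step Q K L"
  shows "weak_step B (pre K) (pre L)"
proof -
  have K: "brace_ideal Q K" and L: "brace_ideal Q L" and KL: "K \<subseteq> L"
    using step by (auto simp: weak_step_def)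
  note pK = ideal_pre[OF K] and pL = ideal_pre[OF L] and tr = coset_pre_iff[OF K]
  have LC: "L \<subseteq> bcar Q" using ideal_of.in_car[OF Q.idealI[OF L]] by blast
  have pLC: "pre L \<subseteq> bcar B" by (auto simp: pre_def)
  note cen_iff = ideal_of.central_mod_iff[OF Q.idealI[OF K] LC]
  note pcen_iff = ideal_of.central_mod_iff[OF B.idealI[OF pK] pLC]
  obtain g' where g': "g' \<in> L" "\<forall>x\<in>L. \<exists>k::int. Q.coset K x = Q.coset K (g' [^]\<^bsub>addG Q\<^esub> k)"
    and or: "central_mod Q K L \<or> (\<exists>p::nat. prime p \<and> g' [^]\<^bsub>addG Q\<^esub> int p \<in> K)"
    using step unfolding weak_step_def cyclic_mod_def by blast
  have "g' \<in> h ` bcar B" using g'(1) LC surj by blast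
  then obtain g where g: "g \<in> bcar B" "g' = h g" by (elim imageE)
  have "cyclic_mod B (pre K) (pre L) g"
    unfolding cyclic_mod_def
  proof (intro conjI ballI)
    show "g \<in> pre L" using g g'(1) by (simp add: pre_def)
    fix x assume "x \<in> pre L"
    then have x: "x \<in> bcar B" "h x \<in> L" by (simp_all add: pre_def)
    obtain k :: int where k: "Q.coset K (h x) = Q.coset K (g' [^]\<^bsub>addG Q\<^esub> k)" using g'(2) x(2) by blast
    have "B.coset (pre K) x = B.coset (pre K) (g [^]\<^bsub>addG B\<^esub> k)"
      unfolding tr[OF x(1) B.add.int_pow_closed[OF g(1)]] hom_nmul[OF g(1)] k g(2) ..
    then show "\<exists>k::int. B.coset (pre K) x = B.coset (pre K) (g [^]\<^bsub>addG B\<^esub> k)" by blast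
  qed
  moreover have "central_mod B (pre K) (pre L) \<or> (\<exists>p::nat. prime p \<and> g [^]\<^bsub>addG B\<^esub> int p \<in> pre K)"
    using or
  proof
    assume cen: "central_mod Q K L"
    have "B.coset (pre K) (lam B a b) = B.coset (pre K) b \<and> B.coset (pre K) (badd B a b) = B.coset (pre K) (badd B b a)"
      if a: "a \<in> pre L" and b: "b \<in> bcar B" for a b
    proof -
      have a': "a \<in> bcar B" "h a \<in> L" using a by (simp_all add: pre_def)
      have "Q.coset K (lam Q (h a) (h b)) = Q.coset K (h b) \<and> Q.coset K (badd Q (h a) (h b)) = Q.coset K (badd Q (h b) (h a))"
        using cen[unfolded cen_iff] a'(2) hom_closed[OF b] by blast
      then show ?thesis
        using a'(1) b tr[OF B.lam_closed[OF a'(1) b] b] tr[OF B.add.m_closed[OF a'(1) b] B.add.m_closed[OF b a'(1)]]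
        by (simp only: hom_lam hom_add)
    qed
    then show ?thesis unfolding pcen_iff by blast
  next
    assume "\<exists>p::nat. prime p \<and> g' [^]\<^bsub>addG Q\<^esub> int p \<in> K"
    then obtain p :: nat where "prime p" "g' [^]\<^bsub>addG Q\<^esub> int p \<in> K" by blast
    then have "prime p" "g [^]\<^bsub>addG B\<^esub> int p \<in> pre K" using g by (simp_all add: pre_def hom_nmul)
    then show ?thesis by blast
  qed
  moreover have "pre K \<subseteq> pre L" using KL by (auto simp: pre_def)
  ultimately show ?thesis using pK pL unfolding weak_step_def by blast
qed

lemma weak_chain_pre:
  assumes "(weak_step Q)\<^sup>*\<^sup>* K L"
  shows "(weak_step B)\<^sup>*\<^sup>* (pre K) (pre L)"
  using assms by (induction rule: rtranclp_induct) (auto intro: rtranclp.rtrancl_into_rtrancl weak_step_pre)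

end

subsection \<open>Supersolubility via weak steps\<close>

text \<open>The value \<open>d\<close> is the order of \<open>a\<close>, with \<open>0\<close>
  standing for infinite order. This convention makes the divisibility criterion uniform.\<close>

lemma (in group) exponent_generator:
  assumes a: "a \<in> carrier G"
  shows "\<exists>d::nat. (\<forall>k::int. a [^] k = \<one> \<longleftrightarrow> int d dvd k) \<and>
    (d = 0 \<longrightarrow> infinite (generate G {a})) \<and> (d > 0 \<longrightarrow> card (generate G {a}) = d)"
proof -
  define D where "D = {k::int. a [^] k = \<one>}"
  have "\<exists>d\<in>D. \<forall>k\<in>D. d dvd k"
    by (rule int_subgroup_generator) (use a in \<open>auto simp: D_def int_pow_diff\<close>)
  then obtain d0 :: int where d0: "a [^] d0 = \<one>" "\<And>k. a [^] k = \<one> \<Longrightarrow> d0 dvd k" by (auto simp: D_def)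
  define d where "d = nat \<bar>d0\<bar>"
  have iff: "a [^] k = \<one> \<longleftrightarrow> int d dvd k" for k :: int
  proof
    assume "int d dvd k"
    then obtain q where "k = d0 * q" by (auto simp: d_def elim: dvdE)
    then show "a [^] k = \<one>" using d0(1) a by (simp add: int_pow_pow[symmetric])
  qed (use d0(2) in \<open>simp add: d_def\<close>)
  have eq_iff: "a [^] i = a [^] j \<longleftrightarrow> int d dvd i - j" for i j :: int
  proof -
    have "a [^] i = a [^] j \<longleftrightarrow> a [^] i \<otimes> inv (a [^] j) = \<one>"
      using a by (metis int_pow_closed inv_closed inv_equality inv_inv r_inv)
    also have "\<dots> \<longleftrightarrow> int d dvd i - j" using a iff by (simp add: int_pow_diff[symmetric])
    finally show ?thesis .
  qed
  have gen: "generate G {a} = range (\<lambda>k::int. a [^] k)" using a by (auto simp: generate_pow)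
  show ?thesis
  proof (intro exI[of _ d] conjI allI impI iff)
    assume "d = 0"
    then have "inj (\<lambda>k::int. a [^] k)" using eq_iff by (auto intro!: injI)
    then show "infinite (generate G {a})" unfolding gen using range_inj_infinite by (simp add: finite_image_iff infinite_UNIV_int)
  next
    assume d: "d > 0"
    have "range (\<lambda>k::int. a [^] k) = (\<lambda>k::int. a [^] k) ` {0..<int d}"
    proof -
      have "a [^] k = a [^] (k mod int d)" for k :: int by (simp add: eq_iff minus_mod_eq_mult_div)
      moreover have "k mod int d \<in> {0..<int d}" for k :: int using d by simp
      ultimately show ?thesis by blast
    qed
    moreover have "inj_on (\<lambda>k::int. a [^] k) {0..<int d}"
    proof (rule inj_onI)
      fix i j assume ij: "i \<in> {0..<int d}" "j \<in> {0..<int d}" "a [^] i = a [^] j"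
      then have "i mod int d = j mod int d" unfolding eq_iff mod_eq_dvd_iff by blast
      with ij show "i = j" by simp
    qed
    ultimately show "card (generate G {a}) = d" unfolding gen by (simp add: card_image)
  qed
qed

lemma (in group) pow_card_eq_one:
  assumes fin: "finite (carrier G)" and a: "a \<in> carrier G"
  shows "a [^] int (card (carrier G)) = \<one>"
proof -
  have sub: "generate G {a} \<subseteq> carrier G" using a by (intro generate_incl) simp
  have sg: "subgroup (generate G {a}) G" using a by (intro generate_is_subgroup) simp
  from exponent_generator[OF a]
  obtain d :: nat where d: "\<forall>k::int. a [^] k = \<one> \<longleftrightarrow> int d dvd k"
    "d = 0 \<longrightarrow> infinite (generate G {a})" "d > 0 \<longrightarrow> card (generate G {a}) = d"
    by (elim exE conjE)
  have "finite (generate G {a})" using fin sub finite_subset by blast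
  then have "card (rcosets (generate G {a})) * d = card (carrier G)"
    using lagrange[OF sg] d(2,3) by (auto simp: Coset.order_def)
  then have "d dvd card (carrier G)" by (metis dvd_triv_right)
  then show ?thesis using d(1) by simp
qed

lemma (in group) prime_order_generator:
  assumes "prime (card (carrier G))"
  shows "\<exists>a\<in>carrier G. generate G {a} = carrier G \<and> a [^] int (card (carrier G)) = \<one>"
proof -
  let ?p = "card (carrier G)"
  have fin: "finite (carrier G)" using assms prime_gt_0_nat card_gt_0_iff by blast
  have "\<not> carrier G \<subseteq> {\<one>}"
  proof
    assume "carrier G \<subseteq> {\<one>}"
    then have "?p \<le> 1" using card_mono[of "{\<one>}" "carrier G"] by simp
    then show False using assms prime_gt_1_nat[of ?p] by simp
  qed
  then obtain a where a: "a \<in> carrier G" "a \<noteq> \<one>" by blast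
  have sub: "generate G {a} \<subseteq> carrier G" using a by (intro generate_incl) simp
  have sg: "subgroup (generate G {a}) G" using a by (intro generate_is_subgroup) simp
  from exponent_generator[OF a(1)]
  obtain d :: nat where d: "\<forall>k::int. a [^] k = \<one> \<longleftrightarrow> int d dvd k"
    "d = 0 \<longrightarrow> infinite (generate G {a})" "d > 0 \<longrightarrow> card (generate G {a}) = d"
    by (elim exE conjE)
  have "finite (generate G {a})" using fin sub finite_subset by blast
  then have d0: "d > 0" using d(2) by blast
  have "card (rcosets (generate G {a})) * d = ?p"
    using lagrange[OF sg] d(3) d0 by (simp add: Coset.order_def)
  then have "d dvd ?p" by (metis dvd_triv_right)
  moreover have "d \<noteq> 1" using d(1)[rule_format, of 1] a by auto
  ultimately have "d = ?p" using assms prime_nat_iff by blast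
  then have "generate G {a} = carrier G" using d(3) d0 sub fin by (intro card_subset_eq) auto
  moreover have "a [^] int ?p = \<one>" using d(1) \<open>d = ?p\<close> by simp
  ultimately show ?thesis using a(1) by blast
qed

context skew_brace
begin

lemma strict_imp_weak:
  assumes step: "strict_step B K L"
  shows "weak_step B K L"
proof -
  have K: "brace_ideal B K" and L: "brace_ideal B L" and KL: "K \<subseteq> L"
    using step by (auto simp: strict_step_def)
  interpret K: ideal_of B K using K by (rule idealI)
  have LC: "L \<subseteq> C" using ideal_of.in_car[OF idealI[OF L]] by blast
  define Q where "Q = quot_brace B K"
  define L' where "L' = coset K ` L"
  interpret Q: skew_brace Q unfolding Q_def by (rule K.quot_skew_brace)
  have R: "quot_brace (restrict_brace B L) K = restrict_brace Q L'"
    by (simp add: quot_restrict Q_def L'_def)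
  have "brace_ideal Q L'" unfolding Q_def L'_def by (rule brace_epi.ideal_image[OF K.coset_epi L])
  then have sL: "subgroup L' (addG Q)" by (auto simp: brace_ideal_def subbrace_def)
  have L'C: "L' \<subseteq> bcar Q" using subgroup.subset[OF sL] by simp
  have "\<exists>\<gamma>\<in>L'. generate (addG Q) {\<gamma>} = L' \<and>
      (L' \<subseteq> Soc Q \<or> (\<exists>p::nat. prime p \<and> \<gamma> [^]\<^bsub>addG Q\<^esub> int p = bzero Q))"
  proof -
    have gen: "generate ((addG Q)\<lparr>carrier := L'\<rparr>) {\<gamma>} = generate (addG Q) {\<gamma>}" if "\<gamma> \<in> L'" for \<gamma>
      using Q.add.generate_consistent[OF _ sL, of "{\<gamma>}"] that by simp
    consider (inf) "infinite_cyclic_add (restrict_brace Q L')" "L' \<subseteq> Soc Q" | (prime) "prime (card L')"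
      using step unfolding strict_step_def R by (auto simp: Q_def)
    then show ?thesis
    proof cases
      case inf
      then show ?thesis using gen unfolding infinite_cyclic_add_def addG_restrict by auto
    next
      case prime
      interpret R: group "(addG Q)\<lparr>carrier := L'\<rparr>" using subgroup.subgroup_is_group[OF sL Q.add.group_axioms] .
      obtain \<gamma> where "\<gamma> \<in> L'" "generate ((addG Q)\<lparr>carrier := L'\<rparr>) {\<gamma>} = L'"
        "\<gamma> [^]\<^bsub>(addG Q)\<lparr>carrier := L'\<rparr>\<^esub> int (card L') = bzero Q"
        using R.prime_order_generator prime by auto
      then show ?thesis using gen prime Q.add.int_pow_consistent[OF sL] by auto
    qed
  qed
  then obtain \<gamma> where \<gamma>: "\<gamma> \<in> L'" "generate (addG Q) {\<gamma>} = L'"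
    "L' \<subseteq> Soc Q \<or> (\<exists>p::nat. prime p \<and> \<gamma> [^]\<^bsub>addG Q\<^esub> int p = bzero Q)" by blast
  obtain g where g: "g \<in> L" "\<gamma> = coset K g" using \<gamma>(1) by (auto simp: L'_def)
  have gc: "g \<in> C" using g LC by blast
  have "cyclic_mod B K L g"
    unfolding cyclic_mod_def
  proof (intro conjI g(1) ballI)
    fix x assume "x \<in> L"
    then have "coset K x \<in> generate (addG Q) {\<gamma>}" using \<gamma>(2) by (simp add: L'_def)
    then show "\<exists>k::int. coset K x = coset K (k \<cdot> g)"
      using Q.add.generate_pow[of \<gamma>] \<gamma>(1) L'C g gc by (auto simp: K.quot_hom_nmul Q_def)
  qed
  moreover have "central_mod B K L \<or> (\<exists>p::nat. prime p \<and> int p \<cdot> g \<in> K)"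
    using \<gamma>(3)
  proof
    assume "L' \<subseteq> Soc Q"
    then show ?thesis by (simp add: central_mod_def L'_def Q_def)
  next
    assume "\<exists>p::nat. prime p \<and> \<gamma> [^]\<^bsub>addG Q\<^esub> int p = bzero Q"
    then obtain p :: nat where p: "prime p" "\<gamma> [^]\<^bsub>addG Q\<^esub> int p = bzero Q" by blast
    then have "coset K (int p \<cdot> g) = K" using g gc by (simp add: K.quot_hom_nmul Q_def K.quot_zero)
    then have "int p \<cdot> g \<in> K" using gc K.coset_zero by simp
    with p(1) show ?thesis by blast
  qed
  ultimately show ?thesis using K L KL unfolding weak_step_def by blast
qed

lemma quot_generate:
  assumes K: "brace_ideal B K" and L: "brace_ideal B L" and cyc: "cyclic_mod B K L g"
  shows "generate (addG (quot_brace B K)) {coset K g} = coset K ` L"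
proof -
  interpret K: ideal_of B K using K by (rule idealI)
  interpret L: ideal_of B L using L by (rule idealI)
  interpret Q: skew_brace "quot_brace B K" by (rule K.quot_skew_brace)
  have g: "g \<in> L" "\<forall>x\<in>L. \<exists>k::int. coset K x = coset K (k \<cdot> g)" using cyc by (auto simp: cyclic_mod_def)
  have gc: "g \<in> C" using g L.in_car by blast
  have "generate (addG (quot_brace B K)) {coset K g} = {coset K (k \<cdot> g) | k::int. True}"
    using Q.add.generate_pow[of "coset K g"] gc by (auto simp: bcar_quot K.quot_hom_nmul)
  also have "\<dots> = coset K ` L"
    using g add.subgroup_int_pow_closed[OF L.addn.subgroup_axioms g(1)] by auto
  finally show ?thesis .
qed

text \<open>The order of \<open>g\<close> modulo \<open>K\<close> divides \<open>p\<close>: order 1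
  collapses the step, order \<open>p\<close> makes it a genuine step of prime order.\<close>

lemma prime_step_strict:
  assumes K: "brace_ideal B K" and L: "brace_ideal B L" and KL: "K \<subseteq> L"
    and cyc: "cyclic_mod B K L g" and p: "prime p" "int p \<cdot> g \<in> K"
  shows "K = L \<or> strict_step B K L"
proof -
  interpret K: ideal_of B K using K by (rule idealI)
  interpret L: ideal_of B L using L by (rule idealI)
  interpret Q: skew_brace "quot_brace B K" by (rule K.quot_skew_brace)
  have g: "g \<in> L" "\<forall>x\<in>L. \<exists>k::int. coset K x = coset K (k \<cdot> g)" using cyc by (auto simp: cyclic_mod_def)
  have gc: "g \<in> C" using g L.in_car by blast
  have \<gamma>c: "coset K g \<in> bcar (quot_brace B K)" using gc by (simp add: bcar_quot)
  from Q.add.exponent_generator[OF \<gamma>c]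
  obtain d :: nat where d: "\<forall>k::int. coset K g [^]\<^bsub>addG (quot_brace B K)\<^esub> k = bzero (quot_brace B K) \<longleftrightarrow> int d dvd k"
    "d > 0 \<longrightarrow> card (generate (addG (quot_brace B K)) {coset K g}) = d"
    by (elim exE conjE)
  have dvd: "k \<cdot> g \<in> K \<longleftrightarrow> int d dvd k" for k :: int
    using d(1)[rule_format, of k] gc by (simp add: K.quot_hom_nmul[symmetric] K.quot_zero K.coset_zero)
  have "d dvd p" using p(2) dvd by simp
  then consider "d = 1" | "d = p" using p(1) prime_nat_iff by blast
  then show ?thesis
  proof cases
    case 1
    have "L \<subseteq> K"
    proof
      fix x assume x: "x \<in> L"
      then obtain k :: int where "coset K x = coset K (k \<cdot> g)" using g by blast
      moreover have "k \<cdot> g \<in> K" using dvd 1 by simp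
      ultimately show "x \<in> K" using K.coset_zero[of x] K.coset_zero[of "k \<cdot> g"] L.in_car[OF x] gc by simp
    qed
    with KL show ?thesis by blast
  next
    case 2
    then have "prime (card (coset K ` L))"
      using d(2) quot_generate[OF K L cyc] p(1) prime_gt_0_nat by simp
    then show ?thesis using K L KL by (simp add: strict_step_def quot_restrict)
  qed
qed

text \<open>Refinement of a finite cyclic central section of order \<open>d\<close> by induction on
  \<open>d\<close>: for a prime \<open>q\<close> dividing \<open>d\<close>, the multiples of
  \<open>q g\<close> modulo \<open>K\<close> cut off a top factor of order \<open>q\<close>.\<close>

lemma central_finite_strict:
  assumes K: "brace_ideal B K" and d: "d > 0"
    and L: "brace_ideal B L" and KL: "K \<subseteq> L" and cyc: "cyclic_mod B K L g"
    and cen: "central_mod B K L" and dvd: "\<And>k::int. k \<cdot> g \<in> K \<longleftrightarrow> int d dvd k"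
  shows "(strict_step B)\<^sup>*\<^sup>* K L"
  using d L KL cyc cen dvd
proof (induction d arbitrary: L g rule: less_induct)
  case (less d)
  interpret K: ideal_of B K using K by (rule idealI)
  interpret L: ideal_of B L using less.prems(2) by (rule idealI)
  have LC: "L \<subseteq> C" using L.in_car by blast
  have g: "g \<in> L" "\<forall>x\<in>L. \<exists>k::int. coset K x = coset K (k \<cdot> g)" using less.prems by (auto simp: cyclic_mod_def)
  have gc: "g \<in> C" using g L.in_car by blast
  show ?case
  proof (cases "d = 1")
    case True
    then have "\<And>k::int. k \<cdot> g \<in> K" using less.prems by simp
    then have "x \<in> K" if "x \<in> L" for x
      using g(2) that K.coset_zero[of x] K.coset_zero LC gc by (metis add.int_pow_closed subsetD)
    then have "L = K" using less.prems(3) by blast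
    then show ?thesis by simp
  next
    case False
    then obtain q where q: "prime q" "q dvd d" using prime_factor_nat by blast
    then obtain m where m: "d = q * m" by blast
    have q1: "q > 1" using q prime_gt_1_nat by blast
    have m0: "m > 0" "m < d" using m less.prems(1) q1 by auto
    define g2 where "g2 = int q \<cdot> g"
    have g2L: "g2 \<in> L" unfolding g2_def by (rule add.subgroup_int_pow_closed[OF L.addn.subgroup_axioms g(1)])
    have g2c: "g2 \<in> C" using g2L LC by blast
    define E where "E = {x \<in> L. \<exists>k::int. coset K x = coset K (k \<cdot> g2)}"
    have EL: "E \<subseteq> L" by (auto simp: E_def)
    have sE: "subgroup E (addG B)"
    proof (rule add.subgroupI)
      show "E \<subseteq> C" using EL LC by blast
      have "coset K \<zero> = coset K ((0::int) \<cdot> g2)" by simp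
      then have "\<zero> \<in> E" unfolding E_def using L.addn.one_closed by blast
      then show "E \<noteq> {}" by blast
      fix a assume "a \<in> E"
      then obtain k :: int where a: "a \<in> L" "coset K a = coset K (k \<cdot> g2)" by (auto simp: E_def)
      have ac: "a \<in> C" using a LC by blast
      have "coset K (\<ominus> a) = coset K ((- k) \<cdot> g2)"
        using a ac g2c by (simp add: K.quot_hom_neg add.int_pow_neg)
      then show "\<ominus> a \<in> E" unfolding E_def using a(1) by blast
      fix b assume "b \<in> E"
      then obtain l :: int where b: "b \<in> L" "coset K b = coset K (l \<cdot> g2)" by (auto simp: E_def)
      have bc: "b \<in> C" using b LC by blast
      have "coset K (a \<oplus> b) = coset K ((k + l) \<cdot> g2)"
        using a b ac bc g2c by (simp add: K.quot_hom_add add.int_pow_mult)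
      then show "a \<oplus> b \<in> E" unfolding E_def using a(1) b(1) by blast
    qed
    have KE: "K \<subseteq> E"
    proof
      fix x assume x: "x \<in> K"
      then have "coset K x = coset K ((0::int) \<cdot> g2)"
        using K.coset_zero[of x] K.coset_zero[of \<zero>] K.in_car by simp
      then show "x \<in> E" unfolding E_def using x less.prems(3) by blast
    qed
    have inv: "lam B b x \<in> E" if b: "b \<in> C" and x: "x \<in> E" for b x
    proof -
      obtain k :: int where k: "x \<in> L" "coset K x = coset K (k \<cdot> g2)" using x by (auto simp: E_def)
      have xc: "x \<in> C" using k LC by blast
      obtain r :: int where r: "coset K (lam B b g) = coset K (r \<cdot> g)" using g L.lam_in[OF b g(1)] by blast
      have "coset K (lam B b x) = coset K (lam B b (k \<cdot> g2))" using k xc b g2c by (simp add: K.quot_hom_lam)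
      also have "lam B b (k \<cdot> g2) = (int q * k) \<cdot> lam B b g"
        using b gc by (simp add: g2_def lam_nmul add.int_pow_pow)
      also have "coset K \<dots> = coset K ((int q * k) \<cdot> (r \<cdot> g))"
        using r b gc by (intro K.coset_nmul_cong) auto
      also have "(int q * k) \<cdot> (r \<cdot> g) = (r * k) \<cdot> g2"
        using gc by (simp add: g2_def add.int_pow_pow mult_ac)
      finally show ?thesis unfolding E_def using L.lam_in[OF b k(1)] by blast
    qed
    \<comment> \<open>Centrality of the section is what makes this intermediate subgroup an ideal;
      its invariance under \<open>lam\<close> holds because \<open>lam b g\<close> is a multiple of
      \<open>g\<close> modulo \<open>K\<close>.\<close>
    have E: "brace_ideal B E" by (rule K.ideal_between[OF less.prems(2,5) sE KE EL inv])
    have "(strict_step B)\<^sup>*\<^sup>* K E"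
    proof (rule less.IH[OF m0(2,1) E KE])
      show "cyclic_mod B K E g2"
        unfolding cyclic_mod_def using g2L add.int_pow_1[OF g2c] by (auto simp: E_def intro!: exI[of _ 1])
      show "central_mod B K E" using less.prems(5) EL by (auto simp: central_mod_def)
      show "k \<cdot> g2 \<in> K \<longleftrightarrow> int m dvd k" for k :: int
      proof -
        have "k \<cdot> g2 = (int q * k) \<cdot> g" using gc by (simp add: g2_def add.int_pow_pow)
        then show ?thesis using less.prems(6) q1 by (simp add: m)
      qed
    qed
    moreover have "E = L \<or> strict_step B E L"
    proof (rule prime_step_strict[OF E less.prems(2) EL _ q(1)])
      interpret E: ideal_of B E using E by (rule idealI)
      show "cyclic_mod B E L g"
        unfolding cyclic_mod_def
      proof (intro conjI g(1) ballI)
        fix x assume x: "x \<in> L"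
        then obtain k :: int where "coset K x = coset K (k \<cdot> g)" using g by blast
        then have "x \<oplus> \<ominus> (k \<cdot> g) \<in> E" using K.coset_eq x LC gc KE by auto
        then show "\<exists>k::int. coset E x = coset E (k \<cdot> g)" using E.coset_eq x LC gc by auto
      qed
      show "int q \<cdot> g \<in> E" unfolding g2_def[symmetric] E_def
        using g2L add.int_pow_1[OF g2c] by (auto intro!: exI[of _ 1])
    qed
    ultimately show ?thesis by (auto intro: rtranclp.rtrancl_into_rtrancl)
  qed
qed

text \<open>In the central case the order of \<open>g\<close> modulo \<open>K\<close> decides:
  infinite order gives one infinite cyclic step, finite order a refinement into prime steps.\<close>

lemma weak_imp_strict_chain:
  assumes step: "weak_step B K L"
  shows "(strict_step B)\<^sup>*\<^sup>* K L"
proof -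
  have K: "brace_ideal B K" and L: "brace_ideal B L" and KL: "K \<subseteq> L"
    using step by (auto simp: weak_step_def)
  obtain g where cyc: "cyclic_mod B K L g"
    and or: "central_mod B K L \<or> (\<exists>p::nat. prime p \<and> int p \<cdot> g \<in> K)"
    using step by (auto simp: weak_step_def)
  interpret K: ideal_of B K using K by (rule idealI)
  interpret L: ideal_of B L using L by (rule idealI)
  interpret Q: skew_brace "quot_brace B K" by (rule K.quot_skew_brace)
  have gL: "g \<in> L" using cyc by (auto simp: cyclic_mod_def)
  then have gc: "g \<in> C" using L.in_car by blast
  have \<gamma>c: "coset K g \<in> bcar (quot_brace B K)" using gc by (simp add: bcar_quot)
  from or show ?thesis
  proof
    assume "\<exists>p::nat. prime p \<and> int p \<cdot> g \<in> K"
    then show ?thesis using prime_step_strict[OF K L KL cyc] by auto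
  next
    assume cen: "central_mod B K L"
    from Q.add.exponent_generator[OF \<gamma>c]
    obtain d :: nat where d: "\<forall>k::int. coset K g [^]\<^bsub>addG (quot_brace B K)\<^esub> k = bzero (quot_brace B K) \<longleftrightarrow> int d dvd k"
      "d = 0 \<longrightarrow> infinite (generate (addG (quot_brace B K)) {coset K g})"
      by (elim exE conjE)
    have dvd: "k \<cdot> g \<in> K \<longleftrightarrow> int d dvd k" for k :: int
      using d(1)[rule_format, of k] gc by (simp add: K.quot_hom_nmul[symmetric] K.quot_zero K.coset_zero)
    show ?thesis
    proof (cases "d = 0")
      case False
      then show ?thesis using central_finite_strict[OF K _ L KL cyc cen dvd] by simp
    next
      case True
      define L' where "L' = coset K ` L"
      have gen: "generate (addG (quot_brace B K)) {coset K g} = L'"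
        unfolding L'_def by (rule quot_generate[OF K L cyc])
      have "brace_ideal (quot_brace B K) L'" unfolding L'_def by (rule brace_epi.ideal_image[OF K.coset_epi L])
      then have sL: "subgroup L' (addG (quot_brace B K))" by (auto simp: brace_ideal_def subbrace_def)
      have gL': "coset K g \<in> L'" using gL by (simp add: L'_def)
      have "generate ((addG (quot_brace B K))\<lparr>carrier := L'\<rparr>) {coset K g} = L'"
        using Q.add.generate_consistent[OF _ sL, of "{coset K g}"] gL' gen by simp
      then have "infinite_cyclic_add (restrict_brace (quot_brace B K) L')"
        unfolding infinite_cyclic_add_def addG_restrict using d(2) True gen gL' by auto
      then have "strict_step B K L"
        unfolding strict_step_def quot_restrict using K L KL cen by (auto simp: central_mod_def L'_def)
      then show ?thesis by blast
    qed
  qed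
qed

theorem supersoluble_iff_weak: "supersoluble B \<longleftrightarrow> (weak_step B)\<^sup>*\<^sup>* {\<zero>} C"
proof -
  have "(strict_step B)\<^sup>*\<^sup>* K L \<Longrightarrow> (weak_step B)\<^sup>*\<^sup>* K L" for K L
    by (induction rule: rtranclp_induct) (auto intro: rtranclp.rtrancl_into_rtrancl strict_imp_weak)
  moreover have "(weak_step B)\<^sup>*\<^sup>* K L \<Longrightarrow> (strict_step B)\<^sup>*\<^sup>* K L" for K L
    by (induction rule: rtranclp_induct) (auto intro: rtranclp_trans weak_imp_strict_chain)
  ultimately show ?thesis unfolding supersoluble_iff_strict by blast
qed

end

subsection \<open>Finite ideals\<close>

context skew_brace
begin

lemma SocD:
  assumes "a \<in> Soc B"
  shows "a \<in> C" "b \<in> C \<Longrightarrow> lam B a b = b" "b \<in> C \<Longrightarrow> a \<oplus> b = b \<oplus> a"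
  using assms by (auto simp: Soc_def)

lemma Soc_add_subgroup: "subgroup (Soc B) (addG B)"
proof (rule add.subgroupI)
  show "Soc B \<subseteq> C" by (auto simp: Soc_def)
  have "\<zero> \<in> Soc B" by (simp add: Soc_def lam_one)
  then show "Soc B \<noteq> {}" by blast
  fix a assume a: "a \<in> Soc B"
  note aD = SocD[OF a]
  have "a \<odot> \<ominus> a = \<zero>" using aD(1,2) by (simp add: mul_lam)
  then have "minv (\<ominus> a) = a" using aD(1) by (intro mul.inv_equality) auto
  then have min: "minv a = \<ominus> a" using mul.inv_inv[of "\<ominus> a"] aD(1) by simp
  have "lam B (\<ominus> a) b = b" if "b \<in> C" for b
    using lam_minv(1)[of a b] aD(1,2) that by (simp add: min)
  moreover have "\<ominus> a \<oplus> b = b \<oplus> \<ominus> a" if b: "b \<in> C" for b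
  proof -
    have "\<ominus> a \<oplus> b = \<ominus> a \<oplus> (b \<oplus> a) \<oplus> \<ominus> a" using aD(1) b by (simp add: add.m_assoc)
    also have "\<dots> = \<ominus> a \<oplus> (a \<oplus> b) \<oplus> \<ominus> a" unfolding aD(3)[OF b] ..
    also have "\<dots> = b \<oplus> \<ominus> a" using aD(1) b by (simp add: add.m_assoc[symmetric])
    finally show ?thesis .
  qed
  ultimately show "\<ominus> a \<in> Soc B" using aD(1) by (simp add: Soc_def)
  fix b assume b: "b \<in> Soc B"
  note bD = SocD[OF b]
  have ab: "a \<oplus> b = a \<odot> b" using aD(1,2) bD(1) by (simp add: mul_lam)
  have "lam B (a \<oplus> b) c = c" if "c \<in> C" for c
    unfolding ab using that aD(1,2) bD(1,2) by (simp add: lam_mul)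
  moreover have "a \<oplus> b \<oplus> c = c \<oplus> (a \<oplus> b)" if c: "c \<in> C" for c
  proof -
    have "a \<oplus> b \<oplus> c = a \<oplus> (c \<oplus> b)" unfolding bD(3)[OF c, symmetric] using aD(1) bD(1) c by (simp add: add.m_assoc)
    also have "\<dots> = c \<oplus> (a \<oplus> b)" using aD(1) bD(1) c by (simp add: add.m_assoc[symmetric] aD(3)[OF c])
    finally show ?thesis .
  qed
  ultimately show "a \<oplus> b \<in> Soc B" using aD(1) bD(1) by (simp add: Soc_def)
qed

text \<open>Since \<open>lam B a\<close> is the identity for \<open>a\<close> in the socle, the two
  operations coincide there.\<close>

lemma Soc_mul_subgroup:
  assumes S: "subgroup S (addG B)" "S \<subseteq> Soc B"
  shows "subgroup S (mulG B)"
proof (rule mul.subgroupI)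
  show SC: "S \<subseteq> C" using S(2) SocD(1) by blast
  show "S \<noteq> {}" using subgroup.one_closed[OF S(1)] by blast
  fix a assume a: "a \<in> S"
  note aD = SocD[OF subsetD[OF S(2) a]]
  have na: "\<ominus> a \<in> S" using subgroup.m_inv_closed[OF S(1) a] by simp
  then have nD: "\<ominus> a \<in> C" using SC by blast
  have "\<ominus> a \<odot> a = \<zero>" using SocD(2)[OF subsetD[OF S(2) na] aD(1)] nD aD(1) by (simp add: mul_lam)
  then have "minv a = \<ominus> a" using nD aD(1) mul.inv_equality by blast
  with na show "minv a \<in> S" by simp
  fix b assume b: "b \<in> S"
  then have "a \<odot> b = a \<oplus> b" using aD(1,2) SC by (auto simp: mul_lam)
  then show "a \<odot> b \<in> S" using subgroup.m_closed[OF S(1) a b] by simp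
qed

lemma lam_central:
  assumes a: "a \<in> C" "\<And>b. b \<in> C \<Longrightarrow> a \<oplus> b = b \<oplus> a" and b: "b \<in> C" and c: "c \<in> C"
  shows "lam B b a \<oplus> c = c \<oplus> lam B b a"
proof -
  have "lam B b (a \<oplus> lam B (minv b) c) = lam B b (lam B (minv b) c \<oplus> a)"
    using a(2)[of "lam B (minv b) c"] b c by simp
  then show ?thesis using a(1) b c by (simp add: lam_add lam_minv)
qed

text \<open>The conjugate \<open>d\<close> has trivial \<open>lam\<close> because \<open>lam\<close>
  is multiplicative, so \<open>d + b = d b = b + lam b a\<close>, and \<open>lam b a\<close> is
  additively central like \<open>a\<close>.\<close>

lemma Soc_conj:
  assumes a: "a \<in> Soc B" and b: "b \<in> C"
  shows "b \<odot> a \<odot> minv b = lam B b a" "lam B b a \<in> Soc B"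
proof -
  note aD = SocD[OF a]
  define d where "d = b \<odot> a \<odot> minv b"
  have dc: "d \<in> C" using aD(1) b by (simp add: d_def)
  have ld: "lam B d c = c" if "c \<in> C" for c
    using that aD(1,2) b by (simp add: d_def lam_mul lam_minv)
  have cen: "lam B b a \<oplus> c = c \<oplus> lam B b a" if "c \<in> C" for c
    using lam_central[OF aD(1,3) b that] .
  have "d \<oplus> b = d \<odot> b" using mul_lam[OF dc b] ld[OF b] by simp
  also have "\<dots> = b \<oplus> lam B b a" unfolding d_def by (rule conj_mul[OF b aD(1)])
  also have "\<dots> = lam B b a \<oplus> b" using cen[OF b] by simp
  finally show eq: "b \<odot> a \<odot> minv b = lam B b a" using dc b aD(1) by (simp add: d_def)
  show "lam B b a \<in> Soc B" using ld cen aD(1) b eq by (simp add: Soc_def d_def)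
qed

lemma Soc_ideal: "brace_ideal B (Soc B)"
proof -
  have sa: "subgroup (Soc B) (addG B)" by (rule Soc_add_subgroup)
  have sm: "subgroup (Soc B) (mulG B)" by (rule Soc_mul_subgroup[OF sa subset_refl])
  have "b \<oplus> a \<oplus> \<ominus> b \<in> Soc B" if "a \<in> Soc B" "b \<in> C" for a b
  proof -
    have "b \<oplus> a \<oplus> \<ominus> b = a"
      unfolding SocD(3)[OF that, symmetric] using SocD(1)[OF that(1)] that(2) by (simp add: add.m_assoc)
    then show ?thesis using that(1) by simp
  qed
  then have "Soc B \<lhd> addG B" using add.normal_inv_iff sa by auto
  moreover have "Soc B \<lhd> mulG B" using mul.normal_inv_iff sm Soc_conj by auto
  ultimately show ?thesis using sa sm Soc_conj(2) by (auto simp: brace_ideal_def subbrace_def)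
qed

lemma central_mod_zero:
  assumes "A \<subseteq> Soc B"
  shows "central_mod B {\<zero>} A"
proof -
  interpret Z: ideal_of B "{\<zero>}" by (rule idealI[OF zero_ideal])
  have "A \<subseteq> C" using assms SocD(1) by blast
  then show ?thesis using assms SocD unfolding Z.central_mod_iff[OF \<open>A \<subseteq> C\<close>] by (metis subsetD)
qed

lemma Soc_sub_ideal:
  assumes "subgroup A (addG B)" "A \<subseteq> Soc B" "\<And>b x. b \<in> C \<Longrightarrow> x \<in> A \<Longrightarrow> lam B b x \<in> A"
  shows "brace_ideal B A"
proof (rule ideal_of.ideal_between[OF idealI[OF zero_ideal] Soc_ideal _ assms(1) _ assms(2,3)])
  show "central_mod B {\<zero>} (Soc B)" by (rule central_mod_zero) simp
  show "{\<zero>} \<subseteq> A" using subgroup.one_closed[OF assms(1)] by simp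
qed

lemma weak_chain_subset: "(weak_step B)\<^sup>*\<^sup>* K L \<Longrightarrow> K \<subseteq> L"
  by (induction rule: rtranclp_induct) (auto simp: weak_step_def)

lemma chain_first_infinite:
  assumes "(weak_step B)\<^sup>*\<^sup>* F L" "finite F" "infinite L"
  shows "\<exists>F' Z. F \<subseteq> F' \<and> finite F' \<and> infinite Z \<and> weak_step B F' Z"
  using assms(1,3)
proof (induction rule: rtranclp_induct)
  case base
  then show ?case using assms(2) by simp
next
  case (step K L)
  show ?case
  proof (cases "finite K")
    case True
    then show ?thesis using step.hyps(2) step.prems weak_chain_subset[OF step.hyps(1)] by blast
  qed (use step.IH in blast)
qed

text \<open>A finite order of \<open>g\<close> modulo \<open>F\<close> would make \<open>Z\<close> a
  finite union of finite cosets. Hence the order is infinite, which excludes the prime alternative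
  of a weak step.\<close>

lemma infinite_weak_step:
  assumes step: "weak_step B F Z" and F: "finite F" and Z: "infinite Z"
  shows "central_mod B F Z \<and> (\<exists>g. cyclic_mod B F Z g \<and> (\<forall>k::int. k \<cdot> g \<in> F \<longrightarrow> k = 0))"
proof -
  have iF: "brace_ideal B F" and iZ: "brace_ideal B Z" using step by (auto simp: weak_step_def)
  obtain g where cyc: "cyclic_mod B F Z g"
    and or: "central_mod B F Z \<or> (\<exists>p::nat. prime p \<and> int p \<cdot> g \<in> F)"
    using step by (auto simp: weak_step_def)
  interpret F: ideal_of B F using iF by (rule idealI)
  interpret Z: ideal_of B Z using iZ by (rule idealI)
  interpret Q: skew_brace "quot_brace B F" by (rule F.quot_skew_brace)
  have gc: "g \<in> C" using cyc Z.in_car by (auto simp: cyclic_mod_def)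
  have \<gamma>c: "coset F g \<in> bcar (quot_brace B F)" using gc by (simp add: bcar_quot)
  from Q.add.exponent_generator[OF \<gamma>c]
  obtain d :: nat where d: "\<forall>k::int. coset F g [^]\<^bsub>addG (quot_brace B F)\<^esub> k = bzero (quot_brace B F) \<longleftrightarrow> int d dvd k"
    "d > 0 \<longrightarrow> card (generate (addG (quot_brace B F)) {coset F g}) = d"
    by (elim exE conjE)
  have dvd: "k \<cdot> g \<in> F \<longleftrightarrow> int d dvd k" for k :: int
    using d(1)[rule_format, of k] gc by (simp add: F.quot_hom_nmul[symmetric] F.quot_zero F.coset_zero)
  have "d = 0"
  proof (rule ccontr)
    assume "d \<noteq> 0"
    then have "card (coset F ` Z) > 0" using d(2) quot_generate[OF iF iZ cyc] by simp
    then have fin: "finite (coset F ` Z)" by (rule card_ge_0_finite)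
    have "finite X" if "X \<in> coset F ` Z" for X
    proof -
      obtain z where "X = coset F z" using \<open>X \<in> coset F ` Z\<close> by (rule imageE)
      then have "X = (\<lambda>f. f \<oplus> z) ` F" by (auto simp: r_coset_def)
      then show ?thesis using F by simp
    qed
    then have "finite (\<Union>(coset F ` Z))" using fin by blast
    moreover have "Z \<subseteq> \<Union>(coset F ` Z)"
    proof
      fix z assume z: "z \<in> Z"
      have "z \<in> coset F z" using add.rcos_self[OF Z.in_car[OF z] F.addn.subgroup_axioms] .
      then show "z \<in> \<Union>(coset F ` Z)" using z by blast
    qed
    ultimately show False using Z finite_subset by blast
  qed
  then have zero: "\<forall>k::int. k \<cdot> g \<in> F \<longrightarrow> k = 0" using dvd by simp
  have "central_mod B F Z"
    using or
  proof
    assume "\<exists>p::nat. prime p \<and> int p \<cdot> g \<in> F"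
    then obtain p :: nat where p: "prime p" "int p \<cdot> g \<in> F" by blast
    then have "int p = 0" using zero by blast
    then show ?thesis using p(1) prime_gt_0_nat[of p] by simp
  qed
  then show ?thesis by (intro conjI exI[of _ g] cyc zero)
qed

lemma hom_eq_on_generate:
  assumes f: "group_hom (addG B) (addG B) f" and g: "group_hom (addG B) (addG B) g"
    and X: "X \<subseteq> C" "\<And>x. x \<in> X \<Longrightarrow> f x = g x" and y: "y \<in> generate (addG B) X"
  shows "f y = g y"
  using y
proof (induction y rule: generate.induct)
  case one
  then show ?case using group_hom.hom_one[OF f] group_hom.hom_one[OF g] by simp
next
  case (incl h)
  then show ?case using X by simp
next
  case (inv h)
  then show ?case using group_hom.hom_inv[OF f, of h] group_hom.hom_inv[OF g, of h] X by auto
next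
  case (eng h1 h2)
  have "h1 \<in> C" "h2 \<in> C" using eng.hyps add.generate_in_carrier[OF X(1)] by auto
  then show ?case
    using eng.IH group_hom.hom_mult[OF f, of h1 h2] group_hom.hom_mult[OF g, of h1 h2] by simp
qed

text \<open>An element of \<open>Z\<close> determines an automorphism \<open>lam B w\<close> and an inner automorphism of the
  finitely generated additive group, both trivial modulo the finite ideal \<open>F\<close>; there are only
  finitely many such pairs, and elements with the same pair differ by an element of the socle.\<close>

lemma infinite_Soc_Int:
  assumes fg: "subgroups_fin_gen (addG B) C"
    and F: "brace_ideal B F" "finite F" and Z: "brace_ideal B Z" "infinite Z"
    and cen: "central_mod B F Z"
  shows "infinite (Soc B \<inter> Z)"
proof -
  interpret F: ideal_of B F using F(1) by (rule idealI)
  interpret Z: ideal_of B Z using Z(1) by (rule idealI)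
  have ZC: "Z \<subseteq> C" using Z.in_car by blast
  have sC: "subgroup C (addG B)" using add.subgroup_self by simp
  from subgroups_fin_genE[OF fg sC subset_refl]
  obtain X where X: "finite X" "X \<subseteq> C" "generate (addG B) X = C" .
  define \<Phi> where "\<Phi> = (\<lambda>w. \<lambda>x\<in>X. (lam B w x \<oplus> \<ominus> x, (w \<oplus> x) \<oplus> \<ominus> (x \<oplus> w)))"
  have cenD: "lam B w x \<oplus> \<ominus> x \<in> F" "(w \<oplus> x) \<oplus> \<ominus> (x \<oplus> w) \<in> F" if "w \<in> Z" "x \<in> C" for w x
    using cen[unfolded F.central_mod_iff[OF ZC]] that ZC F.coset_eq by auto
  have "\<Phi> ` Z \<subseteq> X \<rightarrow>\<^sub>E F \<times> F"
  proof (intro image_subsetI PiE_I)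
    fix w x assume w: "w \<in> Z"
    show "\<Phi> w x \<in> F \<times> F" if x: "x \<in> X"
      using cenD[OF w subsetD[OF X(2) x]] x by (simp add: \<Phi>_def)
    show "\<Phi> w x = undefined" if "x \<notin> X" using that by (simp add: \<Phi>_def)
  qed
  moreover have "finite (X \<rightarrow>\<^sub>E F \<times> F)" using X(1) F(2) by (intro finite_PiE) auto
  ultimately have "finite (\<Phi> ` Z)" by (rule finite_subset)
  from pigeonhole_infinite[OF Z(2) this]
  obtain w0 where w0: "w0 \<in> Z" "infinite {w \<in> Z. \<Phi> w = \<Phi> w0}" by (elim bexE)
  have w0c: "w0 \<in> C" using w0 ZC by blast
  \<comment> \<open>The multiplicative quotient has trivial \<open>lam\<close> when the maps for
    \<open>w\<close> and \<open>w0\<close> agree. Its additive centrality is obtained from the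
    additive difference \<open>c\<close>, since \<open>lam B w0 (u w) = c\<close>.\<close>
  define u where "u = (\<lambda>w. minv w0 \<odot> w)"
  have uS: "u w \<in> Soc B \<inter> Z" if w: "w \<in> Z" "\<Phi> w = \<Phi> w0" for w
  proof -
    have wc: "w \<in> C" using w ZC by blast
    have uZ: "u w \<in> Z" unfolding u_def using Z.muln.m_closed Z.muln.m_inv_closed w(1) w0(1) by blast
    have uc: "u w \<in> C" using uZ ZC by blast
    have eqX: "lam B w x = lam B w0 x \<and> w \<oplus> x \<oplus> \<ominus> w = w0 \<oplus> x \<oplus> \<ominus> w0" if x: "x \<in> X" for x
    proof -
      have xc: "x \<in> C" using x X by blast
      have "\<Phi> w x = \<Phi> w0 x" using w(2) by simp
      then have 1: "lam B w x \<oplus> \<ominus> x = lam B w0 x \<oplus> \<ominus> x"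
        and 2: "(w \<oplus> x) \<oplus> \<ominus> (x \<oplus> w) = (w0 \<oplus> x) \<oplus> \<ominus> (x \<oplus> w0)" using x by (auto simp: \<Phi>_def)
      have "(w \<oplus> x \<oplus> \<ominus> w) \<oplus> \<ominus> x = (w0 \<oplus> x \<oplus> \<ominus> w0) \<oplus> \<ominus> x"
        using 2 xc wc w0c by (simp add: add.inv_mult_group add.m_assoc)
      then show ?thesis using 1 xc wc w0c by simp
    qed
    have conj_hom: "group_hom (addG B) (addG B) (\<lambda>x. v \<oplus> x \<oplus> \<ominus> v)" if "v \<in> C" for v
    proof unfold_locales
      have "v \<oplus> (x \<oplus> y) \<oplus> \<ominus> v = (v \<oplus> x \<oplus> \<ominus> v) \<oplus> (v \<oplus> y \<oplus> \<ominus> v)" if "x \<in> C" "y \<in> C" for x y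
      proof -
        have "\<ominus> v \<oplus> (v \<oplus> z) = z" if "z \<in> C" for z using that \<open>v \<in> C\<close> by (simp add: add.m_assoc[symmetric])
        then show ?thesis using that \<open>v \<in> C\<close> by (simp add: add.m_assoc)
      qed
      then show "(\<lambda>x. v \<oplus> x \<oplus> \<ominus> v) \<in> hom (addG B) (addG B)" using that by (simp add: hom_def)
    qed
    have lamw: "lam B w y = lam B w0 y" if "y \<in> C" for y
      using hom_eq_on_generate[OF lam_hom[OF wc] lam_hom[OF w0c] X(2), of y] eqX X(3) that by simp
    have conjw: "w \<oplus> y \<oplus> \<ominus> w = w0 \<oplus> y \<oplus> \<ominus> w0" if "y \<in> C" for y
      using hom_eq_on_generate[OF conj_hom[OF wc] conj_hom[OF w0c] X(2), of y] eqX X(3) that by simp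
    have lamu: "lam B (u w) y = y" if "y \<in> C" for y
      using that w0c wc by (simp add: u_def lam_mul lamw lam_minv)
    define c where "c = \<ominus> w0 \<oplus> w"
    have cc: "c \<in> C" using w0c wc by (simp add: c_def)
    have ccen: "c \<oplus> y = y \<oplus> c" if y: "y \<in> C" for y
    proof -
      have "w \<oplus> y = (w \<oplus> y \<oplus> \<ominus> w) \<oplus> w" using wc y by (simp add: add.m_assoc)
      also have "\<dots> = w0 \<oplus> y \<oplus> \<ominus> w0 \<oplus> w" unfolding conjw[OF y] ..
      finally have "w \<oplus> y = w0 \<oplus> y \<oplus> \<ominus> w0 \<oplus> w" .
      then have "\<ominus> w0 \<oplus> (w \<oplus> y) = \<ominus> w0 \<oplus> (w0 \<oplus> (y \<oplus> (\<ominus> w0 \<oplus> w)))"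
        using wc w0c y by (simp add: add.m_assoc)
      also have "\<dots> = y \<oplus> c" using wc w0c y by (simp add: c_def add.m_assoc[symmetric])
      finally show ?thesis using wc w0c y by (simp add: c_def add.m_assoc)
    qed
    have "w0 \<oplus> lam B w0 (u w) = w0 \<odot> u w" using w0c uc by (simp add: mul_lam)
    also have "\<dots> = w" using w0c wc by (simp add: u_def mul.m_assoc[symmetric])
    finally have "lam B w0 (u w) = c" using w0c uc wc by (simp add: c_def add.inv_solve_left)
    then have "u w = lam B (minv w0) c" using lam_minv(1)[OF w0c uc] by simp
    then have "u w \<oplus> y = y \<oplus> u w" if "y \<in> C" for y
      using lam_central[OF cc ccen _ that, of "minv w0"] w0c by simp
    then show ?thesis using uc uZ lamu by (simp add: Soc_def)
  qed
  have "inj_on u {w \<in> Z. \<Phi> w = \<Phi> w0}"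
  proof (rule inj_onI)
    fix a b assume ab: "a \<in> {w \<in> Z. \<Phi> w = \<Phi> w0}" "b \<in> {w \<in> Z. \<Phi> w = \<Phi> w0}" "u a = u b"
    then have "a \<in> C" "b \<in> C" using ZC by auto
    then show "a = b" using ab(3) w0c by (simp add: u_def)
  qed
  then have "infinite (u ` {w \<in> Z. \<Phi> w = \<Phi> w0})" using w0(2) finite_imageD by blast
  moreover have "u ` {w \<in> Z. \<Phi> w = \<Phi> w0} \<subseteq> Soc B \<inter> Z" using uS by blast
  ultimately show ?thesis using finite_subset by blast
qed

text \<open>In the first infinite step \<open>Z\<close> above a finite \<open>F'\<close>, the
  torsion of \<open>Z\<close> lies in \<open>F'\<close>, as the quotient is infinite cyclic.
  Multiplying the infinite ideal \<open>S\<close> in the socle by the order of \<open>F'\<close>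
  therefore removes all torsion, and with it the intersection with \<open>F\<close>.\<close>

lemma disjoint_ideal:
  assumes fg: "subgroups_fin_gen (addG B) C" and inf: "infinite C"
    and F: "finite F" "(weak_step B)\<^sup>*\<^sup>* F C"
  shows "\<exists>W. brace_ideal B W \<and> W \<noteq> {\<zero>} \<and> F \<inter> W = {\<zero>}"
proof -
  obtain F' Z where FZ: "F \<subseteq> F'" "finite F'" "infinite Z" "weak_step B F' Z"
    using chain_first_infinite[OF F(2,1) inf] by blast
  have iF: "brace_ideal B F'" and iZ: "brace_ideal B Z" using FZ(4) by (auto simp: weak_step_def)
  have cen: "central_mod B F' Z"
    using infinite_weak_step[OF FZ(4,2,3)] by blast
  obtain g where g: "cyclic_mod B F' Z g" "\<forall>k::int. k \<cdot> g \<in> F' \<longrightarrow> k = 0"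
    using infinite_weak_step[OF FZ(4,2,3)] by blast
  interpret F: ideal_of B F' using iF by (rule idealI)
  interpret Z: ideal_of B Z using iZ by (rule idealI)
  have gc: "g \<in> C" using g(1) Z.in_car by (auto simp: cyclic_mod_def)
  define S where "S = Soc B \<inter> Z"
  have infS: "infinite S" unfolding S_def by (rule infinite_Soc_Int[OF fg iF FZ(2) iZ FZ(3) cen])
  have iS: "brace_ideal B S" unfolding S_def by (rule ideal_Int[OF Soc_ideal iZ])
  interpret S: ideal_of B S using iS by (rule idealI)
  define t where "t = card F'"
  have F0: "\<zero> \<in> F'" by (rule F.addn.one_closed)
  then have "F' \<noteq> {}" by blast
  then have t0: "t > 0" using FZ(2) by (simp add: t_def card_gt_0_iff)
  have tF: "int t \<cdot> s = \<zero>" if "s \<in> F'" for s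
  proof -
    interpret R: group "(addG B)\<lparr>carrier := F'\<rparr>"
      using F.addn.subgroup_is_group[OF add.group_axioms] .
    show ?thesis
      using R.pow_card_eq_one[of s] that FZ(2) add.int_pow_consistent[OF F.addn.subgroup_axioms that] by (simp add: t_def)
  qed
  have torsion_back: "s \<in> F'" if s: "s \<in> S" "int t \<cdot> s \<in> F'" for s
  proof -
    have sc: "s \<in> C" using S.in_car s by blast
    obtain k :: int where k: "coset F' s = coset F' (k \<cdot> g)" using g(1) s(1) by (auto simp: cyclic_mod_def S_def)
    have "coset F' (int t \<cdot> s) = coset F' (int t \<cdot> (k \<cdot> g))"
      using k sc gc by (intro F.coset_nmul_cong) auto
    moreover have "coset F' (int t \<cdot> s) = F'" using s(2) sc by (simp add: F.coset_zero)
    ultimately have "int t \<cdot> (k \<cdot> g) \<in> F'" using gc F.coset_zero[of "int t \<cdot> (k \<cdot> g)"] by simp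
    then have "(k * int t) \<cdot> g \<in> F'" using gc by (simp add: add.int_pow_pow)
    then have "k * int t = 0" using g(2) by blast
    then have "k = 0" using t0 by simp
    then have "coset F' s = F'" using k F.coset_zero[of \<zero>] F0 by simp
    then show ?thesis using sc F.coset_zero by simp
  qed
  \<comment> \<open>Multiplication by an integer is additive on \<open>S\<close> because the socle
    is central. The image is nontrivial: otherwise the infinite \<open>S\<close> would lie inside
    the finite \<open>F'\<close>.\<close>
  define W where "W = (\<lambda>s. int t \<cdot> s) ` S"
  have sW: "subgroup W (addG B)"
  proof (rule add.subgroupI)
    show "W \<subseteq> C" using S.in_car by (auto simp: W_def)
    show "W \<noteq> {}" unfolding W_def using S.addn.one_closed by blast
    fix a assume "a \<in> W"
    then obtain s where s: "s \<in> S" "a = int t \<cdot> s" by (auto simp: W_def)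
    then have "\<ominus> a = int t \<cdot> \<ominus> s" using S.in_car by (simp add: add.int_pow_inv)
    then show "\<ominus> a \<in> W" using S.addn.m_inv_closed[OF s(1)] by (auto simp: W_def)
    fix b assume "b \<in> W"
    then obtain r where r: "r \<in> S" "b = int t \<cdot> r" by (auto simp: W_def)
    have comm: "s \<oplus> r = r \<oplus> s" using s(1) S.in_car[OF r(1)] by (intro SocD(3)) (simp_all add: S_def)
    have "a \<oplus> b = int t \<cdot> (s \<oplus> r)"
      using add.int_pow_mult_distrib[OF comm S.in_car[OF s(1)] S.in_car[OF r(1)]] s(2) r(2) by simp
    then show "a \<oplus> b \<in> W" using S.addn.m_closed[OF s(1) r(1)] by (auto simp: W_def)
  qed
  have "W \<subseteq> Soc B"
    using add.subgroup_int_pow_closed[OF Soc_add_subgroup] by (auto simp: W_def S_def)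
  then have iW: "brace_ideal B W"
    using S.lam_in S.in_car by (intro Soc_sub_ideal[OF sW]) (auto simp: W_def lam_nmul)
  moreover have "W \<noteq> {\<zero>}"
  proof
    assume "W = {\<zero>}"
    have "s \<in> F'" if s: "s \<in> S" for s
    proof (rule torsion_back[OF s])
      have "int t \<cdot> s \<in> W" using s by (simp add: W_def)
      then have "int t \<cdot> s = \<zero>" using \<open>W = {\<zero>}\<close> by simp
      then show "int t \<cdot> s \<in> F'" using F0 by simp
    qed
    then have "S \<subseteq> F'" by blast
    then show False using infS FZ(2) finite_subset by blast
  qed
  moreover have "F \<inter> W \<subseteq> {\<zero>}" using torsion_back tF FZ(1) by (auto simp: W_def)
  moreover have "\<zero> \<in> F \<inter> W"
  proof -
    have "brace_ideal B F"
      using F(2) by (cases rule: converse_rtranclpE) (auto simp: full_ideal weak_step_def)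
    then have "subgroup F (addG B)" by (auto simp: brace_ideal_def subbrace_def)
    then have "\<zero> \<in> F" using subgroup.one_closed by fastforce
    moreover have "\<zero> \<in> W" using subgroup.one_closed[OF sW] by simp
    ultimately show ?thesis by blast
  qed
  ultimately show ?thesis by blast
qed

lemma chain_of_finite_ideal:
  assumes fg: "subgroups_fin_gen (addG B) C" and inf: "infinite C"
    and chain: "\<And>N. brace_ideal B N \<Longrightarrow> N \<noteq> {\<zero>} \<Longrightarrow> (weak_step B)\<^sup>*\<^sup>* N C"
    and F: "brace_ideal B F" "finite F" "F \<noteq> {\<zero>}"
  shows "(weak_step B)\<^sup>*\<^sup>* {\<zero>} C"
proof -
  have FC: "F \<subseteq> C" using ideal_of.in_car[OF idealI[OF F(1)]] by blast
  obtain W where W: "brace_ideal B W" "W \<noteq> {\<zero>}" "F \<inter> W = {\<zero>}"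
    using disjoint_ideal[OF fg inf F(2) chain[OF F(1,3)]] by blast
  have "(weak_step B)\<^sup>*\<^sup>* (F \<inter> W) (F \<inter> C)" by (rule weak_chain_Int[OF F(1) chain[OF W(1,2)]])
  then have "(weak_step B)\<^sup>*\<^sup>* {\<zero>} F" using W(3) FC by (simp add: Int_absorb2)
  then show ?thesis using chain[OF F(1,3)] by (rule rtranclp_trans)
qed

end

subsection \<open>Ideals in the socle\<close>

lemma almost_polycyclicE:
  assumes "almost_polycyclic B"
  obtains n J where "J 0 = {bzero B}" "J n = bcar B" "\<And>i. i \<le> n \<Longrightarrow> brace_ideal B (J i)"
    and "\<And>i. i < n \<Longrightarrow> (\<lambda>x. J i #>\<^bsub>addG B\<^esub> x) ` J (Suc i) \<subseteq> Soc (quot_brace B (J i)) \<and>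
          fin_gen_brace (restrict_brace (quot_brace B (J i)) ((\<lambda>x. J i #>\<^bsub>addG B\<^esub> x) ` J (Suc i)))
         \<or> finite ((\<lambda>x. J i #>\<^bsub>addG B\<^esub> x) ` J (Suc i))"
proof -
  from assms[unfolded almost_polycyclic_def] obtain n J where J: "J 0 = {bzero B} \<and> J n = bcar B \<and>
     (\<forall>i\<le>n. brace_ideal B (J i)) \<and>
     (\<forall>i<n. J i \<subseteq> J (Suc i) \<and>
        ((bcar (quot_brace (restrict_brace B (J (Suc i))) (J i)) \<subseteq> Soc (quot_brace B (J i)) \<and>
          fin_gen_brace (quot_brace (restrict_brace B (J (Suc i))) (J i)))
         \<or> finite (bcar (quot_brace (restrict_brace B (J (Suc i))) (J i)))))" by (elim exE)
  show thesis by (rule that[of J n]) (use J in \<open>simp_all add: quot_restrict\<close>)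
qed

context skew_brace
begin

lemma Soc_restrict_comm_group:
  assumes A: "subgroup A (addG B)" "A \<subseteq> Soc B"
  shows "comm_group ((addG B)\<lparr>carrier := A\<rparr>)"
proof -
  interpret R: group "(addG B)\<lparr>carrier := A\<rparr>" using subgroup.subgroup_is_group[OF A(1) add.group_axioms] .
  show ?thesis
  proof (rule R.group_comm_groupI)
    fix x y assume "x \<in> carrier ((addG B)\<lparr>carrier := A\<rparr>)" "y \<in> carrier ((addG B)\<lparr>carrier := A\<rparr>)"
    then have "x \<in> Soc B" "y \<in> C" using A(2) SocD(1) by auto
    then have "x \<oplus> y = y \<oplus> x" by (rule SocD(3))
    then show "x \<otimes>\<^bsub>(addG B)\<lparr>carrier := A\<rparr>\<^esub> y = y \<otimes>\<^bsub>(addG B)\<lparr>carrier := A\<rparr>\<^esub> x" by simp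
  qed
qed

text \<open>Transfers the group-theoretic result on flagged actions to the brace: subgroups of
  \<open>A\<close> invariant under \<open>lam\<close> are ideals, so the multiples \<open>pA\<close>
  and the cyclic group of a common eigenvector are available as bottoms of chains.\<close>

lemma chain_of_Soc_ideal:
  assumes fg: "subgroups_fin_gen (addG B) C"
    and chain: "\<And>N. brace_ideal B N \<Longrightarrow> N \<noteq> {\<zero>} \<Longrightarrow> (weak_step B)\<^sup>*\<^sup>* N C"
    and A: "brace_ideal B A" "A \<subseteq> Soc B" "A \<noteq> {\<zero>}"
    and nofin: "\<And>N. brace_ideal B N \<Longrightarrow> finite N \<Longrightarrow> N = {\<zero>}"
  shows "(weak_step B)\<^sup>*\<^sup>* {\<zero>} C"
proof -
  interpret A: ideal_of B A using A(1) by (rule idealI)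
  define GA where "GA = (addG B)\<lparr>carrier := A\<rparr>"
  have sA: "subgroup A (addG B)" by (rule A.addn.subgroup_axioms)
  interpret GA: comm_group GA unfolding GA_def by (rule Soc_restrict_comm_group[OF sA A(2)])
  have GA_simps: "carrier GA = A" "monoid.mult GA = badd B" "monoid.one GA = \<zero>" by (simp_all add: GA_def)
  have GA_inv: "inv\<^bsub>GA\<^esub> x = \<ominus> x" if "x \<in> A" for x
    using add.m_inv_consistent[OF sA that] by (simp add: GA_def)
  have GA_pow: "x [^]\<^bsub>GA\<^esub> k = k \<cdot> x" if "x \<in> A" for x and k :: int
    using add.int_pow_consistent[OF sA that] by (simp add: GA_def)
  have GA_sub: "subgroup H GA \<longleftrightarrow> subgroup H (addG B) \<and> H \<subseteq> A" for H
    unfolding GA_def using add.subgroup_incl[OF _ sA] add.incl_subgroup[OF sA] subgroup.subset[of H "(addG B)\<lparr>carrier := A\<rparr>"]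
    by auto
  have Ac: "x \<in> C" if "x \<in> A" for x using A.in_car[OF that] .
  have Acomm: "x \<oplus> y = y \<oplus> x" if "x \<in> A" "y \<in> A" for x y
    using SocD(3) subsetD[OF A(2) that(1)] Ac[OF that(2)] by blast
  have Apow: "k \<cdot> x \<in> A" if "x \<in> A" for k :: int and x
    by (rule add.subgroup_int_pow_closed[OF sA that])
  have fgA: "subgroups_fin_gen GA A"
    unfolding GA_def using add.subgroups_fin_gen_restrict[OF sA] subgroups_fin_gen_mono[OF fg] A.addn.subset by simp
  have Asub_ideal: "brace_ideal B S"
    if "subgroup S (addG B)" "S \<subseteq> A" "\<And>b x. b \<in> C \<Longrightarrow> x \<in> S \<Longrightarrow> lam B b x \<in> S" for S
    using that A(2) by (intro Soc_sub_ideal) auto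
  have torsion: "k = 0 \<or> x = \<zero>" if x: "x \<in> A" "k \<cdot> x = \<zero>" for x and k :: int
  proof (cases "k = 0")
    case False
    define m where "m = nat \<bar>k\<bar>"
    have m: "m > 0" using False by (simp add: m_def)
    \<comment> \<open>The elements killed by \<open>m\<close> form an ideal that is finitely
      generated of finite exponent, hence finite. The absence of finite nonzero ideals is thus
      exactly what gives torsion-freeness.\<close>
    define S where "S = {y \<in> A. int m \<cdot> y = \<zero>}"
    have sS: "subgroup S (addG B)"
    proof (rule add.subgroupI)
      show "S \<subseteq> C" using Ac by (auto simp: S_def)
      have "\<zero> \<in> S" using A.addn.one_closed by (simp add: S_def)
      then show "S \<noteq> {}" by blast
      show "\<ominus> y \<in> S" if "y \<in> S" for y
        using that Ac A.addn.m_inv_closed by (simp add: S_def add.int_pow_inv)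
      show "y \<oplus> z \<in> S" if "y \<in> S" "z \<in> S" for y z
        using that Ac A.addn.m_closed add.int_pow_mult_distrib[OF Acomm, of y z] by (simp add: S_def)
    qed
    have SA: "S \<subseteq> A" by (auto simp: S_def)
    have iS: "brace_ideal B S"
      using A.lam_in Ac by (intro Asub_ideal[OF sS SA]) (auto simp: S_def lam_nmul[symmetric] lam_zero)
    have "subgroup S GA" using GA_sub sS SA by blast
    from subgroups_fin_genE[OF fgA this SA]
    obtain F where F: "finite F" "F \<subseteq> S" "generate GA F = S" .
    have "finite (generate GA F)"
    proof (rule GA.fin_gen_exponent_finite[OF F(1) _ m])
      show "F \<subseteq> carrier GA" using F(2) SA by (simp add: GA_simps)
      show "y [^]\<^bsub>GA\<^esub> int m = \<one>\<^bsub>GA\<^esub>" if "y \<in> generate GA F" for y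
        using that F(3) by (simp add: S_def GA_pow GA_simps)
    qed
    then have "S = {\<zero>}" using F(3) nofin[OF iS] by simp
    moreover have "x \<in> S"
    proof (cases "k \<ge> 0")
      case True
      then show ?thesis using x by (simp add: S_def m_def)
    next
      case False
      then show ?thesis using x Ac[OF x(1)] by (simp add: S_def m_def add.int_pow_neg)
    qed
    ultimately show ?thesis by blast
  qed simp
  interpret flagged_action GA "lam B ` C"
  proof
    show "subgroups_fin_gen GA (carrier GA)" using fgA by (simp add: GA_simps)
    show "k = 0 \<or> x = \<one>\<^bsub>GA\<^esub>" if "x \<in> carrier GA" "x [^]\<^bsub>GA\<^esub> k = \<one>\<^bsub>GA\<^esub>" for x and k :: int
      using that torsion GA_pow by (simp add: GA_simps)
    show "T \<in> iso GA GA" if T: "T \<in> lam B ` C" for T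
    proof -
      obtain b where b: "b \<in> C" "T = lam B b" using T by blast
      have "lam B b \<in> hom GA GA"
        using b(1) A.lam_in Ac lam_add by (auto simp: hom_def GA_simps)
      moreover have "bij_betw (lam B b) A A"
        by (rule bij_betwI[where g = "lam B (minv b)"]) (use b(1) A.lam_in Ac in \<open>auto simp: lam_minv\<close>)
      ultimately show ?thesis using b(2) by (simp add: iso_def GA_simps)
    qed
    show "\<exists>R\<in>lam B ` C. \<forall>v\<in>carrier GA. R v = S (T v)" if ST: "S \<in> lam B ` C" "T \<in> lam B ` C" for S T
    proof -
      obtain a b where ab: "a \<in> C" "S = lam B a" "b \<in> C" "T = lam B b" using ST by blast
      then have "\<forall>v\<in>carrier GA. lam B (a \<odot> b) v = S (T v)" using Ac by (simp add: GA_simps lam_mul)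
      then show ?thesis using ab mul.m_closed by blast
    qed
    show "\<exists>S\<in>lam B ` C. \<forall>v\<in>carrier GA. S (T v) = v" if T: "T \<in> lam B ` C" for T
    proof -
      obtain b where b: "b \<in> C" "T = lam B b" using T by blast
      then have "\<forall>v\<in>carrier GA. lam B (minv b) (T v) = v" using Ac by (simp add: GA_simps lam_minv)
      then show ?thesis using b(1) mul.inv_closed by blast
    qed
    show "carrier GA \<noteq> {\<one>\<^bsub>GA\<^esub>}" using A(3) by (simp add: GA_simps)
  qed
  have flag_of_weak: "flag_step K L" if step: "weak_step B K L" and LA: "L \<subseteq> A" for K L
  proof -
    have iK: "brace_ideal B K" and iL: "brace_ideal B L" and KL: "K \<subseteq> L"
      using step by (auto simp: weak_step_def)
    interpret K: ideal_of B K using iK by (rule idealI)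
    interpret L: ideal_of B L using iL by (rule idealI)
    obtain g where g: "g \<in> L" "\<forall>x\<in>L. \<exists>k::int. coset K x = coset K (k \<cdot> g)"
      using step unfolding weak_step_def cyclic_mod_def by blast
    have gA: "g \<in> A" using g(1) LA by blast
    have "\<exists>k::int. x \<otimes>\<^bsub>GA\<^esub> inv\<^bsub>GA\<^esub> (g [^]\<^bsub>GA\<^esub> k) \<in> K" if x: "x \<in> L" for x
    proof -
      obtain k :: int where "coset K x = coset K (k \<cdot> g)" using g(2) x by blast
      then have "x \<oplus> \<ominus> (k \<cdot> g) \<in> K" using K.coset_eq[OF L.in_car[OF x], of "k \<cdot> g"] Ac[OF gA] by simp
      then show ?thesis using gA Apow[OF gA] by (auto simp: GA_pow GA_inv GA_simps)
    qed
    then have "\<exists>g\<in>L. \<forall>x\<in>L. \<exists>k::int. x \<otimes>\<^bsub>GA\<^esub> inv\<^bsub>GA\<^esub> (g [^]\<^bsub>GA\<^esub> k) \<in> K"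
      using g(1) by (intro bexI[of _ g]) auto
    then show ?thesis
      unfolding flag_step_def GA_sub
      using K.addn.subgroup_axioms L.addn.subgroup_axioms KL LA K.lam_in L.lam_in by (intro conjI) auto
  qed
  have flags: "flag_step\<^sup>*\<^sup>* (powers p) (carrier GA)" if p: "prime p" for p
  proof -
    define N where "N = powers p"
    have N: "N = (\<lambda>x. int p \<cdot> x) ` A" by (auto simp: N_def powers_def GA_pow GA_simps)
    have sN: "subgroup N (addG B)" and NA: "N \<subseteq> A" using powers_subgroup[of p] GA_sub by (auto simp: N_def)
    have iN: "brace_ideal B N"
      using A.lam_in Ac by (intro Asub_ideal[OF sN NA]) (auto simp: N lam_nmul)
    obtain a where a: "a \<in> A" "a \<noteq> \<zero>" using A(3) A.addn.one_closed by blast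
    then have "int p \<cdot> a \<noteq> \<zero>" using torsion[of a "int p"] p prime_gt_0_nat[of p] by auto
    then have "N \<noteq> {\<zero>}" using a by (auto simp: N)
    \<comment> \<open>The chain leads from \<open>pA\<close> up to the whole brace; cutting it down
      by \<open>A\<close> leaves a flag between \<open>pA\<close> and \<open>A\<close>.\<close>
    then have "(weak_step B)\<^sup>*\<^sup>* (A \<inter> N) (A \<inter> C)" using weak_chain_Int[OF A(1) chain[OF iN]] by blast
    moreover have "A \<inter> N = N" "A \<inter> C = A" using NA Ac by auto
    ultimately have ch: "(weak_step B)\<^sup>*\<^sup>* N A" by simp
    have "L \<subseteq> A \<Longrightarrow> flag_step\<^sup>*\<^sup>* N L" if "(weak_step B)\<^sup>*\<^sup>* N L" for L
      using that
    proof (induction rule: rtranclp_induct)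
      case (step K L)
      have "K \<subseteq> L" using step.hyps(2) by (auto simp: weak_step_def)
      then show ?case using step flag_of_weak by (metis order_trans rtranclp.rtrancl_into_rtrancl)
    qed simp
    from this[OF ch] show ?thesis by (simp add: N_def GA_simps)
  qed
  obtain v where v: "v \<in> A" "v \<noteq> \<zero>" "\<And>b. b \<in> C \<Longrightarrow> lam B b v = v \<or> lam B b v = \<ominus> v"
    using common_eigenvector[OF flags] GA_inv by (auto simp: GA_simps)
  \<comment> \<open>Each \<open>lam B b\<close> sends \<open>v\<close> to itself or its negative, so
    the multiples of \<open>v\<close> are invariant; being inside the socle, they form an
    ideal.\<close>
  define D where "D = range (\<lambda>k::int. k \<cdot> v)"
  have vc: "v \<in> C" by (rule Ac[OF v(1)])
  have D: "D = generate (addG B) {v}" using add.generate_pow[of v] vc by (auto simp: D_def)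
  have sD: "subgroup D (addG B)" unfolding D using vc by (intro add.generate_is_subgroup) simp
  have DA: "D \<subseteq> A" using Apow[OF v(1)] by (auto simp: D_def)
  have iD: "brace_ideal B D"
  proof (rule Asub_ideal[OF sD DA])
    fix b x assume b: "b \<in> C" and x: "x \<in> D"
    then obtain k :: int where "x = k \<cdot> v" by (auto simp: D_def)
    then have "lam B b x = k \<cdot> lam B b v" using b vc by (simp add: lam_nmul)
    also have "\<dots> = k \<cdot> v \<or> \<dots> = (- k) \<cdot> v"
      using v(3)[OF b] vc by (auto simp: add.int_pow_inv add.int_pow_neg)
    finally show "lam B b x \<in> D" by (auto simp: D_def)
  qed
  have vD: "v \<in> D" unfolding D by (rule generate.incl) simp
  have "weak_step B {\<zero>} D"
    unfolding weak_step_def cyclic_mod_def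
  proof (intro conjI exI[of _ v] disjI1 vD ballI zero_ideal iD)
    show "{\<zero>} \<subseteq> D" using subgroup.one_closed[OF sD] by simp
    show "\<exists>k::int. coset {\<zero>} x = coset {\<zero>} (k \<cdot> v)" if "x \<in> D" for x using that by (auto simp: D_def)
    show "central_mod B {\<zero>} D" using DA A(2) by (intro central_mod_zero) blast
  qed
  moreover have "(weak_step B)\<^sup>*\<^sup>* D C" using vD v(2) by (intro chain[OF iD]) auto
  ultimately show ?thesis by (rule converse_rtranclp_into_rtranclp)
qed

text \<open>Inside the socle, additive subgroups are subbraces, so generation as a brace is the same
  as additive generation, and finitely generated abelian groups are Noetherian.\<close>

lemma fin_gen_Soc_section:
  assumes L: "brace_ideal B L" "L \<subseteq> Soc B" and fg: "fin_gen_brace (restrict_brace B L)"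
  shows "subgroups_fin_gen (addG B) L"
proof -
  have sL: "subgroup L (addG B)" and mL: "subgroup L (mulG B)"
    using L(1) by (auto simp: brace_ideal_def subbrace_def)
  obtain F where F: "finite F" "F \<subseteq> L" "brace_generate (restrict_brace B L) F = L"
    using fg by (auto simp: fin_gen_brace_def)
  have LC: "L \<subseteq> C" using L(2) SocD(1) by blast
  define S where "S = generate (addG B) F"
  have sS: "subgroup S (addG B)" unfolding S_def using F(2) LC by (intro add.generate_is_subgroup) auto
  have SL: "S \<subseteq> L" unfolding S_def using add.generate_subgroup_incl[OF F(2) sL] .
  have mS: "subgroup S (mulG B)" using Soc_mul_subgroup[OF sS] SL L(2) by blast
  have "subbrace (restrict_brace B L) S"
    unfolding subbrace_def addG_restrict mulG_restrict
    using add.subgroup_incl[OF sS sL SL] mul.subgroup_incl[OF mS mL SL] by blast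
  moreover have "F \<subseteq> S" unfolding S_def by (auto intro: generate.incl)
  ultimately have "brace_generate (restrict_brace B L) F \<subseteq> S"
    unfolding brace_generate_def by (intro Inter_lower) simp
  then have "L \<subseteq> S" using F(3) by simp
  then have LS: "generate (addG B) F = L" using SL by (auto simp: S_def)
  interpret R: comm_group "(addG B)\<lparr>carrier := L\<rparr>" by (rule Soc_restrict_comm_group[OF sL L(2)])
  have "generate ((addG B)\<lparr>carrier := L\<rparr>) F = L" using add.generate_consistent[OF F(2) sL] LS by simp
  then have "subgroups_fin_gen ((addG B)\<lparr>carrier := L\<rparr>) L"
    using R.subgroups_fin_gen_generate[OF F(1)] F(2) by simp
  then show ?thesis using add.subgroups_fin_gen_restrict[OF sL] by simp
qed

text \<open>Induction along the series: each section is finite or a finitely generated part of a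
  socle, and the Noetherian condition passes to extensions.\<close>

lemma almost_polycyclic_fin_gen:
  assumes "almost_polycyclic B"
  shows "subgroups_fin_gen (addG B) C"
proof (rule almost_polycyclicE[OF assms])
  fix n J assume J: "J 0 = {\<zero>}" "J n = C" "\<And>i. i \<le> n \<Longrightarrow> brace_ideal B (J i)"
    and step: "\<And>i. i < n \<Longrightarrow> coset (J i) ` J (Suc i) \<subseteq> Soc (quot_brace B (J i)) \<and>
          fin_gen_brace (restrict_brace (quot_brace B (J i)) (coset (J i) ` J (Suc i)))
         \<or> finite (coset (J i) ` J (Suc i))"
  have "i \<le> n \<Longrightarrow> subgroups_fin_gen (addG B) (J i)" for i
  proof (induction i)
    case 0
    then show ?case by (simp add: J(1) add.subgroups_fin_gen_finite)
  next
    case (Suc i)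
    then have i: "i < n" by simp
    interpret I: ideal_of B "J i" using J(3) i by (intro idealI) simp
    interpret Q: skew_brace "quot_brace B (J i)" by (rule I.quot_skew_brace)
    define L where "L = coset (J i) ` J (Suc i)"
    have iL: "brace_ideal (quot_brace B (J i)) L" unfolding L_def
      by (rule brace_epi.ideal_image[OF I.coset_epi J(3)[OF Suc.prems]])
    have "(L \<subseteq> Soc (quot_brace B (J i)) \<and> fin_gen_brace (restrict_brace (quot_brace B (J i)) L)) \<or> finite L"
      using step[OF i] by (simp add: L_def)
    then have "subgroups_fin_gen (addG (quot_brace B (J i))) L"
      using Q.fin_gen_Soc_section[OF iL] Q.add.subgroups_fin_gen_finite by blast
    then show ?case
      using I.addn.subgroups_fin_gen_preimage[OF Suc.IH, of L "J (Suc i)"] i by (simp add: addG_quot L_def)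
  qed
  from this[of n] show ?thesis by (simp add: J(2))
qed


end

context brace_epi
begin

lemma subgroups_fin_gen_image:
  assumes "subgroups_fin_gen (addG B) (bcar B)"
  shows "subgroups_fin_gen (addG Q) (bcar Q)"
  unfolding subgroups_fin_gen_def
proof (intro allI impI)
  fix K assume "subgroup K (addG Q) \<and> K \<subseteq> bcar Q"
  then have K: "subgroup K (addG Q)" "K \<subseteq> bcar Q" by auto
  have pC: "pre K \<subseteq> bcar B" by (auto simp: pre_def)
  from subgroups_fin_genE[OF assms subgroup_pre_add[OF K(1)] pC]
  obtain F where F: "finite F" "F \<subseteq> pre K" "generate (addG B) F = pre K" .
  have "generate (addG Q) (h ` F) = h ` generate (addG B) F"
    using group_hom.generate_img[OF add_hom, of F] F(2) pC by auto
  also have "\<dots> = K" using F(3) h_pre[OF K(2)] by simp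
  finally have "generate (addG Q) (h ` F) = K" .
  moreover have "h ` F \<subseteq> K" using F(2) by (auto simp: pre_def)
  ultimately show "\<exists>F. finite F \<and> F \<subseteq> K \<and> generate (addG Q) F = K" using F(1) by blast
qed

end

context ideal_of
begin

lemma quot_pre_full: "brace_epi.pre B (coset I) (bcar (quot_brace B I)) = C"
  by (auto simp: brace_epi.pre_def[OF coset_epi] bcar_quot)

lemma quot_pre_zero: "brace_epi.pre B (coset I) {bzero (quot_brace B I)} = I"
proof -
  have "brace_epi.pre B (coset I) {bzero (quot_brace B I)} = {x \<in> C. x \<in> I}"
    unfolding brace_epi.pre_def[OF coset_epi]
    by (intro Collect_cong) (simp add: quot_zero coset_zero cong: conj_cong)
  then show ?thesis using in_car by blast
qed

lemma quot_image_zero: "coset I ` {\<zero>} = {bzero (quot_brace B I)}"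
  using coset_zero[of \<zero>] addn.one_closed by (simp add: quot_zero)

lemma quot_image_full: "coset I ` C = bcar (quot_brace B I)"
  by (simp add: bcar_quot)

lemma quot_supersoluble:
  assumes "supersoluble B"
  shows "supersoluble (quot_brace B I)"
proof -
  interpret Q: skew_brace "quot_brace B I" by (rule quot_skew_brace)
  have "(weak_step B)\<^sup>*\<^sup>* {\<zero>} C" using assms supersoluble_iff_weak by simp
  then have "(weak_step (quot_brace B I))\<^sup>*\<^sup>* (coset I ` {\<zero>}) (coset I ` C)"
    by (rule brace_epi.weak_chain_image[OF coset_epi])
  then show ?thesis unfolding quot_image_zero quot_image_full by (simp add: Q.supersoluble_iff_weak)
qed

lemma chain_from_quot:
  assumes "(weak_step (quot_brace B I))\<^sup>*\<^sup>* {bzero (quot_brace B I)} (bcar (quot_brace B I))"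
  shows "(weak_step B)\<^sup>*\<^sup>* I C"
  using brace_epi.weak_chain_pre[OF coset_epi assms] unfolding quot_pre_zero quot_pre_full .

text \<open>The witness is the image of the first term of the series that is not contained in \<open>I\<close>.\<close>

lemma quot_bottom_ideal:
  assumes ap: "almost_polycyclic B" and proper: "I \<noteq> C"
  shows "\<exists>A. brace_ideal (quot_brace B I) A \<and> A \<noteq> {bzero (quot_brace B I)} \<and>
    (finite A \<or> A \<subseteq> Soc (quot_brace B I))"
proof (rule almost_polycyclicE[OF ap])
  fix n J assume J: "J 0 = {\<zero>}" "J n = C" "\<And>i. i \<le> n \<Longrightarrow> brace_ideal B (J i)"
    and step: "\<And>i. i < n \<Longrightarrow> coset (J i) ` J (Suc i) \<subseteq> Soc (quot_brace B (J i)) \<and>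
          fin_gen_brace (restrict_brace (quot_brace B (J i)) (coset (J i) ` J (Suc i)))
         \<or> finite (coset (J i) ` J (Suc i))"
  have "\<not> J n \<subseteq> I" using J(2) proper in_car by auto
  moreover have "J 0 \<subseteq> I" using J(1) addn.one_closed by simp
  ultimately obtain i where i: "i < n" "J i \<subseteq> I" "\<not> J (Suc i) \<subseteq> I"
    using ex_least_nat_less[of "\<lambda>i. \<not> J i \<subseteq> I" n] by auto
  interpret Ji: ideal_of B "J i" using J(3)[of i] i(1) by (intro idealI) simp
  have iK: "brace_ideal B (J (Suc i))" using J(3) i(1) by simp
  have KC: "J (Suc i) \<subseteq> C" using ideal_of.in_car[OF idealI[OF iK]] by blast
  define A where "A = coset I ` J (Suc i)"
  have iA: "brace_ideal (quot_brace B I) A" unfolding A_def by (rule brace_epi.ideal_image[OF coset_epi iK])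
  have neA: "A \<noteq> {bzero (quot_brace B I)}"
  proof
    assume A0: "A = {bzero (quot_brace B I)}"
    have "x \<in> I" if "x \<in> J (Suc i)" for x
    proof -
      have "coset I x \<in> A" using that by (simp add: A_def)
      then show ?thesis using A0 KC that coset_zero[of x] by (auto simp: quot_zero)
    qed
    then show False using i(3) by blast
  qed
  have mono: "coset I x = coset I y" if "coset (J i) x = coset (J i) y" "x \<in> C" "y \<in> C" for x y
  proof -
    have "x \<oplus> \<ominus> y \<in> J i" using that(1) Ji.coset_eq[OF that(2,3)] by simp
    then show ?thesis using i(2) coset_eq[OF that(2,3)] by blast
  qed
  have "finite A \<or> A \<subseteq> Soc (quot_brace B I)"
    using step[OF i(1)]
  proof
    assume "coset (J i) ` J (Suc i) \<subseteq> Soc (quot_brace B (J i)) \<and>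
          fin_gen_brace (restrict_brace (quot_brace B (J i)) (coset (J i) ` J (Suc i)))"
    then have "central_mod B (J i) (J (Suc i))" by (simp add: central_mod_def)
    then have cen: "coset (J i) (lam B a b) = coset (J i) b" "coset (J i) (a \<oplus> b) = coset (J i) (b \<oplus> a)"
      if "a \<in> J (Suc i)" "b \<in> C" for a b
      using that unfolding Ji.central_mod_iff[OF KC] by auto
    have "coset I (lam B a b) = coset I b \<and> coset I (a \<oplus> b) = coset I (b \<oplus> a)"
      if a: "a \<in> J (Suc i)" and b: "b \<in> C" for a b
    proof -
      have ac: "a \<in> C" using a KC by blast
      show ?thesis
        using mono[OF cen(1)[OF a b] lam_closed[OF ac b] b]
          mono[OF cen(2)[OF a b] add.m_closed[OF ac b] add.m_closed[OF b ac]] by blast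
    qed
    then have "central_mod B I (J (Suc i))" unfolding central_mod_iff[OF KC] by blast
    then show ?thesis by (simp add: central_mod_def A_def)
  next
    assume fin: "finite (coset (J i) ` J (Suc i))"
    \<comment> \<open>Since \<open>J i\<close> is contained in \<open>I\<close>, cosets of
      \<open>I\<close> depend only on cosets of \<open>J i\<close>; with chosen representatives
      \<open>A\<close> is an image of a finite set.\<close>
    define r where "r = (\<lambda>X. SOME x. x \<in> J (Suc i) \<and> coset (J i) x = X)"
    have "coset I x = coset I (r (coset (J i) x))" if x: "x \<in> J (Suc i)" for x
    proof -
      have "r (coset (J i) x) \<in> J (Suc i) \<and> coset (J i) (r (coset (J i) x)) = coset (J i) x"
        unfolding r_def by (rule someI[of _ x]) (simp add: x)
      then show ?thesis using x KC by (intro mono) auto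
    qed
    then have "A \<subseteq> (\<lambda>X. coset I (r X)) ` (coset (J i) ` J (Suc i))" by (auto simp: A_def)
    then show ?thesis using fin finite_subset by blast
  qed
  with iA neA show ?thesis by blast
qed

end

theorem theorem3p51:
  fixes B :: "'a brace"
  assumes "is_brace B" and "almost_polycyclic B"
  shows "supersoluble B \<longleftrightarrow>
    (\<forall>I. brace_ideal B I \<and> finite (bcar (quot_brace B I)) \<longrightarrow> supersoluble (quot_brace B I))"
proof
  interpret skew_brace B by unfold_locales (rule assms(1))
  show "\<forall>I. brace_ideal B I \<and> finite (bcar (quot_brace B I)) \<longrightarrow> supersoluble (quot_brace B I)"
    if "supersoluble B"
    using ideal_of.quot_supersoluble[OF idealI that] by blast
  assume finq: "\<forall>I. brace_ideal B I \<and> finite (bcar (quot_brace B I)) \<longrightarrow> supersoluble (quot_brace B I)"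
  have fg: "subgroups_fin_gen (addG B) C" by (rule almost_polycyclic_fin_gen[OF assms(2)])
  show "supersoluble B"
  proof (rule ccontr)
    assume "\<not> supersoluble B"
    then have bad0: "\<not> (weak_step B)\<^sup>*\<^sup>* {\<zero>} C" using supersoluble_iff_weak by simp
    \<comment> \<open>Failure of a quotient is recorded as the absence of a chain from
      \<open>I\<close> to the top of \<open>B\<close>. All candidates are then additive subgroups of
      the one group, to which the Noetherian condition applies.\<close>
    define \<A> where "\<A> = {I. brace_ideal B I \<and> \<not> (weak_step B)\<^sup>*\<^sup>* I C}"
    have "\<exists>M\<in>\<A>. \<forall>X\<in>\<A>. M \<subseteq> X \<longrightarrow> X = M"
    proof (rule add.subgroups_fin_gen_maximal[OF fg])
      show "\<A> \<noteq> {}" using bad0 zero_ideal by (auto simp: \<A>_def)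
      show "subgroup H (addG B)" if "H \<in> \<A>" for H using that by (auto simp: \<A>_def brace_ideal_def subbrace_def)
    qed
    then obtain I where I: "I \<in> \<A>" and max: "\<forall>X\<in>\<A>. I \<subseteq> X \<longrightarrow> X = I" by (elim bexE)
    have iI: "brace_ideal B I" and bad: "\<not> (weak_step B)\<^sup>*\<^sup>* I C" using I by (auto simp: \<A>_def)
    interpret I: ideal_of B I using iI by (rule idealI)
    define Q where "Q = quot_brace B I"
    interpret e: brace_epi B Q "coset I" unfolding Q_def by (rule I.coset_epi)
    have inf: "infinite (bcar Q)"
    proof
      assume "finite (bcar Q)"
      then have "supersoluble Q" using finq iI by (simp add: Q_def)
      then have "(weak_step Q)\<^sup>*\<^sup>* {bzero Q} (bcar Q)" using e.Q.supersoluble_iff_weak by simp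
      then show False using bad I.chain_from_quot by (simp add: Q_def)
    qed
    \<comment> \<open>Proper quotients of \<open>Q\<close> are handled through \<open>B\<close>: the
      preimage of \<open>N\<close> properly contains \<open>I\<close>, so a chain above it exists by
      maximality, and its image is a chain in \<open>Q\<close>. Quotients of quotients are never
      formed.\<close>
    have chain: "(weak_step Q)\<^sup>*\<^sup>* N (bcar Q)" if N: "brace_ideal Q N" "N \<noteq> {bzero Q}" for N
    proof -
      have iP: "brace_ideal B (e.pre N)" by (rule e.ideal_pre[OF N(1)])
      have NQ: "N \<subseteq> bcar Q" using ideal_of.in_car[OF e.Q.idealI[OF N(1)]] by blast
      have "bzero Q \<in> N" using N(1) subgroup.one_closed[of N "addG Q"] by (simp add: brace_ideal_def subbrace_def)
      have "I \<subseteq> e.pre N"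
      proof
        fix x assume x: "x \<in> I"
        have "coset I x = bzero Q"
          using I.coset_zero[OF I.in_car[OF x]] x by (simp add: Q_def I.quot_zero)
        then show "x \<in> e.pre N" using \<open>bzero Q \<in> N\<close> I.in_car[OF x] by (simp add: e.pre_def)
      qed
      moreover have "e.pre N \<noteq> I"
      proof
        assume eq: "e.pre N = I"
        have "coset I x = bzero Q" if "x \<in> I" for x
          using I.coset_zero[OF I.in_car[OF that]] that by (simp add: Q_def I.quot_zero)
        then have "coset I ` e.pre N \<subseteq> {bzero Q}" unfolding eq by blast
        then show False using e.h_pre[OF NQ] N(2) \<open>bzero Q \<in> N\<close> by blast
      qed
      ultimately have "(weak_step B)\<^sup>*\<^sup>* (e.pre N) C" using max iP by (auto simp: \<A>_def)
      from e.weak_chain_image[OF this] show ?thesis using e.h_pre[OF NQ] e.surj by simp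
    qed
    have fgQ: "subgroups_fin_gen (addG Q) (bcar Q)" by (rule e.subgroups_fin_gen_image[OF fg])
    have "I \<noteq> C" using bad by auto
    from I.quot_bottom_ideal[OF assms(2) this] obtain A where
      A: "brace_ideal Q A" "A \<noteq> {bzero Q}" "finite A \<or> A \<subseteq> Soc Q" unfolding Q_def by blast
    have "(weak_step Q)\<^sup>*\<^sup>* {bzero Q} (bcar Q)"
    proof (cases "\<exists>F. brace_ideal Q F \<and> finite F \<and> F \<noteq> {bzero Q}")
      case True
      then show ?thesis using e.Q.chain_of_finite_ideal[OF fgQ inf chain] by blast
    next
      case False
      then have "A \<subseteq> Soc Q" using A by blast
      then show ?thesis using e.Q.chain_of_Soc_ideal[OF fgQ chain A(1) _ A(2)] False by blast
    qed
    then show False using bad I.chain_from_quot by (simp add: Q_def)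
  qed
qed

end
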